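(* Let $d=2$ and $\kappa=2$. Let $\mathcal{E}_0=1+\cos(\pi/2)=1$ and let $\mathcal{E}_1$ be as defined in the context. Then $(2/3,1)=(\mathcal{E}_1,\mathcal{E}_0)\subset\boldsymbol{\mu}_{\kappa}(\Delta)$. Specifically, with the conjugate operator $\mathbb{A}=A_2+\frac{9}{14}A_4$, for every $E\in(\mathcal{E}_1,\mathcal{E}_0)$ there exist an open interval $I\ni E$ and $\gamma>0$ such that $1_I(\Delta)[\Delta,\mathrm{i}\mathbb{A}]_\circ1_I(\Delta)\ge\gamma1_I(\Delta)$.
   Context: Here $d=2$. On $\mathscr{H}=\ell^2(\mathbb{Z}^d)$ let $(S_i^{\pm1}u)(n)=u(n_1,\dots,n_i\mp1,\dots,n_d)$, $\Delta=\sum_{i=1}^d\frac12(S_i+S_i^{*})$ (so $\sigma(\Delta)=[-d,d]$), and $(N_iu)(n)=n_iu(n)$. For integers $j,\kappa\ge1$ let $A_i(j,\kappa)$ be the closure of the operator $\frac{1}{4\mathrm{i}}\left[(S_i^{j\kappa}-S_i^{-j\kappa})N_i+N_i(S_i^{j\kappa}-S_i^{-j\kappa})\right]$ defined on compactly supported sequences, and $A_{j\kappa}=\sum_{i=1}^dA_i(j,\kappa)$ (self-adjoint). Thus $A_2$ corresponds to $j\kappa=2$ and $A_4$ to $j\kappa=4$. The conjugate operators considered are the self-adjoint linear combinations (finite or infinite) $\mathbb{A}=\sum_{j\ge1}\rho_{j\kappa}A_{j\kappa}$, $\rho_{j\kappa}\in\mathbb{R}$; $[\Delta,\mathrm{i}\mathbb{A}]_\circ$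 is the bounded extension to $\mathscr{H}$ of the commutator initially defined on compactly supported sequences. $\boldsymbol{\mu}_\kappa(\Delta)$ is the set of $E\in\sigma(\Delta)$ for which there exist such an $\mathbb{A}$, an open interval $I\ni E$ and $\gamma>0$ with $1_I(\Delta)[\Delta,\mathrm{i}\mathbb{A}]_\circ1_I(\Delta)\ge\gamma1_I(\Delta)$ ($1_I(\Delta)$ is the spectral projection). $\mathcal{E}_1$ (for $\kappa=2$) is the unique number in $(2\cos(\pi/2),1+\cos(\pi/2))=(0,1)$ for which there are real $X_0,X_1,X_2$ with $T_2(X_0)=T_2(X_1)$, $X_1=\mathcal{E}_1-X_1$, $X_2=\mathcal{E}_1-X_0$ and $\mathcal{E}_1-1=X_0<\cos(\pi/2)<X_1<X_2=1$, where $T_2(x)=2x^2-1$. *)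

theory Defs
  imports "HOL-Analysis.Analysis"
begin

section \<open>The Hilbert space of square-summable complex families\<close>

typedef 'a ell2 = "{u :: 'a \<Rightarrow> complex. (\<lambda>n. (cmod (u n))\<^sup>2) summable_on UNIV}"
  morphisms coord Abs_ell2
  by (rule exI[of _ "\<lambda>_. 0"]) simp

setup_lifting type_definition_ell2

lemma square_summable_add:
  fixes f g :: "'a \<Rightarrow> complex"
  assumes "(\<lambda>n. (cmod (f n))\<^sup>2) summable_on UNIV" "(\<lambda>n. (cmod (g n))\<^sup>2) summable_on UNIV"
  shows "(\<lambda>n. (cmod (f n + g n))\<^sup>2) summable_on UNIV"
proof (rule summable_on_comparison_test)
  show "(\<lambda>n. 2 * (cmod (f n))\<^sup>2 + 2 * (cmod (g n))\<^sup>2) summable_on UNIV"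
    by (intro summable_on_add summable_on_cmult_right assms)
  show "(cmod (f n + g n))\<^sup>2 \<le> 2 * (cmod (f n))\<^sup>2 + 2 * (cmod (g n))\<^sup>2" for n
  proof -
    have "(cmod (f n + g n))\<^sup>2 \<le> (cmod (f n) + cmod (g n))\<^sup>2"
      by (intro power_mono norm_triangle_ineq) auto
    also have "\<dots> \<le> 2 * (cmod (f n))\<^sup>2 + 2 * (cmod (g n))\<^sup>2"
      using sum_squares_bound[of "cmod (f n)" "cmod (g n)"]
      by (simp add: power2_sum)
    finally show ?thesis .
  qed
qed auto

lemma square_summable_cmult:
  fixes f :: "'a \<Rightarrow> complex"
  assumes "(\<lambda>n. (cmod (f n))\<^sup>2) summable_on UNIV"
  shows "(\<lambda>n. (cmod (c * f n))\<^sup>2) summable_on UNIV"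
  by (simp add: norm_mult power_mult_distrib summable_on_cmult_right assms)

lift_definition cscale :: "complex \<Rightarrow> 'a ell2 \<Rightarrow> 'a ell2" (infixr "*\<^sub>C" 75)
  is "\<lambda>c u n. c * u n"
  by (rule square_summable_cmult)

definition cinner :: "'a ell2 \<Rightarrow> 'a ell2 \<Rightarrow> complex" where
  "cinner u v = (\<Sum>\<^sub>\<infinity>n. cnj (coord u n) * coord v n)"

lemma coord_summable: "(\<lambda>n. (cmod (coord u n))\<^sup>2) summable_on UNIV"
  using coord[of u] by simp

lemma cinner_summable: "(\<lambda>n. cnj (coord u n) * coord v n) summable_on UNIV"
proof (rule abs_summable_summable)
  show "(\<lambda>n. norm (cnj (coord u n) * coord v n)) summable_on UNIV"
  proof (rule summable_on_comparison_test)
    show "(\<lambda>n. (cmod (coord u n))\<^sup>2 + (cmod (coord v n))\<^sup>2) summable_on UNIV"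
      by (intro summable_on_add coord_summable)
    show "norm (cnj (coord u n) * coord v n) \<le> (cmod (coord u n))\<^sup>2 + (cmod (coord v n))\<^sup>2" for n
    proof -
      have "2 * (cmod (coord u n) * cmod (coord v n)) \<le> (cmod (coord u n))\<^sup>2 + (cmod (coord v n))\<^sup>2"
        using sum_squares_bound[of "cmod (coord u n)" "cmod (coord v n)"] by simp
      moreover have "0 \<le> cmod (coord u n) * cmod (coord v n)" by simp
      ultimately have "cmod (coord u n) * cmod (coord v n) \<le> (cmod (coord u n))\<^sup>2 + (cmod (coord v n))\<^sup>2"
        by linarith
      then show ?thesis by (simp add: norm_mult)
    qed
  qed auto
qed

lemma cinner_self: "cinner u u = of_real (\<Sum>\<^sub>\<infinity>n. (cmod (coord u n))\<^sup>2)"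
proof -
  have "cinner u u = (\<Sum>\<^sub>\<infinity>n. of_real ((cmod (coord u n))\<^sup>2))"
    unfolding cinner_def
    by (intro infsum_cong) (simp add: complex_norm_square mult.commute del: of_real_power)
  also have "\<dots> = of_real (\<Sum>\<^sub>\<infinity>n. (cmod (coord u n))\<^sup>2)"
    by (intro infsumI has_sum_of_real has_sum_infsum coord_summable)
  finally show ?thesis .
qed

instantiation ell2 :: (type) real_vector
begin

lift_definition zero_ell2 :: "'a ell2" is "\<lambda>_. 0" by simp
lift_definition plus_ell2 :: "'a ell2 \<Rightarrow> 'a ell2 \<Rightarrow> 'a ell2" is "\<lambda>u v n. u n + v n"
  by (rule square_summable_add)
lift_definition uminus_ell2 :: "'a ell2 \<Rightarrow> 'a ell2" is "\<lambda>u n. - u n" by simp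
lift_definition minus_ell2 :: "'a ell2 \<Rightarrow> 'a ell2 \<Rightarrow> 'a ell2" is "\<lambda>u v n. u n - v n"
  using square_summable_add[of _ "\<lambda>n. - _ n"] by simp
lift_definition scaleR_ell2 :: "real \<Rightarrow> 'a ell2 \<Rightarrow> 'a ell2" is "\<lambda>r u n. r *\<^sub>R u n"
  by (simp add: scaleR_conv_of_real square_summable_cmult)

instance
proof
  fix a b c :: "'a ell2" and r s :: real
  show "a + b + c = a + (b + c)" by transfer (simp add: add.assoc)
  show "a + b = b + a" by transfer (simp add: add.commute)
  show "0 + a = a" by transfer simp
  show "- a + a = 0" by transfer simp
  show "a - b = a + - b" by transfer simp
  show "r *\<^sub>R (a + b) = r *\<^sub>R a + r *\<^sub>R b" by transfer (simp add: scaleR_add_right)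
  show "(r + s) *\<^sub>R a = r *\<^sub>R a + s *\<^sub>R a" by transfer (simp add: scaleR_add_left)
  show "r *\<^sub>R s *\<^sub>R a = (r * s) *\<^sub>R a" by transfer simp
  show "1 *\<^sub>R a = a" by transfer simp
qed

end

instantiation ell2 :: (type) real_inner
begin

definition inner_ell2 :: "'a ell2 \<Rightarrow> 'a ell2 \<Rightarrow> real" where
  "inner_ell2 u v = Re (cinner u v)"
definition norm_ell2 :: "'a ell2 \<Rightarrow> real" where
  "norm_ell2 u = sqrt (\<Sum>\<^sub>\<infinity>n. (cmod (coord u n))\<^sup>2)"
definition dist_ell2 :: "'a ell2 \<Rightarrow> 'a ell2 \<Rightarrow> real" where
  "dist_ell2 u v = norm (u - v)"
definition sgn_ell2 :: "'a ell2 \<Rightarrow> 'a ell2" where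
  "sgn_ell2 u = u /\<^sub>R norm u"
definition uniformity_ell2 :: "('a ell2 \<times> 'a ell2) filter" where
  "uniformity_ell2 = (INF e\<in>{0<..}. principal {(x, y). dist x y < e})"
definition open_ell2 :: "'a ell2 set \<Rightarrow> bool" where
  "open_ell2 U = (\<forall>x\<in>U. eventually (\<lambda>(x', y). x' = x \<longrightarrow> y \<in> U) uniformity)"

instance
proof
  fix a b c :: "'a ell2" and r s :: real
  show "dist a b = norm (a - b)" by (rule dist_ell2_def)
  show "sgn a = a /\<^sub>R norm a" by (rule sgn_ell2_def)
  show "(uniformity :: ('a ell2 \<times> 'a ell2) filter) = (INF e\<in>{0<..}. principal {(x, y). dist x y < e})"
    by (rule uniformity_ell2_def)
  show "open U = (\<forall>x\<in>U. eventually (\<lambda>(x', y). x' = x \<longrightarrow> y \<in> U) uniformity)" for U :: "'a ell2 set"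
    by (rule open_ell2_def)
  have "cinner b a = cnj (cinner a b)"
    unfolding cinner_def by (simp add: infsum_cnj[symmetric] mult.commute)
  then show "inner a b = inner b a" by (simp add: inner_ell2_def)
  have "cinner (a + b) c = cinner a c + cinner b c"
    unfolding cinner_def
    by (simp add: plus_ell2.rep_eq distrib_right infsum_add cinner_summable)
  then show "inner (a + b) c = inner a c + inner b c" by (simp add: inner_ell2_def)
  have "cinner (r *\<^sub>R a) b = r *\<^sub>R cinner a b"
    unfolding cinner_def
    by (simp add: scaleR_ell2.rep_eq scaleR_conv_of_real mult.assoc infsum_cmult_right')
  then show "inner (r *\<^sub>R a) b = r * inner a b" by (simp add: inner_ell2_def)
  show "0 \<le> inner a a" by (simp add: inner_ell2_def cinner_self infsum_nonneg)
  show "(inner a a = 0) = (a = 0)"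
  proof
    assume "inner a a = 0"
    then have "(\<Sum>\<^sub>\<infinity>n. (cmod (coord a n))\<^sup>2) = 0" by (simp add: inner_ell2_def cinner_self)
    then have "(cmod (coord a n))\<^sup>2 = 0" for n
      using nonneg_infsum_le_0D[of "\<lambda>n. (cmod (coord a n))\<^sup>2" UNIV n] coord_summable[of a] by simp
    then have "coord a = coord 0" by (auto simp: zero_ell2.rep_eq)
    then show "a = 0" by (simp add: coord_inject)
  next
    assume "a = 0"
    then show "inner a a = 0" by (simp add: inner_ell2_def cinner_def zero_ell2.rep_eq)
  qed
  show "norm a = sqrt (inner a a)" by (simp add: norm_ell2_def inner_ell2_def cinner_self)
qed

end

section \<open>Bounded and unbounded operators\<close>

definition bounded_op :: "('a ell2 \<Rightarrow> 'a ell2) \<Rightarrow> bool" where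
  "bounded_op T \<longleftrightarrow> bounded_linear T \<and> (\<forall>c u. T (c *\<^sub>C u) = c *\<^sub>C T u)"

definition op_le :: "('a ell2 \<Rightarrow> 'a ell2) \<Rightarrow> ('a ell2 \<Rightarrow> 'a ell2) \<Rightarrow> bool" where
  "op_le S T \<longleftrightarrow> (\<forall>u. cinner u (T u - S u) \<in> \<real> \<and> 0 \<le> Re (cinner u (T u - S u)))"

definition spectrum :: "('a ell2 \<Rightarrow> 'a ell2) \<Rightarrow> complex set" where
  "spectrum T = {z. \<not> (\<exists>R. bounded_op R \<and>
      (\<forall>u. R (T u - z *\<^sub>C u) = u) \<and> (\<forall>u. T (R u) - z *\<^sub>C R u = u))}"

definition orthogonal_projection :: "('a ell2 \<Rightarrow> 'a ell2) \<Rightarrow> bool" where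
  "orthogonal_projection Q \<longleftrightarrow> bounded_op Q \<and> (\<forall>u. Q (Q u) = Q u) \<and>
     (\<forall>u v. cinner (Q u) v = cinner u (Q v))"

definition is_spectral_measure ::
    "('a ell2 \<Rightarrow> 'a ell2) \<Rightarrow> (real set \<Rightarrow> 'a ell2 \<Rightarrow> 'a ell2) \<Rightarrow> bool" where
  "is_spectral_measure T P \<longleftrightarrow>
     (\<forall>B\<in>sets borel. orthogonal_projection (P B)) \<and>
     P UNIV = id \<and>
     (\<forall>B :: nat \<Rightarrow> real set. range B \<subseteq> sets borel \<longrightarrow> disjoint_family B \<longrightarrow>
        (\<forall>u. (\<lambda>k. P (B k) u) sums P (\<Union>k. B k) u)) \<and>
     (\<forall>u. let \<mu> = measure_of UNIV (sets borel) (\<lambda>B. ennreal (Re (cinner u (P B u)))) in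
        integrable \<mu> (\<lambda>x. x) \<and> cinner u (T u) = complex_of_real (\<integral>x. x \<partial>\<mu>))"

text \<open>
  \<open>spectral_projection T B\<close> is \<open>1\<^sub>B(T)\<close>, for \<open>T\<close> bounded and self-adjoint and \<open>B\<close> a Borel set.
  By the spectral theorem a projection-valued measure representing \<open>T\<close> exists and its values on
  Borel sets are unique, so the choice does not matter.
\<close>
definition spectral_projection :: "('a ell2 \<Rightarrow> 'a ell2) \<Rightarrow> real set \<Rightarrow> 'a ell2 \<Rightarrow> 'a ell2" where
  "spectral_projection T = (SOME P. is_spectral_measure T P)"

text \<open>
  An unbounded operator is represented by its graph, so that its closure is the topological
  closure of the graph in the product space.
\<close>
type_synonym 'a graph = "('a ell2 \<times> 'a ell2) set"

definition adjoint_graph :: "'a graph \<Rightarrow> 'a graph" where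
  "adjoint_graph G = {(v, w). \<forall>(x, y)\<in>G. cinner v y = cinner w x}"

definition self_adjoint :: "'a graph \<Rightarrow> bool" where
  "self_adjoint G \<longleftrightarrow> closure (Domain G) = UNIV \<and> adjoint_graph G = G"

definition compactly_supported :: "'a ell2 \<Rightarrow> bool" where
  "compactly_supported u \<longleftrightarrow> finite {n. coord u n \<noteq> 0}"

text \<open>
  \<open>C\<close> is the bounded extension of the commutator of \<open>T\<close> with \<open>i\<close> times the operator with graph \<open>G\<close>,
  the commutator being defined on compactly supported sequences. By density \<open>C\<close> is unique.
\<close>
definition is_commutator_ext :: "('a ell2 \<Rightarrow> 'a ell2) \<Rightarrow> 'a graph \<Rightarrow> ('a ell2 \<Rightarrow> 'a ell2) \<Rightarrow> bool" where
  "is_commutator_ext T G C \<longleftrightarrow> bounded_op C \<and>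
     (\<forall>u. compactly_supported u \<longrightarrow>
        (\<exists>v w. (u, v) \<in> G \<and> (T u, w) \<in> G \<and> C u = T (\<i> *\<^sub>C v) - \<i> *\<^sub>C w))"

section \<open>The Laplacian and the conjugate operators\<close>

text \<open>\<open>shift_seq i m\<close> is \<open>S\<^sub>i\<close> to the power \<open>m\<close>, acting on arbitrary sequences.\<close>
definition shift_seq :: "'d::finite \<Rightarrow> int \<Rightarrow> (int ^ 'd \<Rightarrow> complex) \<Rightarrow> int ^ 'd \<Rightarrow> complex" where
  "shift_seq i m u n = u (n - axis i m)"

definition position_seq :: "'d::finite \<Rightarrow> (int ^ 'd \<Rightarrow> complex) \<Rightarrow> int ^ 'd \<Rightarrow> complex" where
  "position_seq i u n = of_int (n $ i) * u n"

lemma shift_seq_add: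
  fixes i :: "'d::finite"
  shows "shift_seq i (a + b) = shift_seq i a \<circ> shift_seq i b"
proof -
  have eq: "n - axis i (a + b) = n - axis i a - axis i b" for n :: "int ^ 'd"
    by (simp add: vec_eq_iff axis_def)
  show ?thesis
    by (intro ext) (simp only: shift_seq_def comp_apply eq)
qed

lemma shift_seq_0:
  fixes i :: "'d::finite"
  shows "shift_seq i 0 = id"
proof -
  have eq: "n - axis i 0 = n" for n :: "int ^ 'd"
    by (simp add: vec_eq_iff axis_def)
  show ?thesis
    by (intro ext) (simp only: shift_seq_def id_apply eq)
qed

lemma shift_seq_funpow:
  "shift_seq i (int m) = shift_seq i 1 ^^ m" "shift_seq i (- int m) = shift_seq i (- 1) ^^ m"
proof -
  have pos: "int (Suc k) = 1 + int k" and neg: "- int (Suc k) = - 1 + - int k" for k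
    by simp_all
  show "shift_seq i (int m) = shift_seq i 1 ^^ m"
  proof (induction m)
    case (Suc m)
    then show ?case unfolding pos shift_seq_add funpow.simps by simp
  qed (simp add: shift_seq_0)
  show "shift_seq i (- int m) = shift_seq i (- 1) ^^ m"
  proof (induction m)
    case (Suc m)
    then show ?case unfolding neg shift_seq_add funpow.simps by simp
  qed (simp add: shift_seq_0)
qed

lift_definition shift :: "'d::finite \<Rightarrow> int \<Rightarrow> (int ^ 'd) ell2 \<Rightarrow> (int ^ 'd) ell2" is shift_seq
proof -
  fix i :: 'd and m and u :: "int ^ 'd \<Rightarrow> complex"
  assume "(\<lambda>n. (cmod (u n))\<^sup>2) summable_on UNIV"
  moreover have "bij_betw (\<lambda>n. n - axis i m) UNIV (UNIV :: (int ^ 'd) set)"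
    by (rule bij_betwI[where g="\<lambda>n. n + axis i m"]) auto
  ultimately show "(\<lambda>n. (cmod (shift_seq i m u n))\<^sup>2) summable_on UNIV"
    using summable_on_reindex_bij_betw[of "\<lambda>n. n - axis i m" UNIV UNIV "\<lambda>n. (cmod (u n))\<^sup>2"]
    by (simp add: shift_seq_def)
qed

lemma shift_adjoint:
  fixes i :: "'d::finite"
  shows "cinner (shift i m u) v = cinner u (shift i (- m) v)"
proof -
  have bij: "bij_betw (\<lambda>n. n + axis i m) UNIV (UNIV :: (int ^ 'd) set)"
    by (rule bij_betwI[where g="\<lambda>n. n - axis i m"]) auto
  have neg: "n - axis i (- m) = n + axis i m" for n
    by (simp add: vec_eq_iff axis_def)
  show ?thesis
    unfolding cinner_def
    by (subst infsum_reindex_bij_betw[OF bij, symmetric])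
       (simp add: shift.rep_eq shift_seq_def neg)
qed

text \<open>By \<open>shift_adjoint\<close>, \<open>shift i (- 1)\<close> is the adjoint of \<open>shift i 1\<close>.\<close>
definition laplacian :: "(int ^ 'd::finite) ell2 \<Rightarrow> (int ^ 'd) ell2" where
  "laplacian u = (\<Sum>i\<in>UNIV. (1/2) *\<^sub>R (shift i 1 u + shift i (- 1) u))"

definition shift_diff_seq :: "'d::finite \<Rightarrow> nat \<Rightarrow> (int ^ 'd \<Rightarrow> complex) \<Rightarrow> int ^ 'd \<Rightarrow> complex" where
  "shift_diff_seq i m u n = shift_seq i (int m) u n - shift_seq i (- int m) u n"

text \<open>Both families \<open>A\<^sub>i(j,\<kappa>)\<close> and \<open>A\<^bsub>j\<kappa>\<^esub>\<close> depend only on the product \<open>m = j\<kappa>\<close>.\<close>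
definition A_dir :: "'d::finite \<Rightarrow> nat \<Rightarrow> (int ^ 'd) graph" where
  "A_dir i m = closure {(u, v). compactly_supported u \<and>
     (\<forall>n. coord v n = 1 / (4 * \<i>) *
        (shift_diff_seq i m (position_seq i (coord u)) n
         + position_seq i (shift_diff_seq i m (coord u)) n))}"

text \<open>
  The algebraic sum of the commuting unbounded operators \<open>A\<^sub>i(j,\<kappa>)\<close> on the intersection of their
  domains is only essentially self-adjoint; the self-adjoint operator is its closure.
\<close>
definition A_op :: "nat \<Rightarrow> (int ^ 'd::finite) graph" where
  "A_op m = closure {(u, \<Sum>i\<in>UNIV. f i) | u f. \<forall>i. (u, f i) \<in> A_dir i m}"

text \<open>
  The linear combination of the \<open>A\<^bsub>j\<kappa>\<^esub>\<close>, \<open>j \<ge> 1\<close>, with real coefficients \<open>\<rho>\<^bsub>j\<kappa>\<^esub>\<close>: terms with zero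
  coefficient impose no domain condition, and the closure is taken as in \<open>A_op\<close>.
\<close>
definition conj_op :: "nat \<Rightarrow> (nat \<Rightarrow> real) \<Rightarrow> (int ^ 'd::finite) graph" where
  "conj_op \<kappa> \<rho> = closure {(u, v). \<exists>f.
     (\<forall>j\<ge>1. \<rho> (j * \<kappa>) \<noteq> 0 \<longrightarrow> (u, f j) \<in> A_op (j * \<kappa>)) \<and>
     (\<lambda>j. \<rho> (Suc j * \<kappa>) *\<^sub>R f (Suc j)) sums v}"

definition mourre_estimate ::
    "('a ell2 \<Rightarrow> 'a ell2) \<Rightarrow> ('a ell2 \<Rightarrow> 'a ell2) \<Rightarrow> real set \<Rightarrow> real \<Rightarrow> bool" where
  "mourre_estimate T C I \<gamma> \<longleftrightarrow>
     op_le (\<lambda>u. \<gamma> *\<^sub>R spectral_projection T I u)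
           (\<lambda>u. spectral_projection T I (C (spectral_projection T I u)))"

definition mu_set :: "nat \<Rightarrow> ((int ^ 'd::finite) ell2 \<Rightarrow> (int ^ 'd) ell2) \<Rightarrow> real set" where
  "mu_set \<kappa> T = {E. complex_of_real E \<in> spectrum T \<and>
     (\<exists>\<rho> C a b \<gamma>. self_adjoint (conj_op \<kappa> \<rho> :: (int ^ 'd) graph) \<and>
        is_commutator_ext T (conj_op \<kappa> \<rho>) C \<and>
        E \<in> {a<..<b} \<and> 0 < \<gamma> \<and> mourre_estimate T C {a<..<b} \<gamma>)}"

text \<open>The coefficients of \<open>A\<^sub>2 + (9/14) A\<^sub>4\<close>.\<close>
definition rho_9_14 :: "nat \<Rightarrow> real" where
  "rho_9_14 = (\<lambda>_. 0)(2 := 1, 4 := 9 / 14)"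

lemma conj_op_rho_9_14:
  "conj_op 2 rho_9_14 =
     closure {(u, v + (9 / 14) *\<^sub>R w) | u v w. (u, v) \<in> A_op 2 \<and> (u, w) \<in> A_op 4}"
  (is "_ = closure ?S")
proof -
  have rho: "rho_9_14 (j * 2) = (if j = 1 then 1 else if j = 2 then 9 / 14 else 0)" for j
    by (auto simp: rho_9_14_def)
  have sums: "(\<lambda>j. rho_9_14 (Suc j * 2) *\<^sub>R f (Suc j)) sums (f 1 + (9 / 14) *\<^sub>R f 2)"
    for f :: "nat \<Rightarrow> (int ^ 'a) ell2"
    using sums_finite[of "{0, 1}" "\<lambda>j. rho_9_14 (Suc j * 2) *\<^sub>R f (Suc j)"]
    unfolding rho by (simp add: numeral_2_eq_2)
  have "{(u, v). \<exists>f. (\<forall>j\<ge>1. rho_9_14 (j * 2) \<noteq> 0 \<longrightarrow> (u, f j) \<in> A_op (j * 2)) \<and>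
      (\<lambda>j. rho_9_14 (Suc j * 2) *\<^sub>R f (Suc j)) sums v} = ?S" (is "?L = _")
  proof (intro subset_antisym subsetI)
    fix p assume "p \<in> ?L"
    then obtain u v f where p: "p = (u, v)"
      and f: "\<And>j. j \<ge> 1 \<Longrightarrow> rho_9_14 (j * 2) \<noteq> 0 \<Longrightarrow> (u, f j) \<in> A_op (j * 2)"
      and "(\<lambda>j. rho_9_14 (Suc j * 2) *\<^sub>R f (Suc j)) sums v"
      by auto
    then have "v = f 1 + (9 / 14) *\<^sub>R f 2" using sums sums_unique2 by blast
    moreover have "(u, f 1) \<in> A_op 2" "(u, f 2) \<in> A_op 4"
      using f[of 1] f[of 2] by (auto simp: rho_9_14_def)
    ultimately show "p \<in> ?S" using p by blast
  next
    fix p assume "p \<in> ?S"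
    then obtain u v w where p: "p = (u, v + (9 / 14) *\<^sub>R w)"
      and vw: "(u, v) \<in> A_op 2" "(u, w) \<in> A_op 4" by blast
    define f where "f j = (if j = 1 then v else w)" for j :: nat
    have "\<forall>j\<ge>1. rho_9_14 (j * 2) \<noteq> 0 \<longrightarrow> (u, f j) \<in> A_op (j * 2)"
      using vw by (auto simp: rho f_def)
    moreover have "(\<lambda>j. rho_9_14 (Suc j * 2) *\<^sub>R f (Suc j)) sums (v + (9 / 14) *\<^sub>R w)"
      using sums[of f] by (simp add: f_def)
    ultimately show "p \<in> ?L" unfolding p by blast
  qed
  then show ?thesis by (simp only: conj_op_def)
qed

section \<open>The threshold energies for \<open>\<kappa> = 2\<close>\<close>

definition T2 :: "real \<Rightarrow> real" where
  "T2 x = 2 * x\<^sup>2 - 1"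

definition E0 :: real where
  "E0 = 1 + cos (pi / 2)"

definition is_E1 :: "real \<Rightarrow> bool" where
  "is_E1 E \<longleftrightarrow> E \<in> {2 * cos (pi / 2)<..<1 + cos (pi / 2)} \<and>
     (\<exists>X0 X1 X2. T2 X0 = T2 X1 \<and> X1 = E - X1 \<and> X2 = E - X0 \<and>
        E - 1 = X0 \<and> X0 < cos (pi / 2) \<and> cos (pi / 2) < X1 \<and> X1 < X2 \<and> X2 = 1)"

definition E1 :: real where
  "E1 = (THE E. is_E1 E)"

end

theory Submission
  imports Defs "HOL-Probability.Infinite_Product_Measure"
begin

text \<open>
  Under the Fourier transform \<open>\<Delta>\<close> becomes multiplication by \<open>cos \<theta>\<^sub>1 + cos \<theta>\<^sub>2\<close> on the torus, and a
  direct computation with shifts shows that the commutator with \<open>\<i>(A\<^sub>2 + (9/14) A\<^sub>4)\<close> becomes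
  multiplication by \<open>g(cos \<theta>\<^sub>1) + g(cos \<theta>\<^sub>2)\<close> with the polynomial
  \<open>g(x) = (4/7) x (1 - x\<^sup>2) (9 x\<^sup>2 - 1)\<close> (\<open>trig_laplacian\<close>, \<open>trig_dil_commutator\<close>). On the line
  \<open>x + y = E\<close> inside the square \<open>[-1, 1]\<^sup>2\<close> the sum \<open>g(x) + g(y)\<close> is \<open>E\<close> times a concave quadratic
  polynomial in \<open>x y\<close>, hence smallest at an end of the segment, where \<open>x = 1\<close>, or at its midpoint
  \<open>x = y\<close>. Both values are positive exactly because \<open>2/3 < E < 1\<close>
  (\<open>commutator_symbol_sum_pos\<close>); at \<open>E = 2/3\<close> both vanish, which is what the coefficient \<open>9/14\<close>
  achieves. By compactness \<open>g(x) + g(y) \<ge> c - K (x + y - E)\<^sup>2\<close> on the whole square for some \<open>c > 0\<close>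
  (\<open>penalised_lower_bound\<close>), and this pointwise inequality is the operator inequality
  \<open>C \<ge> c - K (\<Delta> - E)\<^sup>2\<close>. On the range of the spectral projection of \<open>(E - e, E + e)\<close> the last term
  is at least \<open>- K e\<^sup>2\<close>, so a small \<open>e\<close> gives the estimate with \<open>\<gamma> = c/2\<close>.

  Three facts about operators support this argument.

  The conjugate operator is self-adjoint because it is a symmetric difference operator whose
  coefficients grow linearly: cutting off at distance \<open>r\<close> by a function of slope \<open>1/r\<close> costs a
  commutator that is bounded uniformly in \<open>r\<close>, so the maximal operator is the closure of its
  restriction to finitely supported sequences (\<open>max_graph_subset_closure\<close>). All the closures in the
  definition of the conjugate operator lie between these two (\<open>self_adjoint_between\<close>).

  The spectral measure of \<open>\<Delta>\<close> exists: the projection of a Borel set \<open>B\<close> is the Fourier multiplier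
  by the indicator of \<open>{\<theta>. cos \<theta>\<^sub>1 + cos \<theta>\<^sub>2 \<in> B}\<close>. That it is idempotent is an instance of
  Parseval's identity, which is proved for exactly the functions that occur: they are limits of
  trigonometric polynomials, by Weierstrass approximation for half-lines and a Dynkin argument
  for all Borel sets (\<open>approximable_symbol_set\<close>).

  Finally, the estimate concerns an arbitrary spectral measure, of which only the quadratic form of
  \<open>\<Delta>\<close> is given. That form determines enough: \<open>\<Delta>\<close> leaves the spectral subspaces invariant and
  \<open>\<parallel>(\<Delta> - E) v\<parallel> \<le> e \<parallel>v\<parallel>\<close> holds on the subspace of an interval of radius \<open>e\<close> around \<open>E\<close>
  (\<open>spectral_localisation\<close>). The same bound turns spectral projections into approximate
  eigenvectors, which shows that \<open>E\<close> lies in the spectrum (\<open>spectrum_laplacian\<close>).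
\<close>

section \<open>The Hilbert space of square-summable families\<close>

lemma ell2_eqI: "(\<And>n. coord u n = coord v n) \<Longrightarrow> u = v"
  by (simp add: coord_inject[symmetric] ext)

lemmas [simp] =
  zero_ell2.rep_eq plus_ell2.rep_eq uminus_ell2.rep_eq minus_ell2.rep_eq scaleR_ell2.rep_eq
  cscale.rep_eq

lemma coord_sum [simp]: "coord (\<Sum>i\<in>I. f i) n = (\<Sum>i\<in>I. coord (f i) n)"
  by (induction I rule: infinite_finite_induct) auto

lemma coord_Abs_ell2:
  "(\<lambda>n. (cmod (f n))\<^sup>2) summable_on UNIV \<Longrightarrow> coord (Abs_ell2 f) = f"
  by (simp add: Abs_ell2_inverse)

lemma cinner_add_left: "cinner (a + b) c = cinner a c + cinner b c"
  unfolding cinner_def by (simp add: distrib_right infsum_add cinner_summable)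

lemma cinner_add_right: "cinner c (a + b) = cinner c a + cinner c b"
  unfolding cinner_def by (simp add: distrib_left infsum_add cinner_summable)

lemma cinner_cscale_left: "cinner (z *\<^sub>C a) b = cnj z * cinner a b"
  unfolding cinner_def by (simp add: mult.assoc infsum_cmult_right')

lemma cinner_cscale_right: "cinner a (z *\<^sub>C b) = z * cinner a b"
  unfolding cinner_def by (simp add: mult.left_commute infsum_cmult_right')

lemma scaleR_eq_cscale: "r *\<^sub>R u = of_real r *\<^sub>C u"
  by (rule ell2_eqI) (simp add: scaleR_conv_of_real)

lemma cinner_scaleR_left: "cinner (r *\<^sub>R a) b = r * cinner a b"
  by (simp add: scaleR_eq_cscale cinner_cscale_left)

lemma cinner_scaleR_right: "cinner a (r *\<^sub>R b) = r * cinner a b"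
  by (simp add: scaleR_eq_cscale cinner_cscale_right)

lemma uminus_eq_cscale: "- u = (- 1) *\<^sub>C u"
  by (rule ell2_eqI) simp

lemma cinner_minus_right: "cinner a (- b) = - cinner a b"
  by (simp add: uminus_eq_cscale cinner_cscale_right)

lemma cinner_diff_right: "cinner c (a - b) = cinner c a - cinner c b"
  using cinner_add_right[of c a "- b"] by (simp add: cinner_minus_right)

lemma cinner_zero [simp]: "cinner 0 a = 0" "cinner a 0 = 0"
  by (simp_all add: cinner_def)

lemma cinner_sum_left: "cinner (\<Sum>i\<in>I. f i) a = (\<Sum>i\<in>I. cinner (f i) a)"
  by (induction I rule: infinite_finite_induct) (auto simp: cinner_add_left)

lemma cinner_sum_right: "cinner a (\<Sum>i\<in>I. f i) = (\<Sum>i\<in>I. cinner a (f i))"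
  by (induction I rule: infinite_finite_induct) (auto simp: cinner_add_right)

lemma cinner_commute: "cinner b a = cnj (cinner a b)"
  unfolding cinner_def by (simp add: infsum_cnj[symmetric] mult.commute)

lemma cinner_self_norm: "cinner u u = of_real ((norm u)\<^sup>2)"
  by (simp add: cinner_self norm_ell2_def infsum_nonneg)

lemma Re_cinner: "Re (cinner u v) = inner u v"
  by (simp add: inner_ell2_def)

lemma norm_cscale: "norm (z *\<^sub>C u) = cmod z * norm u"
proof -
  have "of_real ((norm (z *\<^sub>C u))\<^sup>2) = (of_real ((cmod z * norm u)\<^sup>2) :: complex)"
    unfolding cinner_self_norm[symmetric] cinner_cscale_left cinner_cscale_right
    by (simp add: cinner_self_norm power_mult_distrib complex_norm_square mult_ac
        del: of_real_power)
  then have "(norm (z *\<^sub>C u))\<^sup>2 = (cmod z * norm u)\<^sup>2"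
    by (simp only: of_real_eq_iff)
  then show ?thesis by (simp add: power2_eq_iff_nonneg)
qed

text \<open>Rotating one argument by a phase reduces the complex inequality to the real one.\<close>
lemma cmod_cinner_le: "cmod (cinner u v) \<le> norm u * norm v"
proof (cases "cinner u v = 0")
  case False
  define z where "z = sgn (cinner u v)"
  have z: "cmod z = 1" using False by (simp add: z_def norm_sgn)
  have "cinner (z *\<^sub>C u) v = of_real (cmod (cinner u v))"
    using False
    by (simp add: cinner_cscale_left z_def sgn_eq field_simps complex_norm_square[symmetric])
      (simp add: power2_eq_square)
  then have "cmod (cinner u v) = inner (z *\<^sub>C u) v"
    by (simp add: Re_cinner[symmetric])
  also have "\<dots> \<le> norm (z *\<^sub>C u) * norm v" by (rule norm_cauchy_schwarz)
  finally show ?thesis by (simp add: norm_cscale z)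
qed simp

lemma bounded_bilinear_cinner: "bounded_bilinear cinner"
proof
  show "\<exists>K. \<forall>a b. norm (cinner a b) \<le> norm a * norm b * K"
    by (intro exI[of _ 1]) (simp add: cmod_cinner_le)
qed (simp_all add: cinner_add_left cinner_add_right cinner_scaleR_left cinner_scaleR_right
    scaleR_conv_of_real)

lemmas continuous_on_cinner [continuous_intros] =
  bounded_bilinear.continuous_on[OF bounded_bilinear_cinner]

lemma bounded_opD:
  assumes "bounded_op T"
  shows "bounded_linear T" "linear T" "T (z *\<^sub>C u) = z *\<^sub>C T u"
  using assms bounded_linear.linear unfolding bounded_op_def by auto

lemma bounded_op_continuous_on: "bounded_op T \<Longrightarrow> continuous_on A T"
  using bounded_opD(1) linear_continuous_on by blast

lemma cmod_coord_le_norm: "cmod (coord u n) \<le> norm u"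
proof -
  have "(cmod (coord u n))\<^sup>2 \<le> (\<Sum>\<^sub>\<infinity>n. (cmod (coord u n))\<^sup>2)"
    using finite_sum_le_infsum[OF coord_summable[of u], of "{n}"] by simp
  then show ?thesis unfolding norm_ell2_def by (rule real_le_rsqrt)
qed

lemma tendsto_coord: "(f \<longlongrightarrow> u) F \<Longrightarrow> ((\<lambda>x. coord (f x) n) \<longlongrightarrow> coord u n) F"
proof -
  assume "(f \<longlongrightarrow> u) F"
  moreover have "bounded_linear (\<lambda>u. coord u n)"
    by (rule bounded_linear_intro[where K=1]) (auto simp: cmod_coord_le_norm)
  ultimately show ?thesis by (rule bounded_linear.tendsto[rotated])
qed

lemma norm_sq_eq_infsum: "(norm u)\<^sup>2 = (\<Sum>\<^sub>\<infinity>n. (cmod (coord u n))\<^sup>2)"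
  by (simp add: norm_ell2_def infsum_nonneg)

text \<open>
  For a sequence that is only given by its coordinates, this yields membership in the Hilbert space
  together with the norm bound.
\<close>
lemma norm_le_of_finite:
  assumes "0 \<le> C" "\<And>F. finite F \<Longrightarrow> (\<Sum>n\<in>F. (cmod (f n))\<^sup>2) \<le> C\<^sup>2"
  shows "(\<lambda>n. (cmod (f n))\<^sup>2) summable_on UNIV" "norm (Abs_ell2 f) \<le> C"
proof -
  show *: "(\<lambda>n. (cmod (f n))\<^sup>2) summable_on UNIV"
    by (rule nonneg_bdd_above_summable_on) (auto intro!: bdd_aboveI[of _ "C\<^sup>2"] assms)
  have "(norm (Abs_ell2 f))\<^sup>2 \<le> C\<^sup>2"
    unfolding norm_sq_eq_infsum coord_Abs_ell2[OF *]
    by (rule infsum_le_finite_sums[OF *]) (use assms in auto)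
  then show "norm (Abs_ell2 f) \<le> C"
    using assms(1) by (rule power2_le_imp_le)
qed

section \<open>Finitely supported sequences\<close>

lemma summable_finite_support:
  assumes "finite {n. f n \<noteq> 0}"
  shows "(\<lambda>n. (cmod (f n))\<^sup>2) summable_on UNIV"
proof -
  have "(\<lambda>n. (cmod (f n))\<^sup>2) summable_on {n. f n \<noteq> 0}"
    using assms by (rule summable_on_finite)
  then show ?thesis
    by (rule summable_on_cong_neutral[THEN iffD1, rotated -1]) auto
qed

lift_definition truncate :: "'a set \<Rightarrow> 'a ell2 \<Rightarrow> 'a ell2"
  is "\<lambda>F u n. if n \<in> F then u n else 0"
  by (erule summable_on_comparison_test) auto

lift_definition delta :: "'a \<Rightarrow> 'a ell2" is "\<lambda>m n. if n = m then 1 else 0"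
  by (rule summable_finite_support) simp

lemmas [simp] = truncate.rep_eq delta.rep_eq

lemma compactly_supported_intro:
  "finite F \<Longrightarrow> (\<And>n. n \<notin> F \<Longrightarrow> coord u n = 0) \<Longrightarrow> compactly_supported u"
  unfolding compactly_supported_def by (rule finite_subset[of _ F]) auto

lemma compactly_supported_truncate: "finite F \<Longrightarrow> compactly_supported (truncate F u)"
  by (rule compactly_supported_intro) auto

lemma compactly_supported_delta: "compactly_supported (delta m)"
  by (rule compactly_supported_intro[of "{m}"]) auto

lemma compactly_supported_zero: "compactly_supported 0"
  by (rule compactly_supported_intro[of "{}"]) auto

lemma compactly_supported_add:
  "compactly_supported u \<Longrightarrow> compactly_supported v \<Longrightarrow> compactly_supported (u + v)"
  by (rule compactly_supported_intro[of "{n. coord u n \<noteq> 0} \<union> {n. coord v n \<noteq> 0}"])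
     (auto simp: compactly_supported_def)

lemma compactly_supported_cscale: "compactly_supported u \<Longrightarrow> compactly_supported (c *\<^sub>C u)"
  by (rule compactly_supported_intro[of "{n. coord u n \<noteq> 0}"])
     (auto simp: compactly_supported_def)

lemma compactly_supported_scaleR: "compactly_supported u \<Longrightarrow> compactly_supported (c *\<^sub>R u)"
  by (simp add: scaleR_eq_cscale compactly_supported_cscale)

lemma compactly_supported_diff:
  "compactly_supported u \<Longrightarrow> compactly_supported v \<Longrightarrow> compactly_supported (u - v)"
  by (metis compactly_supported_add compactly_supported_cscale diff_conv_add_uminus
      uminus_eq_cscale)

lemma compactly_supported_sum:
  "(\<And>i. i \<in> I \<Longrightarrow> compactly_supported (f i)) \<Longrightarrow> compactly_supported (\<Sum>i\<in>I. f i)"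
  by (induction I rule: infinite_finite_induct)
     (auto simp: compactly_supported_zero compactly_supported_add)

lemma cinner_delta_left: "cinner (delta m) u = coord u m"
  unfolding cinner_def
  by (subst infsum_cong_neutral[where T="{m}" and g="\<lambda>n. coord u n"]) auto

lemma cinner_delta_right: "cinner u (delta m) = cnj (coord u m)"
  by (subst cinner_commute) (simp add: cinner_delta_left)

lemma compactly_supported_expand:
  assumes "compactly_supported u"
  shows "u = (\<Sum>m | coord u m \<noteq> 0. coord u m *\<^sub>C delta m)"
proof (rule ell2_eqI)
  fix n
  have "(\<Sum>m | coord u m \<noteq> 0. coord u m * (if n = m then 1 else 0)) = coord u n"
    using assms by (simp add: compactly_supported_def if_distrib[of "\<lambda>x. _ * x"] sum.delta cong: if_cong)
  then show "coord u n = coord (\<Sum>m | coord u m \<noteq> 0. coord u m *\<^sub>C delta m) n" by simp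
qed

lemma cinner_compactly_supported:
  "compactly_supported w \<Longrightarrow>
     cinner w u = (\<Sum>n | coord w n \<noteq> 0. cnj (coord w n) * coord u n)"
  by (subst compactly_supported_expand, assumption)
     (simp add: cinner_sum_left cinner_cscale_left cinner_delta_left)

lemma norm_sq_compactly_supported:
  "compactly_supported w \<Longrightarrow> (norm w)\<^sup>2 = (\<Sum>n | coord w n \<noteq> 0. (cmod (coord w n))\<^sup>2)"
  unfolding norm_sq_eq_infsum
  by (subst infsum_cong_neutral[where T="{n. coord w n \<noteq> 0}" and g="\<lambda>n. (cmod (coord w n))\<^sup>2"])
     (auto simp: compactly_supported_def)

text \<open>
  A finite set carries all but \<open>e\<close> of the mass of the dominating sequence, and on a finite set
  coordinatewise convergence is convergence in norm.
\<close>
lemma ell2_dominated_convergence: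
  fixes f :: "nat \<Rightarrow> 'a ell2"
  assumes lim: "\<And>n. (\<lambda>k. coord (f k) n) \<longlonglongrightarrow> 0"
    and dom: "\<And>k n. cmod (coord (f k) n) \<le> cmod (coord g n)"
  shows "f \<longlonglongrightarrow> 0"
proof -
  have "(\<lambda>k. (norm (f k))\<^sup>2) \<longlonglongrightarrow> 0"
  proof (rule LIMSEQ_I)
    fix e :: real assume e: "0 < e"
    define s where "s = (\<Sum>\<^sub>\<infinity>n. (cmod (coord g n))\<^sup>2)"
    have hs: "((\<lambda>n. (cmod (coord g n))\<^sup>2) has_sum s) UNIV"
      unfolding s_def by (rule has_sum_infsum[OF coord_summable])
    obtain F where F: "finite F" "dist (\<Sum>n\<in>F. (cmod (coord g n))\<^sup>2) s \<le> e/3"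
      using has_sum_finite_approximation[OF hs, of "e/3"] e by auto
    have tail: "(\<Sum>\<^sub>\<infinity>n\<in>-F. (cmod (coord g n))\<^sup>2) \<le> e/3"
    proof -
      have "s = (\<Sum>n\<in>F. (cmod (coord g n))\<^sup>2) + (\<Sum>\<^sub>\<infinity>n\<in>-F. (cmod (coord g n))\<^sup>2)"
        unfolding s_def
        using infsum_Un_disjoint[of "\<lambda>n. (cmod (coord g n))\<^sup>2" F "-F"] F(1)
          summable_on_subset_banach[OF coord_summable[of g]] by (simp add: summable_on_finite)
      then show ?thesis using F(2) by (simp add: dist_real_def)
    qed
    have "(\<lambda>k. \<Sum>n\<in>F. (cmod (coord (f k) n))\<^sup>2) \<longlonglongrightarrow> (\<Sum>n\<in>F. 0)"
      by (intro tendsto_sum) (use lim tendsto_norm_zero tendsto_null_power in auto)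
    then have "eventually (\<lambda>k. (\<Sum>n\<in>F. (cmod (coord (f k) n))\<^sup>2) < e/3) sequentially"
      using e by (intro order_tendstoD(2)[where y=0]) auto
    then obtain k0 where k0: "\<And>k. k \<ge> k0 \<Longrightarrow> (\<Sum>n\<in>F. (cmod (coord (f k) n))\<^sup>2) < e/3"
      by (auto simp: eventually_sequentially)
    have "norm ((norm (f k))\<^sup>2 - 0) < e" if "k \<ge> k0" for k
    proof -
      have "(norm (f k))\<^sup>2 = (\<Sum>n\<in>F. (cmod (coord (f k) n))\<^sup>2) + (\<Sum>\<^sub>\<infinity>n\<in>-F. (cmod (coord (f k) n))\<^sup>2)"
        unfolding norm_sq_eq_infsum
        using infsum_Un_disjoint[of "\<lambda>n. (cmod (coord (f k) n))\<^sup>2" F "-F"] F(1)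
          summable_on_subset_banach[OF coord_summable[of "f k"]] by (simp add: summable_on_finite)
      moreover have "(\<Sum>\<^sub>\<infinity>n\<in>-F. (cmod (coord (f k) n))\<^sup>2) \<le> (\<Sum>\<^sub>\<infinity>n\<in>-F. (cmod (coord g n))\<^sup>2)"
        by (intro infsum_mono summable_on_subset_banach[OF coord_summable] power_mono dom) auto
      ultimately have "(norm (f k))\<^sup>2 < e" using k0[OF that] tail e by linarith
      then show ?thesis by simp
    qed
    then show "\<exists>k0. \<forall>k\<ge>k0. norm ((norm (f k))\<^sup>2 - 0) < e" by blast
  qed
  then have "(\<lambda>k. sqrt ((norm (f k))\<^sup>2)) \<longlonglongrightarrow> sqrt 0" by (rule tendsto_real_sqrt)
  then show ?thesis by (simp add: tendsto_norm_zero_iff)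
qed

lemma compactly_supported_dense: "closure {u. compactly_supported u} = (UNIV :: 'a ell2 set)"
proof -
  have "u \<in> closure {u. compactly_supported u}" for u :: "'a ell2"
  proof (rule closure_approachable[THEN iffD2], intro allI impI)
    fix e :: real assume e: "0 < e"
    have "((\<lambda>n. (cmod (coord u n))\<^sup>2) has_sum (norm u)\<^sup>2) UNIV"
      unfolding norm_sq_eq_infsum by (rule has_sum_infsum[OF coord_summable])
    then obtain F where F: "finite F" "dist (\<Sum>n\<in>F. (cmod (coord u n))\<^sup>2) ((norm u)\<^sup>2) \<le> e\<^sup>2/2"
      using has_sum_finite_approximation[of _ UNIV "(norm u)\<^sup>2" "e\<^sup>2/2"] e by auto
    have "(norm (truncate F u - u))\<^sup>2 = (\<Sum>\<^sub>\<infinity>n\<in>-F. (cmod (coord u n))\<^sup>2)"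
      unfolding norm_sq_eq_infsum by (rule infsum_cong_neutral) auto
    moreover have "(norm u)\<^sup>2 = (\<Sum>n\<in>F. (cmod (coord u n))\<^sup>2) + (\<Sum>\<^sub>\<infinity>n\<in>-F. (cmod (coord u n))\<^sup>2)"
      unfolding norm_sq_eq_infsum
      using infsum_Un_disjoint[of "\<lambda>n. (cmod (coord u n))\<^sup>2" F "-F"] F(1)
        summable_on_subset_banach[OF coord_summable[of u]] by (simp add: summable_on_finite)
    ultimately have "(norm (truncate F u - u))\<^sup>2 \<le> e\<^sup>2/2" using F(2) by (simp add: dist_real_def)
    also have "\<dots> < e\<^sup>2" using e by simp
    finally have "dist (truncate F u) u < e"
      unfolding dist_norm using e by (simp add: power2_less_imp_less)
    then show "\<exists>y\<in>{u. compactly_supported u}. dist y u < e"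
      using compactly_supported_truncate[OF F(1)] by blast
  qed
  then show ?thesis by auto
qed

text \<open>
  Operator identities and inequalities are checked on finitely supported sequences, whose Fourier
  transforms are trigonometric polynomials, and extended by continuity.
\<close>
lemma ell2_density_induct:
  assumes "closed {u. Q u}" "\<And>w. compactly_supported w \<Longrightarrow> Q w"
  shows "Q u"
proof -
  have "closure {u. compactly_supported u} \<subseteq> {u. Q u}"
    by (rule closure_minimal) (use assms in auto)
  then show ?thesis by (auto simp: compactly_supported_dense)
qed

section \<open>Difference operators with linearly growing coefficients\<close>

definition l1 :: "int ^ 'd::finite \<Rightarrow> real" where
  "l1 n = (\<Sum>i\<in>UNIV. \<bar>of_int (n $ i)\<bar>)"

lemma l1_nonneg: "0 \<le> l1 n"
  by (simp add: l1_def sum_nonneg)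

lemma component_le_l1: "\<bar>of_int (n $ i)\<bar> \<le> l1 n"
  unfolding l1_def by (rule member_le_sum) auto

lemma l1_diff_le: "l1 (n - k) \<le> l1 n + l1 k"
  unfolding l1_def sum.distrib[symmetric] by (rule sum_mono) simp

lemma abs_l1_diff: "\<bar>l1 (n - k) - l1 n\<bar> \<le> l1 k"
proof -
  have "l1 n \<le> l1 (n - k) + l1 k"
    unfolding l1_def sum.distrib[symmetric] by (rule sum_mono) simp
  then show ?thesis using l1_diff_le[of n k] by linarith
qed

lemma finite_l1_ball: "finite {n :: int ^ 'd::finite. l1 n < r}"
proof -
  define F where "F = PiE (UNIV :: 'd set) (\<lambda>_. {- \<lceil>r\<rceil>..\<lceil>r\<rceil>})"
  have "{n :: int ^ 'd. l1 n < r} \<subseteq> vec_lambda ` F"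
  proof
    fix n :: "int ^ 'd" assume "n \<in> {n. l1 n < r}"
    then have r: "\<bar>of_int (n $ i)\<bar> < r" for i using component_le_l1[of n i] by simp
    have "n $ i \<in> {- \<lceil>r\<rceil>..\<lceil>r\<rceil>}" for i
      using r[of i] by simp linarith
    then have "vec_nth n \<in> F" by (auto simp: F_def)
    then show "n \<in> vec_lambda ` F" by (rule rev_image_eqI) simp
  qed
  moreover have "finite F" unfolding F_def by (rule finite_PiE) auto
  ultimately show ?thesis by (blast intro: finite_subset finite_imageI)
qed

definition tent :: "real \<Rightarrow> int ^ 'd::finite \<Rightarrow> real" where
  "tent r n = max 0 (1 - l1 n / r)"

lemma tent_bounds: "r > 0 \<Longrightarrow> 0 \<le> tent r n \<and> tent r n \<le> 1"
  by (simp add: tent_def l1_nonneg)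

lemma tent_support: "r > 0 \<Longrightarrow> tent r n \<noteq> 0 \<Longrightarrow> l1 n < r"
  by (simp add: tent_def max_def divide_simps split: if_splits)

lemma tent_tendsto: "(\<lambda>k. tent (real (Suc k)) n) \<longlonglongrightarrow> 1"
proof -
  have "(\<lambda>k. max 0 (1 - l1 n * inverse (real (Suc k)))) \<longlonglongrightarrow> max 0 (1 - l1 n * 0)"
    by (intro tendsto_intros LIMSEQ_inverse_real_of_nat)
  then show ?thesis by (simp add: tent_def divide_inverse)
qed

text \<open>
  The slope \<open>1 / r\<close> of the tent compensates the size of the growing coefficient, because the tent
  is constant outside a ball of radius \<open>r\<close>.
\<close>
lemma tent_difference_bound:
  assumes r: "1 \<le> r" and x: "0 \<le> x" "x \<le> c * (1 + l1 n)" and c: "0 \<le> c"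
  shows "x * \<bar>tent r (n - k) - tent r n\<bar> \<le> c * ((2 + l1 k) * l1 k)"
proof (cases "l1 n \<ge> r + l1 k")
  case True
  then have "l1 (n - k) \<ge> r" "l1 n \<ge> r"
    using abs_l1_diff[of n k] l1_nonneg[of k] by linarith+
  then have "tent r (n - k) = 0" "tent r n = 0"
    using r tent_support[of r] by fastforce+
  then show ?thesis using c by (simp add: l1_nonneg)
next
  case False
  have "\<bar>tent r (n - k) - tent r n\<bar> \<le> \<bar>l1 (n - k) / r - l1 n / r\<bar>"
    unfolding tent_def by linarith
  also have "\<dots> = \<bar>l1 (n - k) - l1 n\<bar> / r"
    using r by (simp add: diff_divide_distrib[symmetric])
  also have "\<dots> \<le> l1 k / r"
    using r abs_l1_diff[of n k] by (simp add: divide_right_mono)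
  finally have "x * \<bar>tent r (n - k) - tent r n\<bar> \<le> (c * (1 + l1 n)) * (l1 k / r)"
    using x c l1_nonneg[of n] by (intro mult_mono) auto
  also have "\<dots> \<le> (c * (r * (2 + l1 k))) * (l1 k / r)"
  proof (intro mult_right_mono mult_left_mono c)
    have "l1 k \<le> r * l1 k" using mult_right_mono[OF r l1_nonneg[of k]] by simp
    then show "1 + l1 n \<le> r * (2 + l1 k)" using False r by (simp add: distrib_left)
    show "0 \<le> l1 k / r" using r l1_nonneg[of k] by simp
  qed
  also have "\<dots> = c * ((2 + l1 k) * l1 k)" using r by simp
  finally show ?thesis .
qed

lift_definition cutoff :: "real \<Rightarrow> (int ^ 'd::finite) ell2 \<Rightarrow> (int ^ 'd) ell2"
  is "\<lambda>r u n. if r > 0 then of_real (tent r n) * u n else 0"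
proof -
  fix r :: real and u :: "int ^ 'd \<Rightarrow> complex"
  assume u: "(\<lambda>n. (cmod (u n))\<^sup>2) summable_on UNIV"
  show "(\<lambda>n. (cmod (if r > 0 then of_real (tent r n) * u n else 0))\<^sup>2) summable_on UNIV"
  proof (rule summable_on_comparison_test[OF u])
    fix n
    show "(cmod (if r > 0 then of_real (tent r n) * u n else 0))\<^sup>2 \<le> (cmod (u n))\<^sup>2"
      using tent_bounds[of r n] by (auto simp: norm_mult intro!: power_mono mult_left_le_one_le)
  qed auto
qed

lift_definition modulus :: "'a ell2 \<Rightarrow> 'a ell2" is "\<lambda>u n. of_real (cmod (u n))"
  by simp

lift_definition translate :: "'g::ab_group_add \<Rightarrow> 'g ell2 \<Rightarrow> 'g ell2" is "\<lambda>k u n. u (n - k)"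
proof -
  fix k :: 'g and u :: "'g \<Rightarrow> complex"
  assume "(\<lambda>n. (cmod (u n))\<^sup>2) summable_on UNIV"
  moreover have "bij_betw (\<lambda>n. n - k) UNIV (UNIV :: 'g set)"
    by (rule bij_betwI[where g="\<lambda>n. n + k"]) auto
  ultimately show "(\<lambda>n. (cmod (u (n - k)))\<^sup>2) summable_on UNIV"
    using summable_on_reindex_bij_betw[of "\<lambda>n. n - k" UNIV UNIV "\<lambda>n. (cmod (u n))\<^sup>2"] by simp
qed

text \<open>
  The steps of the operator are indexed by \<open>J\<close>: the value at \<open>n - \<kappa> j\<close> enters at \<open>n\<close> with
  coefficient \<open>a j n\<close>. The involution pairs every step with its reverse, so that \<open>symmetric\<close> says
  that the infinite matrix is Hermitian.
\<close>
locale symmetric_difference_operator =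
  fixes J :: "'j set" and \<kappa> :: "'j \<Rightarrow> int ^ 'd::finite"
    and a :: "'j \<Rightarrow> int ^ 'd \<Rightarrow> complex" and \<sigma> :: "'j \<Rightarrow> 'j" and c :: real
  assumes finite_J: "finite J"
    and involution: "j \<in> J \<Longrightarrow> \<sigma> j \<in> J" "j \<in> J \<Longrightarrow> \<sigma> (\<sigma> j) = j" "j \<in> J \<Longrightarrow> \<kappa> (\<sigma> j) = - \<kappa> j"
    and symmetric: "j \<in> J \<Longrightarrow> a (\<sigma> j) (n - \<kappa> j) = cnj (a j n)"
    and growth: "0 \<le> c" "j \<in> J \<Longrightarrow> cmod (a j n) \<le> c * (1 + l1 n)"
begin

definition D :: "(int ^ 'd \<Rightarrow> complex) \<Rightarrow> int ^ 'd \<Rightarrow> complex" where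
  "D u n = (\<Sum>j\<in>J. a j n * u (n - \<kappa> j))"

definition max_graph :: "(int ^ 'd) graph" where
  "max_graph = {(u, v). \<forall>n. coord v n = D (coord u) n}"

definition min_graph :: "(int ^ 'd) graph" where
  "min_graph = {(u, v). compactly_supported u \<and> (\<forall>n. coord v n = D (coord u) n)}"

lemma closed_max_graph: "closed max_graph"
  unfolding closed_sequential_limits
proof (intro allI impI, elim conjE)
  fix p :: "nat \<Rightarrow> (int ^ 'd) ell2 \<times> (int ^ 'd) ell2" and l
  assume p: "\<forall>k. p k \<in> max_graph" and lim: "p \<longlonglongrightarrow> l"
  have "coord (snd l) n = D (coord (fst l)) n" for n
  proof (rule LIMSEQ_unique)
    show "(\<lambda>k. coord (snd (p k)) n) \<longlonglongrightarrow> coord (snd l) n"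
      by (intro tendsto_coord tendsto_snd lim)
    have "(\<lambda>k. D (coord (fst (p k))) n) \<longlonglongrightarrow> D (coord (fst l)) n"
      unfolding D_def by (intro tendsto_intros tendsto_coord lim)
    moreover have "coord (snd (p k)) n = D (coord (fst (p k))) n" for k
      using p[rule_format, of k] by (auto simp: max_graph_def split: prod.splits)
    ultimately show "(\<lambda>k. coord (snd (p k)) n) \<longlonglongrightarrow> D (coord (fst l)) n" by simp
  qed
  then show "l \<in> max_graph" by (auto simp: max_graph_def split: prod.splits)
qed

definition matrix_column :: "int ^ 'd \<Rightarrow> (int ^ 'd) ell2" where
  "matrix_column m = (\<Sum>j\<in>J. a j (m + \<kappa> j) *\<^sub>C delta (m + \<kappa> j))"

lemma coord_matrix_column: "coord (matrix_column m) n = D (coord (delta m)) n"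
  unfolding matrix_column_def D_def by (auto intro!: sum.cong simp: algebra_simps)

lemma cinner_matrix_column: "cinner v (matrix_column m) = cnj (D (coord v) m)"
proof -
  have "cnj (D (coord v) m) = (\<Sum>j\<in>J. cnj (a (\<sigma> j) m) * cnj (coord v (m - \<kappa> (\<sigma> j))))"
    unfolding D_def
    by (simp, rule sum.reindex_bij_witness[of _ \<sigma> \<sigma>]) (auto simp: involution)
  also have "\<dots> = (\<Sum>j\<in>J. a j (m + \<kappa> j) * cnj (coord v (m + \<kappa> j)))"
  proof (intro sum.cong refl)
    fix j assume "j \<in> J"
    then show "cnj (a (\<sigma> j) m) * cnj (coord v (m - \<kappa> (\<sigma> j)))
        = a j (m + \<kappa> j) * cnj (coord v (m + \<kappa> j))"
      using symmetric[of j "m + \<kappa> j"] by (simp add: involution)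
  qed
  finally show ?thesis
    by (simp add: matrix_column_def cinner_sum_right cinner_cscale_right cinner_delta_right)
qed

lemma min_graph_delta: "(delta m, matrix_column m) \<in> min_graph"
  by (simp add: min_graph_def compactly_supported_delta coord_matrix_column)

lemma min_graph_expand:
  assumes "compactly_supported u"
  shows "coord (\<Sum>m | coord u m \<noteq> 0. coord u m *\<^sub>C matrix_column m) n = D (coord u) n"
proof -
  have "D (coord u) n = D (coord (\<Sum>m | coord u m \<noteq> 0. coord u m *\<^sub>C delta m)) n"
    using compactly_supported_expand[OF assms] by simp
  also have "\<dots> = (\<Sum>m | coord u m \<noteq> 0. coord u m * D (coord (delta m)) n)"
    unfolding D_def coord_sum cscale.rep_eq sum_distrib_left
    by (subst sum.swap) (simp add: mult_ac)
  finally show ?thesis by (simp add: coord_matrix_column)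
qed

lemma min_graph_total: "compactly_supported u \<Longrightarrow> \<exists>v. (u, v) \<in> min_graph"
  unfolding min_graph_def using min_graph_expand by blast

text \<open>
  Testing against the delta sequences, whose images are the matrix columns, reads off the
  coordinates of the adjoint.
\<close>
lemma adjoint_min_graph: "adjoint_graph min_graph \<subseteq> max_graph"
proof clarify
  fix v w assume vw: "(v, w) \<in> adjoint_graph min_graph"
  have "coord w n = D (coord v) n" for n
  proof -
    have "cinner v (matrix_column n) = cinner w (delta n)"
      using vw min_graph_delta[of n] by (auto simp: adjoint_graph_def)
    then show ?thesis by (simp add: cinner_matrix_column cinner_delta_right)
  qed
  then show "(v, w) \<in> max_graph" by (simp add: max_graph_def)
qed

text \<open>
  Cutting off an element of the maximal domain by a tent of width \<open>r\<close> changes its image by a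
  commutator, which by \<open>tent_difference_bound\<close> is bounded uniformly in \<open>r\<close> and tends to zero in
  each coordinate.
\<close>
lemma max_graph_subset_closure: "max_graph \<subseteq> closure min_graph"
proof clarify
  fix v w assume "(v, w) \<in> max_graph"
  then have w: "coord w n = D (coord v) n" for n by (simp add: max_graph_def)
  define u where "u k = cutoff (real (Suc k)) v" for k
  have coord_u: "coord (u k) n = of_real (tent (real (Suc k)) n) * coord v n" for k n
    by (simp add: u_def cutoff.rep_eq)
  have cs: "compactly_supported (u k)" for k
    by (rule compactly_supported_intro[OF finite_l1_ball[of "real (Suc k)"]])
       (use tent_support[of "real (Suc k)"] in \<open>auto simp: coord_u\<close>)
  define z where "z k = (\<Sum>m | coord (u k) m \<noteq> 0. coord (u k) m *\<^sub>C matrix_column m)" for k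
  have z: "coord (z k) n = D (coord (u k)) n" for k n
    unfolding z_def by (rule min_graph_expand[OF cs])
  have lim_u: "(\<lambda>k. coord (u k) n) \<longlonglongrightarrow> coord v n" for n
    unfolding coord_u using tendsto_mult[OF tendsto_of_real[OF tent_tendsto[of n]] tendsto_const]
    by simp
  have u_v: "(\<lambda>k. u k - v) \<longlonglongrightarrow> 0"
  proof (rule ell2_dominated_convergence)
    show "(\<lambda>k. coord (u k - v) n) \<longlonglongrightarrow> 0" for n
      using tendsto_diff[OF lim_u[of n] tendsto_const[of "coord v n"]] by simp
    show "cmod (coord (u k - v) n) \<le> cmod (coord v n)" for k n
    proof -
      have "coord (u k - v) n = of_real (tent (real (Suc k)) n - 1) * coord v n"
        by (simp add: coord_u algebra_simps)
      then show ?thesis using tent_bounds[of "real (Suc k)" n]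
        by (simp only: norm_mult norm_of_real) (auto intro!: mult_left_le_one_le)
    qed
  qed
  define b where "b j = c * ((2 + l1 (\<kappa> j)) * l1 (\<kappa> j))" for j
  have b_nonneg: "0 \<le> b j" for j using growth(1) by (simp add: b_def l1_nonneg)
  define g where "g = (\<Sum>j\<in>J. b j *\<^sub>R translate (\<kappa> j) (modulus v)) + modulus w"
  have z_w: "(\<lambda>k. z k - w) \<longlonglongrightarrow> 0"
  proof (rule ell2_dominated_convergence)
    fix n
    have "(\<lambda>k. D (coord (u k)) n) \<longlonglongrightarrow> D (coord v) n"
      unfolding D_def by (intro tendsto_intros lim_u)
    then have "(\<lambda>k. coord (z k) n - coord w n) \<longlonglongrightarrow> D (coord v) n - D (coord v) n"
      unfolding z w by (intro tendsto_intros)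
    then show "(\<lambda>k. coord (z k - w) n) \<longlonglongrightarrow> 0" by simp
  next
    fix k n
    let ?t = "tent (real (Suc k))"
    have "coord (z k - w) n =
        (\<Sum>j\<in>J. a j n * of_real (?t (n - \<kappa> j) - ?t n) * coord v (n - \<kappa> j))
        + of_real (?t n - 1) * coord w n"
      by (simp add: z w D_def coord_u sum_distrib_left sum_subtractf[symmetric]
          sum.distrib[symmetric] algebra_simps)
    also have "cmod \<dots> \<le> (\<Sum>j\<in>J. b j * cmod (coord v (n - \<kappa> j))) + cmod (coord w n)"
    proof (intro order_trans[OF norm_triangle_ineq] add_mono order_trans[OF norm_sum] sum_mono)
      fix j assume j: "j \<in> J"
      have "cmod (a j n) * \<bar>?t (n - \<kappa> j) - ?t n\<bar> \<le> b j"
        unfolding b_def by (rule tent_difference_bound) (auto simp: growth j)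
      then show "cmod (a j n * of_real (?t (n - \<kappa> j) - ?t n) * coord v (n - \<kappa> j))
          \<le> b j * cmod (coord v (n - \<kappa> j))"
        unfolding norm_mult norm_of_real by (rule mult_right_mono) simp
    next
      show "cmod (of_real (?t n - 1) * coord w n) \<le> cmod (coord w n)"
        using tent_bounds[of "real (Suc k)" n]
        by (simp only: norm_mult norm_of_real) (auto intro!: mult_left_le_one_le)
    qed
    also have "\<dots> = Re (coord g n)"
      by (simp add: g_def translate.rep_eq modulus.rep_eq)
    also have "\<dots> \<le> cmod (coord g n)" by (rule complex_Re_le_cmod)
    finally show "cmod (coord (z k - w) n) \<le> cmod (coord g n)" .
  qed
  have "(\<lambda>k. (u k, z k)) \<longlonglongrightarrow> (v, w)"
    using u_v z_w by (intro tendsto_Pair) (simp_all add: LIM_zero_iff)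
  moreover have "(u k, z k) \<in> min_graph" for k
    by (simp add: min_graph_def cs z)
  ultimately show "(v, w) \<in> closure min_graph"
    unfolding closure_sequential by (intro exI[of _ "\<lambda>k. (u k, z k)"]) simp
qed

text \<open>
  Symmetry against a finitely supported sequence is a finite computation, and the maximal graph is
  contained in the closure of the minimal one.
\<close>
lemma max_graph_symmetric: "max_graph \<subseteq> adjoint_graph max_graph"
proof clarify
  fix v w assume vw: "(v, w) \<in> max_graph"
  let ?S = "{p. cinner v (snd p) = cinner w (fst p)}"
  have "min_graph \<subseteq> ?S"
  proof clarify
    fix u z assume uz: "(u, z) \<in> min_graph"
    then have cs: "compactly_supported u" by (simp add: min_graph_def)
    have "z = (\<Sum>m | coord u m \<noteq> 0. coord u m *\<^sub>C matrix_column m)"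
      using uz min_graph_expand[OF cs] by (intro ell2_eqI) (simp add: min_graph_def)
    then have "cinner v z = (\<Sum>m | coord u m \<noteq> 0. coord u m * cnj (coord w m))"
      using vw by (simp add: cinner_sum_right cinner_cscale_right cinner_matrix_column max_graph_def)
    also have "\<dots> = cinner w u"
      by (subst (3) compactly_supported_expand[OF cs])
         (simp add: cinner_sum_right cinner_cscale_right cinner_delta_right)
    finally show "cinner v (snd (u, z)) = cinner w (fst (u, z))" by simp
  qed
  then have "closure min_graph \<subseteq> ?S"
    by (rule closure_minimal) (intro closed_Collect_eq continuous_intros)
  then show "(v, w) \<in> adjoint_graph max_graph"
    using max_graph_subset_closure by (fastforce simp: adjoint_graph_def)
qed

text \<open>
  The closure of the minimal operator is already the maximal one, so there is no room in between.
  This makes the result insensitive to the order in which sums and closures are taken when an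
  operator is composed of several pieces.
\<close>
theorem self_adjoint_between:
  assumes "closed G" "min_graph \<subseteq> G" "G \<subseteq> max_graph"
  shows "self_adjoint G"
proof -
  have "G = max_graph"
    using closure_minimal[OF assms(2,1)] max_graph_subset_closure assms(3) by blast
  moreover have "adjoint_graph max_graph \<subseteq> adjoint_graph min_graph"
    by (auto simp: adjoint_graph_def min_graph_def max_graph_def)
  moreover have "closure (Domain max_graph) = UNIV"
  proof -
    have "{u. compactly_supported u} \<subseteq> Domain max_graph"
      using min_graph_total by (fastforce simp: min_graph_def max_graph_def)
    then show ?thesis using closure_mono compactly_supported_dense by blast
  qed
  ultimately show ?thesis
    using adjoint_min_graph max_graph_symmetric unfolding self_adjoint_def by blast
qed

end

section \<open>The conjugate operator\<close>

text \<open>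
  Moving the position operators to the left in \<open>(1/(4\<i>)) [(S\<^sup>m - S\<^sup>-\<^sup>m) N + N (S\<^sup>m - S\<^sup>-\<^sup>m)]\<close> gives the
  coefficient \<open>(2 n\<^sub>i - m) / (4\<i>)\<close> for the shift by \<open>m\<close> and \<open>-(2 n\<^sub>i + m) / (4\<i>)\<close> for the shift by \<open>-m\<close>.
  With an odd weight \<open>r\<close> both are instances of a single formula.
\<close>
definition dil_coeff :: "(int \<Rightarrow> real) \<Rightarrow> 'd::finite \<times> int \<Rightarrow> int ^ 'd \<Rightarrow> complex" where
  "dil_coeff r = (\<lambda>(i, m) n. - \<i> * of_real (r m * (2 * of_int (n $ i) - of_int m) / 4))"

lemma dil_operator:
  fixes I :: "'d::finite set"
  assumes "finite M" "\<And>m. m \<in> M \<Longrightarrow> - m \<in> M \<and> r (- m) = - r m"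
  shows "\<exists>c. symmetric_difference_operator (I \<times> M) (\<lambda>(i, m). axis i m) (dil_coeff r)
    (\<lambda>(i, m). (i, - m)) c"
proof -
  define c where "c = (\<Sum>m\<in>M. \<bar>r m\<bar> * (1 + \<bar>of_int m\<bar>))"
  have "symmetric_difference_operator (I \<times> M) (\<lambda>(i, m). axis i m) (dil_coeff r)
    (\<lambda>(i, m). (i, - m)) c"
  proof
    show "finite (I \<times> M)" using assms(1) by simp
    show "0 \<le> c" by (simp add: c_def sum_nonneg)
    fix j n assume "j \<in> I \<times> M"
    then obtain i m where j: "j = (i, m)" "i \<in> I" "m \<in> M" by auto
    show "(case case j of (i, m) \<Rightarrow> (i, - m) of (i, m) \<Rightarrow> axis i m)
        = - (case j of (i, m) \<Rightarrow> axis i m)"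
      by (simp add: j vec_eq_iff axis_def)
    show "dil_coeff r (case j of (i, m) \<Rightarrow> (i, - m)) (n - (case j of (i, m) \<Rightarrow> axis i m))
        = cnj (dil_coeff r j n)"
      using assms(2)[OF j(3)] by (simp add: j dil_coeff_def field_simps)
    have "cmod (dil_coeff r j n) = \<bar>r m\<bar> * \<bar>2 * of_int (n $ i) - of_int m\<bar> / 4"
      unfolding j dil_coeff_def prod.case norm_mult norm_of_real norm_minus_cancel
      by (simp add: abs_mult)
    also have "\<dots> \<le> \<bar>r m\<bar> * ((1 + \<bar>of_int m\<bar>) * (1 + l1 n))"
    proof -
      have "\<bar>2 * of_int (n $ i) - of_int m\<bar> / 4 \<le> l1 n + \<bar>of_int m\<bar>"
        using component_le_l1[of n i] l1_nonneg[of n]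
          abs_triangle_ineq4[of "2 * real_of_int (n $ i)" "real_of_int m"]
        by (simp add: abs_mult)
      also have "\<dots> \<le> (1 + \<bar>of_int m\<bar>) * (1 + l1 n)"
        using l1_nonneg[of n] by (simp add: algebra_simps)
      finally show ?thesis by (metis abs_ge_zero mult_left_mono times_divide_eq_right)
    qed
    also have "\<dots> \<le> c * (1 + l1 n)"
      unfolding mult.assoc[symmetric] c_def using assms(1) j l1_nonneg[of n]
      by (intro mult_right_mono member_le_sum) auto
    finally show "cmod (dil_coeff r j n) \<le> c * (1 + l1 n)" .
  qed (use assms in auto)
  then show ?thesis ..
qed

definition dil_seq ::
    "'d::finite set \<Rightarrow> int set \<Rightarrow> (int \<Rightarrow> real) \<Rightarrow> (int ^ 'd \<Rightarrow> complex) \<Rightarrow> int ^ 'd \<Rightarrow> complex" where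
  "dil_seq I M r u n = (\<Sum>i\<in>I. \<Sum>m\<in>M. dil_coeff r (i, m) n * u (n - axis i m))"

text \<open>
  The graph given by the coordinate formula is closed, and every closed graph between it and its
  restriction to finitely supported sequences is self-adjoint. The conjugate operator is placed
  between the two by following its definition: each summand, each sum and each closure stays in
  this range.
\<close>
lemma dil_graphs:
  fixes I :: "'d::finite set"
  assumes "finite M" "\<And>m. m \<in> M \<Longrightarrow> - m \<in> M \<and> r (- m) = - r m"
  shows "closed {(u, v). \<forall>n. coord v n = dil_seq I M r (coord u) n}"
    and "compactly_supported u \<Longrightarrow> \<exists>v. \<forall>n. coord v n = dil_seq I M r (coord u) n"
    and "closed G \<Longrightarrow>
      {(u, v). compactly_supported u \<and> (\<forall>n. coord v n = dil_seq I M r (coord u) n)} \<subseteq> G \<Longrightarrow>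
      G \<subseteq> {(u, v). \<forall>n. coord v n = dil_seq I M r (coord u) n} \<Longrightarrow> self_adjoint G"
proof -
  obtain c where "symmetric_difference_operator (I \<times> M) (\<lambda>(i, m). axis i m) (dil_coeff r)
    (\<lambda>(i, m). (i, - m)) c"
    using dil_operator[OF assms] by blast
  then interpret symmetric_difference_operator "I \<times> M" "\<lambda>(i, m). axis i m" "dil_coeff r"
    "\<lambda>(i, m). (i, - m)" c .
  have D: "D u n = dil_seq I M r u n" for u n
    unfolding D_def dil_seq_def sum.cartesian_product by (auto intro!: sum.cong)
  show "closed {(u, v). \<forall>n. coord v n = dil_seq I M r (coord u) n}"
    using closed_max_graph by (simp add: max_graph_def D)
  show "compactly_supported u \<Longrightarrow> \<exists>v. \<forall>n. coord v n = dil_seq I M r (coord u) n"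
    using min_graph_total[of u] by (auto simp: min_graph_def D)
  show "closed G \<Longrightarrow>
      {(u, v). compactly_supported u \<and> (\<forall>n. coord v n = dil_seq I M r (coord u) n)} \<subseteq> G \<Longrightarrow>
      G \<subseteq> {(u, v). \<forall>n. coord v n = dil_seq I M r (coord u) n} \<Longrightarrow> self_adjoint G"
    using self_adjoint_between[of G] by (simp add: min_graph_def max_graph_def D)
qed

abbreviation pm :: "nat \<Rightarrow> int set" where "pm m \<equiv> {int m, - int m}"

lemma pm_odd: "finite (pm m)" "k \<in> pm m \<Longrightarrow> - k \<in> pm m \<and> real_of_int (sgn (- k)) = - of_int (sgn k)"
  by (auto simp: sgn_minus)

lemma A_dir_coord:
  assumes "0 < m"
  shows "1 / (4 * \<i>) * (shift_diff_seq i m (position_seq i u) n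
     + position_seq i (shift_diff_seq i m u) n) = dil_seq {i} (pm m) sgn u n"
proof -
  have "1 / (4 * \<i>) = - \<i> / 4" by (simp add: field_simps)
  moreover have "int m \<noteq> - int m" "sgn (int m) = 1" using assms by auto
  ultimately show ?thesis
    by (simp add: dil_seq_def dil_coeff_def shift_diff_seq_def shift_seq_def position_seq_def
        sgn_minus algebra_simps add_divide_distrib diff_divide_distrib)
qed

lemma A_dir_between:
  assumes "0 < m"
  shows "A_dir i m \<subseteq> {(u, v). \<forall>n. coord v n = dil_seq {i} (pm m) sgn (coord u) n}"
    and "compactly_supported u \<Longrightarrow> (\<forall>n. coord v n = dil_seq {i} (pm m) sgn (coord u) n) \<Longrightarrow>
      (u, v) \<in> A_dir i m"
proof -
  show "A_dir i m \<subseteq> {(u, v). \<forall>n. coord v n = dil_seq {i} (pm m) sgn (coord u) n}"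
    unfolding A_dir_def A_dir_coord[OF assms]
    by (rule closure_minimal[OF _ dil_graphs(1)[OF pm_odd]]) auto
  show "compactly_supported u \<Longrightarrow> (\<forall>n. coord v n = dil_seq {i} (pm m) sgn (coord u) n) \<Longrightarrow>
      (u, v) \<in> A_dir i m"
    unfolding A_dir_def A_dir_coord[OF assms] by (rule closure_subset[THEN subsetD]) simp
qed

lemma dil_seq_UNIV: "dil_seq UNIV M r u n = (\<Sum>i\<in>UNIV. dil_seq {i} M r u n)"
  by (simp add: dil_seq_def)

lemma A_op_between:
  assumes "0 < m"
  shows "A_op m \<subseteq> {(u :: (int ^ 'd::finite) ell2, v). \<forall>n. coord v n = dil_seq UNIV (pm m) sgn (coord u) n}"
    and "compactly_supported (u :: (int ^ 'd::finite) ell2) \<Longrightarrow>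
      (\<forall>n. coord v n = dil_seq UNIV (pm m) sgn (coord u) n) \<Longrightarrow> (u, v) \<in> A_op m"
proof -
  show "A_op m \<subseteq> {(u :: (int ^ 'd) ell2, v). \<forall>n. coord v n = dil_seq UNIV (pm m) sgn (coord u) n}"
    unfolding A_op_def
  proof (rule closure_minimal[OF _ dil_graphs(1)[OF pm_odd]], clarify)
    fix u :: "(int ^ 'd) ell2" and f n
    assume "\<forall>i. (u, f i) \<in> A_dir i m"
    then have "coord (f i) n = dil_seq {i} (pm m) sgn (coord u) n" for i
      using A_dir_between(1)[OF assms] by blast
    then show "coord (\<Sum>i\<in>UNIV. f i) n = dil_seq UNIV (pm m) sgn (coord u) n"
      by (simp add: dil_seq_UNIV)
  qed
  assume cs: "compactly_supported (u :: (int ^ 'd) ell2)"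
    and v: "\<forall>n. coord v n = dil_seq UNIV (pm m) sgn (coord u) n"
  have "\<exists>w. \<forall>n. coord w n = dil_seq {i} (pm m) sgn (coord u) n" for i
    using dil_graphs(2)[OF pm_odd cs] .
  then obtain f where f: "\<And>i n. coord (f i) n = dil_seq {i} (pm m) sgn (coord u) n" by metis
  have "v = (\<Sum>i\<in>UNIV. f i)"
    by (rule ell2_eqI) (simp add: v dil_seq_UNIV f)
  moreover have "(u, f i) \<in> A_dir i m" for i
    using A_dir_between(2)[OF assms cs] f by blast
  ultimately show "(u, v) \<in> A_op m"
    unfolding A_op_def by (intro closure_subset[THEN subsetD]) blast
qed

text \<open>The odd coefficient sequence of \<open>A\<^sub>2 + (9/14) A\<^sub>4\<close>.\<close>
definition r_9_14 :: "int \<Rightarrow> real" where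
  "r_9_14 m = sgn m * rho_9_14 (nat \<bar>m\<bar>)"

abbreviation M_9_14 :: "int set" where "M_9_14 \<equiv> {2, - 2, 4, - 4}"

lemma r_9_14_odd: "finite M_9_14" "m \<in> M_9_14 \<Longrightarrow> - m \<in> M_9_14 \<and> r_9_14 (- m) = - r_9_14 m"
  by (auto simp: r_9_14_def)

lemma dil_seq_9_14:
  "dil_seq UNIV M_9_14 r_9_14 u n =
     dil_seq UNIV (pm 2) sgn u n + of_real (9/14) * dil_seq UNIV (pm 4) sgn u n"
  by (simp add: dil_seq_def dil_coeff_def r_9_14_def rho_9_14_def sum_distrib_left
      sum.distrib[symmetric] algebra_simps)

lemma conj_op_9_14_mem:
  assumes cs: "compactly_supported (u :: (int ^ 'd::finite) ell2)"
    and v: "\<forall>n. coord v n = dil_seq UNIV M_9_14 r_9_14 (coord u) n"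
  shows "(u, v) \<in> conj_op 2 rho_9_14"
proof -
  obtain w where w: "\<And>n. coord w n = dil_seq UNIV (pm 2) sgn (coord u) n"
    using dil_graphs(2)[OF pm_odd cs] by blast
  obtain z where z: "\<And>n. coord z n = dil_seq UNIV (pm 4) sgn (coord u) n"
    using dil_graphs(2)[OF pm_odd cs] by blast
  have "v = w + (9/14) *\<^sub>R z"
    by (rule ell2_eqI) (simp add: v w z dil_seq_9_14 scaleR_conv_of_real)
  moreover have "(u, w) \<in> A_op 2" "(u, z) \<in> A_op 4"
    using A_op_between(2)[OF _ cs] w z by simp_all
  ultimately show ?thesis
    unfolding conj_op_rho_9_14 by (intro closure_subset[THEN subsetD]) blast
qed

theorem self_adjoint_conj_op_9_14:
  "self_adjoint (conj_op 2 rho_9_14 :: (int ^ 'd::finite) graph)"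
proof (rule dil_graphs(3)[OF r_9_14_odd])
  show "closed (conj_op 2 rho_9_14 :: (int ^ 'd) graph)" by (simp add: conj_op_rho_9_14)
  show "{(u, v). compactly_supported u \<and> (\<forall>n. coord v n = dil_seq UNIV M_9_14 r_9_14 (coord u) n)}
      \<subseteq> (conj_op 2 rho_9_14 :: (int ^ 'd) graph)"
    using conj_op_9_14_mem by blast
  show "(conj_op 2 rho_9_14 :: (int ^ 'd) graph)
      \<subseteq> {(u, v). \<forall>n. coord v n = dil_seq UNIV M_9_14 r_9_14 (coord u) n}"
    unfolding conj_op_rho_9_14
  proof (rule closure_minimal[OF _ dil_graphs(1)[OF r_9_14_odd]], clarify)
    fix u v w :: "(int ^ 'd) ell2" and n
    assume "(u, v) \<in> A_op 2" "(u, w) \<in> A_op 4"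
    then have "coord v n = dil_seq UNIV (pm 2) sgn (coord u) n"
      "coord w n = dil_seq UNIV (pm 4) sgn (coord u) n"
      using A_op_between(1)[of 2] A_op_between(1)[of 4] by auto
    then show "coord (v + (9/14) *\<^sub>R w) n = dil_seq UNIV M_9_14 r_9_14 (coord u) n"
      by (simp add: dil_seq_9_14 scaleR_conv_of_real)
  qed
qed

section \<open>Fourier series on the torus\<close>

definition circle_measure :: "real measure" where
  "circle_measure = uniform_measure lborel {0..2 * pi}"

definition torus :: "('d::finite \<Rightarrow> real) measure" where
  "torus = PiM UNIV (\<lambda>_. circle_measure)"

lemma prob_space_circle: "prob_space circle_measure"
  unfolding circle_measure_def by (rule prob_space_uniform_measure) auto

lemma sets_circle [measurable_cong, simp]: "sets circle_measure = sets borel"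
  by (simp add: circle_measure_def)

lemma space_torus [simp]: "space torus = UNIV"
  by (simp add: torus_def space_PiM circle_measure_def)

lemma sets_torus [measurable_cong]: "sets torus = sets (PiM UNIV (\<lambda>_. borel))"
  unfolding torus_def by (rule sets_PiM_cong) auto

interpretation torus: prob_space torus
  unfolding torus_def by (rule prob_space_PiM) (rule prob_space_circle)

lemma integral_circle:
  fixes f :: "real \<Rightarrow> complex"
  assumes [measurable]: "f \<in> borel_measurable borel"
  shows "integral\<^sup>L circle_measure f = (\<integral>x. indicator {0..2 * pi} x *\<^sub>R f x \<partial>lborel) / (2 * pi)"
proof -
  have "1 / ennreal (2 * pi) = ennreal (1 / (2 * pi))"
    using divide_ennreal[of 1 "2 * pi"] by simp
  then have eq: "circle_measure = density lborel (\<lambda>x. ennreal (indicator {0..2 * pi} x / (2 * pi)))"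
    unfolding circle_measure_def uniform_measure_def
    by (intro density_cong AE_I2) (auto split: split_indicator)
  have "integral\<^sup>L circle_measure f = (\<integral>x. (indicator {0..2 * pi} x / (2 * pi)) *\<^sub>R f x \<partial>lborel)"
    unfolding eq by (rule integral_density) auto
  also have "\<dots> = (\<integral>x. (indicator {0..2 * pi} x *\<^sub>R f x) / (2 * pi) \<partial>lborel)"
    by (rule Bochner_Integration.integral_cong) (auto simp: scaleR_conv_of_real)
  finally show ?thesis by simp
qed

lemma continuous_on_cis_mult: "continuous_on A (\<lambda>x. cis (c * x))"
  by (intro continuous_intros)

lemma integral_circle_cis:
  "(\<integral>x. cis (of_int k * x) \<partial>circle_measure) = (if k = 0 then 1 else 0)"
proof (cases "k = 0")
  case True
  interpret prob_space circle_measure by (rule prob_space_circle)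
  show ?thesis using True prob_space by simp
next
  case False
  define F where "F x = cis (of_int k * x) / (\<i> * of_int k)" for x
  have "(\<integral>x. indicator {0..2 * pi} x *\<^sub>R cis (of_int k * x) \<partial>lborel) = F (2 * pi) - F 0"
  proof (rule integral_FTC_Icc)
    fix x :: real
    have "((\<lambda>z. exp (\<i> * of_int k * z) / (\<i> * of_int k)) has_field_derivative
        exp (\<i> * of_int k * of_real x)) (at (of_real x))"
      using False by (auto intro!: derivative_eq_intros)
    from has_vector_derivative_real_field[OF this]
    show "(F has_vector_derivative cis (of_int k * x)) (at x within {0..2 * pi})"
      unfolding F_def cis_conv_exp by (simp add: mult.assoc)
  qed (auto intro: continuous_on_cis_mult)
  moreover have "cis (of_int k * (2 * pi)) = 1"
    using cis_multiple_2pi[of "of_int k"] by (simp add: mult_ac)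
  ultimately have "(\<integral>x. indicator {0..2 * pi} x *\<^sub>R cis (of_int k * x) \<partial>lborel) = 0"
    by (simp add: F_def)
  then show ?thesis
    using False by (simp add: integral_circle borel_measurable_continuous_onI continuous_on_cis_mult)
qed

definition character :: "int ^ 'd::finite \<Rightarrow> ('d \<Rightarrow> real) \<Rightarrow> complex" where
  "character n \<theta> = (\<Prod>i\<in>UNIV. cis (of_int (n $ i) * \<theta> i))"

lemma character_add: "character (m + n) \<theta> = character m \<theta> * character n \<theta>"
  by (simp add: character_def prod.distrib[symmetric] cis_mult distrib_right)

lemma character_axis: "character (axis i m) \<theta> = cis (of_int m * \<theta> i)"
proof -
  have "character (axis i m) \<theta> = (\<Prod>j\<in>UNIV. if j = i then cis (of_int m * \<theta> i) else 1)"
    unfolding character_def by (intro prod.cong) (auto simp: axis_def)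
  then show ?thesis by simp
qed

lemma cnj_character: "cnj (character n \<theta>) = character (- n) \<theta>"
  by (simp add: character_def cis_cnj)

lemma norm_character [simp]: "cmod (character n \<theta>) = 1"
  by (simp add: character_def prod_norm[symmetric])

lemma measurable_coordinate [measurable]: "(\<lambda>\<theta>. \<theta> i) \<in> borel_measurable torus"
  unfolding measurable_cong_sets[OF sets_torus refl]
  by (rule measurable_component_singleton) simp

lemma measurable_cis [measurable]: "cis \<in> borel_measurable borel"
  using continuous_on_cis_mult[of UNIV 1] by (simp add: borel_measurable_continuous_onI)

lemma measurable_character [measurable]: "character n \<in> borel_measurable torus"
  unfolding character_def by measurable

lemma measurable_cis_mult [measurable]: "(\<lambda>x. cis (c * x)) \<in> borel_measurable circle_measure"
  unfolding measurable_cong_sets[OF sets_circle refl] by measurable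

lemma integral_character: "(\<integral>\<theta>. character n \<theta> \<partial>torus) = (if n = 0 then 1 else 0)"
proof -
  interpret circle: prob_space circle_measure by (rule prob_space_circle)
  interpret product_sigma_finite "\<lambda>_. circle_measure" ..
  have "(\<integral>\<theta>. character n \<theta> \<partial>torus) = (\<Prod>i\<in>UNIV. \<integral>x. cis (of_int (n $ i) * x) \<partial>circle_measure)"
    unfolding character_def torus_def
    by (rule product_integral_prod)
       (auto intro!: circle.integrable_const_bound[where B=1] measurable_cis_mult)
  also have "\<dots> = (if n = 0 then 1 else 0)"
    by (simp add: integral_circle_cis vec_eq_iff)
  finally show ?thesis .
qed

definition trig :: "(int ^ 'd::finite) ell2 \<Rightarrow> ('d \<Rightarrow> real) \<Rightarrow> complex" where
  "trig w \<theta> = (\<Sum>n | coord w n \<noteq> 0. coord w n * character n \<theta>)"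

lemma trig_superset:
  "finite F \<Longrightarrow> {n. coord w n \<noteq> 0} \<subseteq> F \<Longrightarrow> trig w \<theta> = (\<Sum>n\<in>F. coord w n * character n \<theta>)"
  unfolding trig_def by (rule sum.mono_neutral_left) auto

lemma trig_zero [simp]: "trig 0 = (\<lambda>_. 0)"
  by (simp add: trig_def fun_eq_iff)

lemma trig_delta [simp]: "trig (delta n) = character n"
  by (rule ext) (simp add: trig_superset[of "{n}"])

lemma trig_add:
  assumes "compactly_supported u" "compactly_supported v"
  shows "trig (u + v) \<theta> = trig u \<theta> + trig v \<theta>"
proof -
  let ?F = "{n. coord u n \<noteq> 0} \<union> {n. coord v n \<noteq> 0}"
  have "finite ?F" using assms by (simp add: compactly_supported_def)
  then show ?thesis
    by (subst (1 2 3) trig_superset[of ?F]) (auto simp: sum.distrib distrib_right)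
qed

lemma trig_cscale:
  assumes "compactly_supported u"
  shows "trig (c *\<^sub>C u) \<theta> = c * trig u \<theta>"
  using assms
  by (subst (1 2) trig_superset[of "{n. coord u n \<noteq> 0}"])
     (auto simp: compactly_supported_def sum_distrib_left mult.assoc)

lemma trig_scaleR: "compactly_supported u \<Longrightarrow> trig (r *\<^sub>R u) \<theta> = of_real r * trig u \<theta>"
  by (simp add: scaleR_eq_cscale trig_cscale)

lemma trig_diff:
  assumes "compactly_supported u" "compactly_supported v"
  shows "trig (u - v) \<theta> = trig u \<theta> - trig v \<theta>"
proof -
  have "trig (u + (- 1) *\<^sub>C v) \<theta> = trig u \<theta> - trig v \<theta>"
    using assms by (simp only: trig_add trig_cscale compactly_supported_cscale) simp
  then show ?thesis by (simp add: uminus_eq_cscale[symmetric])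
qed

lemma trig_sum:
  "(\<And>i. i \<in> I \<Longrightarrow> compactly_supported (f i)) \<Longrightarrow> trig (\<Sum>i\<in>I. f i) \<theta> = (\<Sum>i\<in>I. trig (f i) \<theta>)"
  by (induction I rule: infinite_finite_induct)
     (auto simp: trig_add compactly_supported_sum)

lemma compactly_supported_shift:
  assumes "compactly_supported w"
  shows "compactly_supported (shift i m w)"
  using assms
  by (intro compactly_supported_intro[of "(\<lambda>n. n + axis i m) ` {n. coord w n \<noteq> 0}"])
     (auto simp: compactly_supported_def shift.rep_eq shift_seq_def image_iff algebra_simps
       intro: exI[of _ "_ - axis i m"])

lemma trig_shift:
  assumes "compactly_supported w"
  shows "trig (shift i m w) \<theta> = cis (of_int m * \<theta> i) * trig w \<theta>"
proof -
  have "trig (shift i m w) \<theta> = (\<Sum>n | coord w n \<noteq> 0. coord w n * character (n + axis i m) \<theta>)"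
    unfolding trig_def
    by (rule sum.reindex_bij_witness[of _ "\<lambda>n. n + axis i m" "\<lambda>n. n - axis i m"])
       (auto simp: shift.rep_eq shift_seq_def)
  then show ?thesis
    by (simp add: trig_def sum_distrib_left character_add character_axis mult_ac)
qed

definition bounded_measurable :: "(('d::finite \<Rightarrow> real) \<Rightarrow> complex) \<Rightarrow> bool" where
  "bounded_measurable f \<longleftrightarrow> f \<in> borel_measurable torus \<and> bounded (range f)"

lemma bounded_measurableI:
  "f \<in> borel_measurable torus \<Longrightarrow> (\<And>\<theta>. cmod (f \<theta>) \<le> B) \<Longrightarrow> bounded_measurable f"
  by (auto simp: bounded_measurable_def bounded_iff)

lemma bounded_measurable_measurable [measurable_dest]:
  "bounded_measurable f \<Longrightarrow> f \<in> borel_measurable torus"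
  by (simp add: bounded_measurable_def)

lemma bounded_measurable_integrable: "bounded_measurable f \<Longrightarrow> integrable torus f"
  unfolding bounded_measurable_def bounded_iff
  by (auto intro: torus.integrable_const_bound)

lemma bounded_measurable_add:
  assumes "bounded_measurable f" "bounded_measurable g"
  shows "bounded_measurable (\<lambda>\<theta>. f \<theta> + g \<theta>)"
  using assms bounded_plus_comp[of f UNIV g]
  by (auto simp: bounded_measurable_def intro!: borel_measurable_add)

lemma bounded_measurable_diff:
  assumes "bounded_measurable f" "bounded_measurable g"
  shows "bounded_measurable (\<lambda>\<theta>. f \<theta> - g \<theta>)"
  using assms bounded_minus_comp[of f UNIV g]
  by (auto simp: bounded_measurable_def intro!: borel_measurable_diff)

lemma bounded_measurable_mult:
  assumes "bounded_measurable f" "bounded_measurable g"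
  shows "bounded_measurable (\<lambda>\<theta>. f \<theta> * g \<theta>)"
proof -
  obtain A B where "\<And>\<theta>. cmod (f \<theta>) \<le> A" "\<And>\<theta>. cmod (g \<theta>) \<le> B"
    using assms by (auto simp: bounded_measurable_def bounded_iff)
  then have "cmod (f \<theta> * g \<theta>) \<le> A * B" for \<theta>
    unfolding norm_mult by (intro mult_mono) (auto intro: order_trans[OF norm_ge_zero])
  then show ?thesis using assms by (intro bounded_measurableI[where B="A * B"]) auto
qed

lemma bounded_measurable_cnj: "bounded_measurable f \<Longrightarrow> bounded_measurable (\<lambda>\<theta>. cnj (f \<theta>))"
proof -
  have [measurable]: "cnj \<in> borel_measurable borel"
    by (intro borel_measurable_continuous_onI continuous_intros)
  assume "bounded_measurable f"
  then have [measurable]: "f \<in> borel_measurable torus" and "bounded (range f)"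
    by (auto simp: bounded_measurable_def)
  then show ?thesis unfolding bounded_measurable_def by (auto simp: bounded_iff)
qed

lemma bounded_measurable_const: "bounded_measurable (\<lambda>_. c)"
  by (rule bounded_measurableI[of _ "cmod c"]) auto

lemma bounded_measurable_character: "bounded_measurable (character n)"
  by (rule bounded_measurableI[of _ 1]) auto

lemma bounded_measurable_sum:
  "(\<And>i. i \<in> I \<Longrightarrow> bounded_measurable (f i)) \<Longrightarrow> bounded_measurable (\<lambda>\<theta>. \<Sum>i\<in>I. f i \<theta>)"
  by (induction I rule: infinite_finite_induct)
     (auto intro: bounded_measurable_add bounded_measurable_const)

lemma bounded_measurable_trig: "bounded_measurable (trig w)"
  unfolding trig_def[abs_def]
  by (intro bounded_measurable_sum bounded_measurable_mult bounded_measurable_const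
      bounded_measurable_character)

lemma bounded_measurable_indicator:
  "Z \<in> sets torus \<Longrightarrow> bounded_measurable (\<lambda>\<theta>. of_real (indicator Z \<theta>))"
  by (rule bounded_measurableI[of _ 1]) (auto split: split_indicator)

lemmas bounded_measurable_intros =
  bounded_measurable_add bounded_measurable_diff bounded_measurable_mult bounded_measurable_cnj
  bounded_measurable_const bounded_measurable_character bounded_measurable_sum
  bounded_measurable_trig bounded_measurable_indicator

lemma integrable_norm_sq:
  "bounded_measurable f \<Longrightarrow> integrable torus (\<lambda>\<theta>. (cmod (f \<theta>))\<^sup>2)"
  using integrable_norm[OF bounded_measurable_integrable[OF bounded_measurable_mult[of f f]]]
  by (simp add: norm_mult power2_eq_square)

definition fourier :: "(('d::finite \<Rightarrow> real) \<Rightarrow> complex) \<Rightarrow> int ^ 'd \<Rightarrow> complex" where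
  "fourier f n = (\<integral>\<theta>. cnj (character n \<theta>) * f \<theta> \<partial>torus)"

lemma integral_trig_mult:
  assumes "bounded_measurable f"
  shows "(\<integral>\<theta>. cnj (trig w \<theta>) * f \<theta> \<partial>torus) = (\<Sum>n | coord w n \<noteq> 0. cnj (coord w n) * fourier f n)"
proof -
  have "(\<integral>\<theta>. cnj (trig w \<theta>) * f \<theta> \<partial>torus) =
      (\<integral>\<theta>. (\<Sum>n | coord w n \<noteq> 0. cnj (coord w n) * (cnj (character n \<theta>) * f \<theta>)) \<partial>torus)"
    by (simp add: trig_def sum_distrib_right mult.assoc)
  also have "\<dots> = (\<Sum>n | coord w n \<noteq> 0. cnj (coord w n) * fourier f n)"
    unfolding fourier_def
    by (subst Bochner_Integration.integral_sum)
       (auto intro!: bounded_measurable_integrable bounded_measurable_intros assms)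
  finally show ?thesis .
qed

lemma fourier_character: "fourier (character m) n = (if n = m then 1 else 0)"
  unfolding fourier_def cnj_character character_add[symmetric] integral_character
  by (auto simp: algebra_simps)

lemma fourier_add:
  "bounded_measurable f \<Longrightarrow> bounded_measurable g \<Longrightarrow>
     fourier (\<lambda>\<theta>. f \<theta> + g \<theta>) n = fourier f n + fourier g n"
  unfolding fourier_def distrib_left
  by (intro Bochner_Integration.integral_add bounded_measurable_integrable bounded_measurable_intros)

lemma fourier_cmult: "fourier (\<lambda>\<theta>. c * f \<theta>) n = c * fourier f n"
  unfolding fourier_def by (simp add: mult.left_commute)

lemma fourier_zero: "fourier (\<lambda>_. 0) n = 0"
  by (simp add: fourier_def)

lemma fourier_sum:
  "(\<And>i. i \<in> I \<Longrightarrow> bounded_measurable (f i)) \<Longrightarrow>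
     fourier (\<lambda>\<theta>. \<Sum>i\<in>I. f i \<theta>) n = (\<Sum>i\<in>I. fourier (f i) n)"
  by (induction I rule: infinite_finite_induct)
     (auto simp: fourier_add bounded_measurable_sum fourier_zero)

lemma fourier_trig:
  assumes "compactly_supported w"
  shows "fourier (trig w) n = coord w n"
proof -
  have "fourier (trig w) n = (\<Sum>m | coord w m \<noteq> 0. coord w m * (if n = m then 1 else 0))"
    unfolding trig_def[abs_def]
    by (subst fourier_sum) (auto intro: bounded_measurable_intros simp: fourier_cmult fourier_character)
  then show ?thesis
    using assms by (simp add: compactly_supported_def if_distrib[of "\<lambda>x. _ * x"] cong: if_cong)
qed

lemma integral_trig_trig:
  "compactly_supported u \<Longrightarrow> compactly_supported v \<Longrightarrow>
     (\<integral>\<theta>. cnj (trig u \<theta>) * trig v \<theta> \<partial>torus) = cinner u v"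
  by (simp add: integral_trig_mult bounded_measurable_trig fourier_trig cinner_compactly_supported)

lemma norm_sq_eq_cnj_mult: "complex_of_real ((cmod z)\<^sup>2) = cnj z * z"
  by (metis complex_norm_square mult.commute)

lemma integral_norm_sq_trig:
  assumes "compactly_supported w"
  shows "(\<integral>\<theta>. (cmod (trig w \<theta>))\<^sup>2 \<partial>torus) = (norm w)\<^sup>2"
proof -
  have "of_real (\<integral>\<theta>. (cmod (trig w \<theta>))\<^sup>2 \<partial>torus) = (\<integral>\<theta>. cnj (trig w \<theta>) * trig w \<theta> \<partial>torus)"
    by (subst integral_complex_of_real[symmetric]) (simp only: norm_sq_eq_cnj_mult)
  then show ?thesis
    unfolding integral_trig_trig[OF assms assms] cinner_self_norm by (simp only: of_real_eq_iff)
qed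

lemma norm_sq_trig_distance:
  assumes "bounded_measurable f" "compactly_supported w"
  shows "(\<integral>\<theta>. (cmod (f \<theta> - trig w \<theta>))\<^sup>2 \<partial>torus) =
    (\<integral>\<theta>. (cmod (f \<theta>))\<^sup>2 \<partial>torus) - 2 * Re (\<Sum>n | coord w n \<noteq> 0. cnj (coord w n) * fourier f n) + (norm w)\<^sup>2"
proof -
  have eq: "(cmod (a - b))\<^sup>2 = (cmod a)\<^sup>2 - 2 * Re (cnj b * a) + (cmod b)\<^sup>2" for a b
    unfolding cmod_power2 by (simp add: power2_eq_square algebra_simps)
  define p where "p = (\<lambda>\<theta>. cnj (trig w \<theta>) * f \<theta>)"
  have int: "integrable torus p"
    unfolding p_def by (intro bounded_measurable_integrable bounded_measurable_intros assms)
  have "(\<integral>\<theta>. (cmod (f \<theta> - trig w \<theta>))\<^sup>2 \<partial>torus) =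
    (\<integral>\<theta>. (cmod (f \<theta>))\<^sup>2 - 2 * Re (p \<theta>) + (cmod (trig w \<theta>))\<^sup>2 \<partial>torus)"
    unfolding eq p_def ..
  also have "\<dots> = (\<integral>\<theta>. (cmod (f \<theta>))\<^sup>2 \<partial>torus) - 2 * Re (\<integral>\<theta>. p \<theta> \<partial>torus)
      + (\<integral>\<theta>. (cmod (trig w \<theta>))\<^sup>2 \<partial>torus)"
    using int integrable_norm_sq[OF assms(1)] integrable_norm_sq[OF bounded_measurable_trig[of w]]
    by simp
  also have "(\<integral>\<theta>. p \<theta> \<partial>torus) = (\<Sum>n | coord w n \<noteq> 0. cnj (coord w n) * fourier f n)"
    unfolding p_def by (rule integral_trig_mult[OF assms(1)])
  finally show ?thesis by (simp only: integral_norm_sq_trig[OF assms(2)])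
qed

text \<open>
  The squared distance to the truncated Fourier series is nonnegative.
\<close>
lemma bessel_finite:
  assumes "bounded_measurable f" "finite F"
  shows "(\<Sum>n\<in>F. (cmod (fourier f n))\<^sup>2) \<le> (\<integral>\<theta>. (cmod (f \<theta>))\<^sup>2 \<partial>torus)"
proof -
  define w where "w = (\<Sum>n\<in>F. fourier f n *\<^sub>C delta n)"
  have w: "coord w n = (if n \<in> F then fourier f n else 0)" for n
    unfolding w_def using assms(2) by (simp add: if_distrib[of "\<lambda>x. _ * x"] cong: if_cong)
  have cs: "compactly_supported w"
    by (rule compactly_supported_intro[OF assms(2)]) (simp add: w)
  have nz: "{n. coord w n \<noteq> 0} \<subseteq> F" by (auto simp: w)
  have 1: "(\<Sum>n | coord w n \<noteq> 0. cnj (coord w n) * fourier f n) = (\<Sum>n\<in>F. of_real ((cmod (fourier f n))\<^sup>2))"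
    using assms(2) nz by (subst sum.mono_neutral_left[of F])
      (auto simp: w norm_sq_eq_cnj_mult simp del: of_real_power)
  have 2: "(norm w)\<^sup>2 = (\<Sum>n\<in>F. (cmod (fourier f n))\<^sup>2)"
    unfolding norm_sq_compactly_supported[OF cs]
    using assms(2) nz by (subst sum.mono_neutral_left[of F]) (auto simp: w)
  have "0 \<le> (\<integral>\<theta>. (cmod (f \<theta> - trig w \<theta>))\<^sup>2 \<partial>torus)" by simp
  then show ?thesis
    unfolding norm_sq_trig_distance[OF assms(1) cs] 1 2 of_real_sum[symmetric] by simp
qed

definition fourier_coeffs :: "(('d::finite \<Rightarrow> real) \<Rightarrow> complex) \<Rightarrow> (int ^ 'd) ell2" where
  "fourier_coeffs f = Abs_ell2 (fourier f)"

lemma fourier_coeffs: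
  assumes "bounded_measurable f"
  shows coord_fourier_coeffs: "coord (fourier_coeffs f) n = fourier f n"
    and bessel: "(norm (fourier_coeffs f))\<^sup>2 \<le> (\<integral>\<theta>. (cmod (f \<theta>))\<^sup>2 \<partial>torus)"
proof -
  let ?C = "sqrt (\<integral>\<theta>. (cmod (f \<theta>))\<^sup>2 \<partial>torus)"
  have C: "?C\<^sup>2 = (\<integral>\<theta>. (cmod (f \<theta>))\<^sup>2 \<partial>torus)" by simp
  have *: "0 \<le> ?C" "\<And>F. finite F \<Longrightarrow> (\<Sum>n\<in>F. (cmod (fourier f n))\<^sup>2) \<le> ?C\<^sup>2"
    unfolding C using bessel_finite[OF assms] by auto
  show "coord (fourier_coeffs f) n = fourier f n"
    unfolding fourier_coeffs_def using coord_Abs_ell2[OF norm_le_of_finite(1)[OF *]] by simp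
  show "(norm (fourier_coeffs f))\<^sup>2 \<le> (\<integral>\<theta>. (cmod (f \<theta>))\<^sup>2 \<partial>torus)"
    using power_mono[OF norm_le_of_finite(2)[OF *] norm_ge_zero, of 2]
    by (simp only: C fourier_coeffs_def)
qed

lemma integral_trig_fourier_coeffs:
  assumes "bounded_measurable f" "compactly_supported w"
  shows "(\<integral>\<theta>. cnj (trig w \<theta>) * f \<theta> \<partial>torus) = cinner w (fourier_coeffs f)"
  using assms by (simp add: integral_trig_mult cinner_compactly_supported coord_fourier_coeffs)

lemma fourier_coeffs_add:
  "bounded_measurable f \<Longrightarrow> bounded_measurable g \<Longrightarrow>
     fourier_coeffs (\<lambda>\<theta>. f \<theta> + g \<theta>) = fourier_coeffs f + fourier_coeffs g"
  by (rule ell2_eqI) (simp add: coord_fourier_coeffs bounded_measurable_intros fourier_add)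

lemma fourier_coeffs_trig: "compactly_supported w \<Longrightarrow> fourier_coeffs (trig w) = w"
  by (rule ell2_eqI) (simp add: coord_fourier_coeffs bounded_measurable_trig fourier_trig)

text \<open>
  The coefficient sequence is the best approximation, so the defect in Bessel's inequality is at
  most the squared distance to any trigonometric polynomial.
\<close>
lemma bessel_defect:
  assumes "bounded_measurable f" "compactly_supported w"
  shows "(\<integral>\<theta>. (cmod (f \<theta>))\<^sup>2 \<partial>torus) - (norm (fourier_coeffs f))\<^sup>2 \<le> (\<integral>\<theta>. (cmod (f \<theta> - trig w \<theta>))\<^sup>2 \<partial>torus)"
proof -
  have "(\<Sum>n | coord w n \<noteq> 0. cnj (coord w n) * fourier f n) = cinner w (fourier_coeffs f)"
    using assms by (simp add: cinner_compactly_supported coord_fourier_coeffs)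
  then have "(\<integral>\<theta>. (cmod (f \<theta> - trig w \<theta>))\<^sup>2 \<partial>torus)
      = (\<integral>\<theta>. (cmod (f \<theta>))\<^sup>2 \<partial>torus) - 2 * inner w (fourier_coeffs f) + (norm w)\<^sup>2"
    by (simp add: norm_sq_trig_distance[OF assms] Re_cinner)
  moreover have "0 \<le> (norm (fourier_coeffs f - w))\<^sup>2" by simp
  then have "0 \<le> (norm (fourier_coeffs f))\<^sup>2 - 2 * inner w (fourier_coeffs f) + (norm w)\<^sup>2"
    by (simp add: power2_norm_eq_inner inner_diff_left inner_diff_right inner_commute)
  ultimately show ?thesis by simp
qed

text \<open>
  Membership in the closure of the trigonometric polynomials in the square norm, which is the
  hypothesis under which Bessel's inequality becomes Parseval's identity.
\<close>
definition approximable :: "(('d::finite \<Rightarrow> real) \<Rightarrow> complex) \<Rightarrow> bool" where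
  "approximable f \<longleftrightarrow> (\<forall>e>0. \<exists>w. compactly_supported w \<and>
     (\<integral>\<theta>. (cmod (f \<theta> - trig w \<theta>))\<^sup>2 \<partial>torus) < e)"

lemma parseval:
  assumes "bounded_measurable f" "approximable f"
  shows "(norm (fourier_coeffs f))\<^sup>2 = (\<integral>\<theta>. (cmod (f \<theta>))\<^sup>2 \<partial>torus)"
proof (rule antisym[OF bessel[OF assms(1)]], rule field_le_epsilon)
  fix e :: real assume "0 < e"
  then obtain w where "compactly_supported w" "(\<integral>\<theta>. (cmod (f \<theta> - trig w \<theta>))\<^sup>2 \<partial>torus) < e"
    using assms(2) by (auto simp: approximable_def)
  then show "(\<integral>\<theta>. (cmod (f \<theta>))\<^sup>2 \<partial>torus) \<le> (norm (fourier_coeffs f))\<^sup>2 + e"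
    using bessel_defect[OF assms(1)] by force
qed

lemma approximable_trig: "compactly_supported w \<Longrightarrow> approximable (trig w)"
  unfolding approximable_def by (auto intro!: exI[of _ w])

lemma integral_norm_sq_triangle:
  assumes "bounded_measurable f" "bounded_measurable g" "bounded_measurable k"
  shows "(\<integral>\<theta>. (cmod (f \<theta> - g \<theta>))\<^sup>2 \<partial>torus) \<le>
    2 * (\<integral>\<theta>. (cmod (f \<theta> - k \<theta>))\<^sup>2 \<partial>torus) + 2 * (\<integral>\<theta>. (cmod (k \<theta> - g \<theta>))\<^sup>2 \<partial>torus)"
proof -
  have int: "integrable torus (\<lambda>\<theta>. (cmod (f \<theta> - g \<theta>))\<^sup>2)" if "bounded_measurable f" "bounded_measurable g"
    for f g :: "('a \<Rightarrow> real) \<Rightarrow> complex"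
    by (intro integrable_norm_sq bounded_measurable_intros that)
  have "(cmod (a - b))\<^sup>2 \<le> 2 * (cmod (a - c))\<^sup>2 + 2 * (cmod (c - b))\<^sup>2" for a b c
  proof -
    have "(cmod (a - b))\<^sup>2 \<le> (cmod (a - c) + cmod (c - b))\<^sup>2"
      by (rule power_mono) (use norm_triangle_ineq[of "a - c" "c - b"] in auto)
    also have "\<dots> \<le> 2 * (cmod (a - c))\<^sup>2 + 2 * (cmod (c - b))\<^sup>2"
      using sum_squares_bound[of "cmod (a - c)" "cmod (c - b)"] by (simp add: power2_sum)
    finally show ?thesis .
  qed
  then have "(\<integral>\<theta>. (cmod (f \<theta> - g \<theta>))\<^sup>2 \<partial>torus) \<le>
    (\<integral>\<theta>. 2 * (cmod (f \<theta> - k \<theta>))\<^sup>2 + 2 * (cmod (k \<theta> - g \<theta>))\<^sup>2 \<partial>torus)"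
    using int assms by (intro integral_mono) auto
  then show ?thesis using int assms by simp
qed

lemma approximable_limit:
  assumes "bounded_measurable f"
    and "\<And>e. 0 < e \<Longrightarrow> \<exists>g. bounded_measurable g \<and> approximable g \<and>
      (\<integral>\<theta>. (cmod (f \<theta> - g \<theta>))\<^sup>2 \<partial>torus) < e"
  shows "approximable f"
  unfolding approximable_def
proof (intro allI impI)
  fix e :: real assume "0 < e"
  then have e: "0 < e / 4" by simp
  then obtain g where g: "bounded_measurable g" "approximable g"
    "(\<integral>\<theta>. (cmod (f \<theta> - g \<theta>))\<^sup>2 \<partial>torus) < e / 4"
    using assms(2) by blast
  obtain w where w: "compactly_supported w" "(\<integral>\<theta>. (cmod (g \<theta> - trig w \<theta>))\<^sup>2 \<partial>torus) < e / 4"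
    using g(2) e unfolding approximable_def by blast
  have "(\<integral>\<theta>. (cmod (f \<theta> - trig w \<theta>))\<^sup>2 \<partial>torus) < e"
    using integral_norm_sq_triangle[OF assms(1) bounded_measurable_trig[of w] g(1)] g(3) w(2) by linarith
  then show "\<exists>w. compactly_supported w \<and> (\<integral>\<theta>. (cmod (f \<theta> - trig w \<theta>))\<^sup>2 \<partial>torus) < e"
    using w(1) by blast
qed

lemma approximable_linear:
  assumes f: "bounded_measurable f" "approximable f" and g: "bounded_measurable g" "approximable g"
    and c: "cmod c \<le> 1"
  shows "approximable (\<lambda>\<theta>. f \<theta> + c * g \<theta>)"
  unfolding approximable_def
proof (intro allI impI)
  fix e :: real assume "0 < e"
  then have e: "0 < e / 4" by simp
  obtain u where u: "compactly_supported u" "(\<integral>\<theta>. (cmod (f \<theta> - trig u \<theta>))\<^sup>2 \<partial>torus) < e / 4"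
    using f(2) e unfolding approximable_def by blast
  obtain v where v: "compactly_supported v" "(\<integral>\<theta>. (cmod (g \<theta> - trig v \<theta>))\<^sup>2 \<partial>torus) < e / 4"
    using g(2) e unfolding approximable_def by blast
  let ?w = "u + c *\<^sub>C v"
  have w: "compactly_supported ?w"
    by (intro compactly_supported_add compactly_supported_cscale u v)
  have tw: "trig ?w \<theta> = trig u \<theta> + c * trig v \<theta>" for \<theta>
    by (simp add: trig_add trig_cscale compactly_supported_cscale u v)
  have "(\<integral>\<theta>. (cmod ((f \<theta> + c * g \<theta>) - trig ?w \<theta>))\<^sup>2 \<partial>torus)
      \<le> 2 * (\<integral>\<theta>. (cmod ((f \<theta> + c * g \<theta>) - (trig u \<theta> + c * g \<theta>)))\<^sup>2 \<partial>torus)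
        + 2 * (\<integral>\<theta>. (cmod ((trig u \<theta> + c * g \<theta>) - trig ?w \<theta>))\<^sup>2 \<partial>torus)"
    by (intro integral_norm_sq_triangle bounded_measurable_intros f g)
  also have "(\<integral>\<theta>. (cmod ((trig u \<theta> + c * g \<theta>) - trig ?w \<theta>))\<^sup>2 \<partial>torus)
      = (cmod c)\<^sup>2 * (\<integral>\<theta>. (cmod (g \<theta> - trig v \<theta>))\<^sup>2 \<partial>torus)"
    unfolding tw by (simp add: right_diff_distrib[symmetric] norm_mult power_mult_distrib)
  also have "\<dots> \<le> (\<integral>\<theta>. (cmod (g \<theta> - trig v \<theta>))\<^sup>2 \<partial>torus)"
    using c by (intro mult_left_le_one_le) (auto simp: power_le_one)
  also have "2 * (\<integral>\<theta>. (cmod ((f \<theta> + c * g \<theta>) - (trig u \<theta> + c * g \<theta>)))\<^sup>2 \<partial>torus)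
      + 2 * (\<integral>\<theta>. (cmod (g \<theta> - trig v \<theta>))\<^sup>2 \<partial>torus) < e"
    using u v by simp
  finally show "\<exists>w. compactly_supported w \<and>
      (\<integral>\<theta>. (cmod (f \<theta> + c * g \<theta> - trig w \<theta>))\<^sup>2 \<partial>torus) < e"
    using w by auto
qed

section \<open>Localisation by a spectral measure\<close>

definition pvm_measure :: "(real set \<Rightarrow> 'a ell2 \<Rightarrow> 'a ell2) \<Rightarrow> 'a ell2 \<Rightarrow> real measure" where
  "pvm_measure P u = measure_of UNIV (sets borel) (\<lambda>B. ennreal (Re (cinner u (P B u))))"

text \<open>
  The conditions of \<open>is_spectral_measure\<close> that do not involve the operator.
\<close>
locale pvm =
  fixes P :: "real set \<Rightarrow> 'a ell2 \<Rightarrow> 'a ell2"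
  assumes proj: "B \<in> sets borel \<Longrightarrow> orthogonal_projection (P B)"
    and P_UNIV: "P UNIV = id"
    and sums: "range F \<subseteq> sets borel \<Longrightarrow> disjoint_family F \<Longrightarrow>
      (\<lambda>k. P (F k) u) sums P (\<Union>k::nat. F k) u"
begin

lemma
  assumes "B \<in> sets borel"
  shows P_bounded_op: "bounded_op (P B)" and P_idem: "P B (P B u) = P B u"
    and P_sym: "inner (P B u) v = inner u (P B v)"
  using proj[OF assms] unfolding orthogonal_projection_def by (auto simp: Re_cinner[symmetric])

lemma
  assumes "B \<in> sets borel"
  shows P_add: "P B (u + v) = P B u + P B v" and P_diff: "P B (u - v) = P B u - P B v"
  using bounded_opD(2)[OF P_bounded_op[OF assms]] by (simp_all add: linear_add linear_diff)

lemma norm_sq_P: "B \<in> sets borel \<Longrightarrow> (norm (P B u))\<^sup>2 = inner u (P B u)"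
  by (simp add: power2_norm_eq_inner P_sym P_idem)

lemma norm_P_le:
  assumes "B \<in> sets borel"
  shows "norm (P B u) \<le> norm u"
proof (cases "P B u = 0")
  case False
  have "norm (P B u) * norm (P B u) \<le> norm u * norm (P B u)"
    using norm_sq_P[OF assms, of u] norm_cauchy_schwarz[of u "P B u"] by (simp add: power2_eq_square)
  then show ?thesis using False by simp
qed simp

lemma P_empty: "P {} u = 0"
proof -
  have "(\<lambda>k::nat. P {} u) sums P {} u"
    using sums[of "\<lambda>_. {}" u] by (simp add: disjoint_family_on_def)
  then have "(\<lambda>k::nat. P {} u) \<longlonglongrightarrow> 0" by (intro summable_LIMSEQ_zero sums_summable)
  then show ?thesis by (simp add: LIMSEQ_const_iff)
qed

lemma P_Un:
  assumes "A \<in> sets borel" "B \<in> sets borel" "A \<inter> B = {}"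
  shows "P (A \<union> B) u = P A u + P B u"
proof -
  have "(\<lambda>k. P (binaryset A B k) u) sums P (\<Union>k. binaryset A B k) u"
    using assms by (intro sums) (auto simp: range_binaryset_eq disjoint_family_on_def binaryset_def)
  moreover have "(\<lambda>k. P (binaryset A B k) u) sums (\<Sum>k\<in>{0, 1}. P (binaryset A B k) u)"
    by (rule sums_finite) (auto simp: binaryset_def P_empty)
  ultimately show ?thesis
    using sums_unique2 by (fastforce simp: UN_binaryset_eq binaryset_def)
qed

text \<open>If a sum of two projections is a projection, it is a contraction, so their ranges are orthogonal.\<close>
lemma P_disjoint:
  assumes "A \<in> sets borel" "B \<in> sets borel" "A \<inter> B = {}"
  shows "P B (P A u) = 0"
proof -
  let ?v = "P A u"
  have "(norm (P (A \<union> B) ?v))\<^sup>2 = inner ?v (P (A \<union> B) ?v)"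
    using assms by (intro norm_sq_P) auto
  also have "\<dots> = inner ?v (P A ?v) + inner ?v (P B ?v)"
    by (simp only: P_Un[OF assms] inner_add_right)
  also have "\<dots> = (norm ?v)\<^sup>2 + (norm (P B ?v))\<^sup>2"
    using assms by (simp add: norm_sq_P[symmetric] P_idem power2_norm_eq_inner)
  finally have "(norm ?v)\<^sup>2 + (norm (P B ?v))\<^sup>2 \<le> (norm ?v)\<^sup>2"
    using norm_P_le[of "A \<union> B" ?v] assms power_mono[of "norm (P (A \<union> B) ?v)" "norm ?v" 2] by simp
  then show ?thesis by simp
qed

lemma P_Int:
  assumes A: "A \<in> sets borel" and X: "X \<in> sets borel"
  shows "P X (P A u) = P (A \<inter> X) u"
proof -
  have "A = (A \<inter> X) \<union> (A - X)" "X = (A \<inter> X) \<union> (X - A)" by auto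
  then have 1: "P A u = P (A \<inter> X) u + P (A - X) u" for u
    using P_Un[of "A \<inter> X" "A - X" u] A X by (metis Diff_disjoint Int_Diff_disjoint sets.Diff sets.Int)
  have 2: "P X u = P (A \<inter> X) u + P (X - A) u" for u
    using P_Un[of "A \<inter> X" "X - A" u] A X \<open>X = (A \<inter> X) \<union> (X - A)\<close>
    by (metis Diff_disjoint Int_assoc Int_commute inf_bot_right sets.Diff sets.Int)
  have "P X (P A u) = P (A \<inter> X) (P A u)"
    unfolding 2 using A X P_disjoint[of A "X - A" u] by simp
  also have "\<dots> = P (A \<inter> X) (P (A \<inter> X) u) + P (A \<inter> X) (P (A - X) u)"
    unfolding 1 using A X by (simp add: P_add)
  also have "\<dots> = P (A \<inter> X) u"
  proof -
    have "(A - X) \<inter> (A \<inter> X) = {}" by auto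
    then show ?thesis using A X P_disjoint[of "A - X" "A \<inter> X" u] by (simp add: P_idem)
  qed
  finally show ?thesis .
qed

lemma
  shows space_pvm_measure [simp]: "space (pvm_measure P u) = UNIV"
    and sets_pvm_measure [simp, measurable_cong]: "sets (pvm_measure P u) = sets borel"
  unfolding pvm_measure_def using sets.sigma_sets_eq[of borel]
  by (simp_all add: space_measure_of_conv sets_measure_of_conv)

lemma measurable_pvm_measure [simp]:
  "f \<in> borel_measurable (pvm_measure P u) \<longleftrightarrow> f \<in> borel_measurable borel"
  by (simp add: measurable_cong_sets[OF sets_pvm_measure refl])

lemma emeasure_pvm_measure:
  assumes "B \<in> sets borel"
  shows "emeasure (pvm_measure P u) B = ennreal ((norm (P B u))\<^sup>2)"
proof -
  let ?m = "\<lambda>B. ennreal (Re (cinner u (P B u)))"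
  have "emeasure (pvm_measure P u) B = ?m B"
  proof (rule emeasure_measure_of[OF pvm_measure_def])
    show "positive (sets (pvm_measure P u)) ?m"
      by (simp add: positive_def P_empty)
    show "countably_additive (sets (pvm_measure P u)) ?m"
    proof (rule countably_additiveI)
      fix A :: "nat \<Rightarrow> real set"
      assume A: "range A \<subseteq> sets (pvm_measure P u)" "disjoint_family A"
      have "(\<lambda>k. inner u (P (A k) u)) sums inner u (P (\<Union>k. A k) u)"
        using A by (intro bounded_linear.sums[OF bounded_linear_inner_right] sums) auto
      moreover have "0 \<le> inner u (P (A k) u)" for k
        using A(1) norm_sq_P[of "A k" u] by (auto simp: image_subset_iff) (metis zero_le_power2)
      ultimately show "(\<Sum>k. ?m (A k)) = ?m (\<Union>k. A k)"
        unfolding Re_cinner by (intro suminf_ennreal_eq)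
    qed
  qed (use assms in auto)
  then show ?thesis using assms by (simp add: Re_cinner norm_sq_P)
qed

lemma finite_measure_pvm: "finite_measure (pvm_measure P u)"
  by standard (simp add: emeasure_pvm_measure)

lemma measure_pvm_measure:
  "B \<in> sets borel \<Longrightarrow> measure (pvm_measure P u) B = (norm (P B u))\<^sup>2"
  by (simp add: measure_def emeasure_pvm_measure)

text \<open>
  The scalar measure of a projected vector is the restriction of the original one. This is how an
  integral over a Borel set becomes a quadratic form on a spectral subspace.
\<close>
lemma pvm_measure_restrict:
  assumes "A \<in> sets borel"
  shows "pvm_measure P (P A u) = density (pvm_measure P u) (indicator A)"
proof (rule measure_eqI)
  fix X assume "X \<in> sets (pvm_measure P (P A u))"
  then have X: "X \<in> sets borel" by simp
  have "emeasure (density (pvm_measure P u) (indicator A)) X = emeasure (pvm_measure P u) (A \<inter> X)"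
    using assms X by (subst emeasure_density) (auto simp: indicator_inter_arith[symmetric])
  then show "emeasure (pvm_measure P (P A u)) X = emeasure (density (pvm_measure P u) (indicator A)) X"
    using assms X by (simp add: emeasure_pvm_measure P_Int)
qed simp

end

lemma is_spectral_measure_iff:
  "is_spectral_measure T P \<longleftrightarrow> pvm P \<and>
     (\<forall>u. integrable (pvm_measure P u) (\<lambda>x. x) \<and>
        cinner u (T u) = complex_of_real (\<integral>x. x \<partial>pvm_measure P u))"
  unfolding is_spectral_measure_def pvm_def pvm_measure_def Let_def by auto

text \<open>
  By polarisation the bound on the quadratic form is a bound on the bilinear form over \<open>V\<close>, and
  invariance makes \<open>S v\<close> itself available as a test vector.
\<close>
lemma norm_le_numerical_radius:
  fixes S :: "'a::real_inner \<Rightarrow> 'a"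
  assumes V: "subspace V" "\<And>z. z \<in> V \<Longrightarrow> S z \<in> V" and S: "linear S"
    and sym: "\<And>x y. inner (S x) y = inner x (S y)"
    and num: "\<And>z. z \<in> V \<Longrightarrow> \<bar>inner z (S z)\<bar> \<le> e * (norm z)\<^sup>2"
    and v: "v \<in> V"
  shows "norm (S v) \<le> e * norm v"
proof (cases "S v = 0")
  case True
  then show ?thesis
  proof (cases "v = 0")
    case False
    have "0 \<le> e * (norm v)\<^sup>2" using num[OF v] by linarith
    then have "0 \<le> e" using False by (simp add: zero_le_mult_iff)
    then show ?thesis using True by simp
  qed simp
next
  case False
  \<comment> \<open>Polarisation at \<open>v\<close> and the multiple of \<open>S v\<close> with the same norm as \<open>v\<close>.\<close>
  define y where "y = (norm v / norm (S v)) *\<^sub>R S v"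
  have y: "y \<in> V" unfolding y_def using V v by (simp add: subspace_scale)
  have ny: "norm y = norm v" using False by (simp add: y_def)
  have "4 * inner y (S v) = inner (y + v) (S (y + v)) - inner (y - v) (S (y - v))"
    using sym[of y v] sym[of v y]
    by (simp add: linear_add[OF S] linear_diff[OF S] inner_add_left inner_add_right
        inner_diff_left inner_diff_right inner_commute)
  also have "\<dots> \<le> e * (norm (y + v))\<^sup>2 + e * (norm (y - v))\<^sup>2"
    using num[of "y + v"] num[of "y - v"] y v V(1) by (simp add: subspace_add subspace_diff)
  also have "\<dots> = e * (2 * (norm y)\<^sup>2 + 2 * (norm v)\<^sup>2)"
    by (simp add: power2_norm_eq_inner inner_add_left inner_add_right inner_diff_left
        inner_diff_right inner_commute algebra_simps)
  finally have "inner y (S v) \<le> e * (norm v)\<^sup>2" by (simp add: ny)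
  moreover have "inner y (S v) = norm v * norm (S v)"
    using False by (simp add: y_def power2_norm_eq_inner[symmetric] power2_eq_square)
  ultimately have "norm v * norm (S v) \<le> norm v * (e * norm v)"
    by (simp add: power2_eq_square mult_ac)
  moreover have "v \<noteq> 0" using False linear_0[OF S] by auto
  ultimately show ?thesis by simp
qed

text \<open>
  The ranges of \<open>P B\<close> and of its complement are orthogonal for the quadratic form of \<open>T\<close>, because
  the integral over the real line splits; hence \<open>T\<close> leaves the range of \<open>P B\<close> invariant, and there
  its distance to \<open>E\<close> is controlled through the numerical radius.
\<close>
lemma spectral_localisation:
  assumes P: "is_spectral_measure T P" and T: "linear T"
    and sym: "\<And>x y. inner (T x) y = inner x (T y)"
    and B: "B \<in> sets borel" "B \<subseteq> {E - e..E + e}"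
    and v: "P B v = v"
  shows "norm (T v - E *\<^sub>R v) \<le> e * norm v"
proof -
  interpret pvm P using P by (simp add: is_spectral_measure_iff)
  have int: "integrable (pvm_measure P u) (\<lambda>x. x)"
    and form: "inner u (T u) = (\<integral>x. x \<partial>pvm_measure P u)" for u
    using P by (simp_all add: is_spectral_measure_iff Re_cinner[symmetric])
  have part: "inner (P A u) (T (P A u)) = (\<integral>x. indicator A x *\<^sub>R x \<partial>pvm_measure P u)"
    if "A \<in> sets borel" for A u
    unfolding form pvm_measure_restrict[OF that] ennreal_indicator[symmetric]
    using that by (subst integral_density) auto
  have B': "- B \<in> sets borel" using B by auto
  have split: "u = P B u + P (- B) u" for u
    using P_Un[OF B(1) B', of u] P_UNIV by simp
  have cross: "inner (P B u) (T (P (- B) u)) = 0" for u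
  proof -
    have "(\<integral>x. x \<partial>pvm_measure P u) =
        (\<integral>x. indicator B x *\<^sub>R x + indicator (- B) x *\<^sub>R x \<partial>pvm_measure P u)"
      by (intro Bochner_Integration.integral_cong) (auto split: split_indicator)
    also have "\<dots> = inner (P B u) (T (P B u)) + inner (P (- B) u) (T (P (- B) u))"
      unfolding part[OF B(1)] part[OF B']
      by (intro Bochner_Integration.integral_add integrable_mult_indicator int) (use B B' in auto)
    finally have "inner u (T u) = inner (P B u) (T (P B u)) + inner (P (- B) u) (T (P (- B) u))"
      by (simp add: form)
    moreover have "inner u (T u) = inner (P B u) (T (P B u)) + inner (P (- B) u) (T (P (- B) u))
        + 2 * inner (P B u) (T (P (- B) u))"
      using sym[of "P B u" "P (- B) u"]
      by (subst (1 2) split) (simp add: linear_add[OF T] inner_add_left inner_add_right inner_commute)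
    ultimately show ?thesis by simp
  qed
  have ortho: "inner x (T y) = 0" if x: "P B x = x" and y: "P B y = 0" for x y
  proof -
    have y': "P (- B) y = y" using split[of y] y by simp
    have x': "P (- B) x = 0" using P_disjoint[OF B(1) B', of x] x by simp
    show ?thesis using cross[of "x + y"] x y x' y' B B' by (simp add: P_add)
  qed
  define V where "V = {z. P B z = z}"
  have "subspace V"
    using bounded_opD(2)[OF P_bounded_op[OF B(1)]]
    by (auto simp: V_def subspace_def linear_0 linear_add linear_scale)
  have inv: "P B (T x) = T x" if x: "P B x = x" for x
  proof -
    define y where "y = T x - P B (T x)"
    have "P B y = 0" unfolding y_def using B(1) by (simp add: P_diff P_idem)
    then have "inner (T x) y = 0" using ortho[OF x] sym by metis
    moreover have "inner (P B (T x)) y = 0"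
      using \<open>P B y = 0\<close> B(1) by (simp add: P_sym)
    ultimately have "inner y y = 0" by (simp add: y_def inner_diff_left)
    then show ?thesis by (simp add: y_def)
  qed
  define S where "S z = T z - E *\<^sub>R z" for z
  have num: "\<bar>inner z (S z)\<bar> \<le> e * (norm z)\<^sup>2" if "z \<in> V" for z
  proof -
    have z: "P B z = z" using that by (simp add: V_def)
    interpret finite_measure "pvm_measure P z" by (rule finite_measure_pvm)
    have "P (- B) z = 0" using P_disjoint[OF B(1) B', of z] z by simp
    then have "AE x in pvm_measure P z. x \<in> B"
      using B' by (intro AE_I[of _ _ "- B"]) (auto simp: emeasure_pvm_measure)
    then have ae: "AE x in pvm_measure P z. \<bar>x - E\<bar> \<le> e"
      by eventually_elim (use B(2) in \<open>auto simp: abs_le_iff\<close>)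
    have mass: "measure (pvm_measure P z) UNIV = (norm z)\<^sup>2"
      by (simp add: measure_pvm_measure P_UNIV)
    have "inner z (S z) = (\<integral>x. x \<partial>pvm_measure P z) - E * (norm z)\<^sup>2"
      by (simp add: S_def inner_diff_right form power2_norm_eq_inner)
    also have "\<dots> = (\<integral>x. x - E \<partial>pvm_measure P z)"
      using int by (simp add: mass)
    finally have "\<bar>inner z (S z)\<bar> \<le> (\<integral>x. \<bar>x - E\<bar> \<partial>pvm_measure P z)"
      using integral_norm_bound[of "pvm_measure P z" "\<lambda>x. x - E"] by simp
    also have "\<dots> \<le> (\<integral>x. e \<partial>pvm_measure P z)"
      using int ae by (intro integral_mono_AE) auto
    finally show ?thesis by (simp add: mass mult.commute)
  qed
  have "norm (S v) \<le> e * norm v"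
  proof (rule norm_le_numerical_radius[OF \<open>subspace V\<close> _ _ _ num])
    show "S z \<in> V" if "z \<in> V" for z
      using that inv[of z] B(1) bounded_opD(2)[OF P_bounded_op[OF B(1)]]
      by (simp add: V_def S_def P_diff linear_scale)
    show "linear S" unfolding S_def
      by (intro linear_compose_sub T linear_scale_self)
    show "inner (S x) y = inner x (S y)" for x y
      by (simp add: S_def inner_diff_left inner_diff_right sym)
    show "v \<in> V" using v by (simp add: V_def)
  qed
  then show ?thesis by (simp add: S_def)
qed

section \<open>The spectral measure of the Laplacian\<close>

definition laplacian_symbol :: "('d::finite \<Rightarrow> real) \<Rightarrow> real" where
  "laplacian_symbol \<theta> = (\<Sum>i\<in>UNIV. cos (\<theta> i))"

lemma measurable_laplacian_symbol [measurable]: "laplacian_symbol \<in> borel_measurable torus"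
  unfolding laplacian_symbol_def[abs_def] by measurable

lemma laplacian_symbol_bound: "\<bar>laplacian_symbol (\<theta> :: 'd::finite \<Rightarrow> real)\<bar> \<le> real CARD('d)"
proof -
  have "\<bar>laplacian_symbol \<theta>\<bar> \<le> (\<Sum>i\<in>(UNIV :: 'd set). 1)"
    unfolding laplacian_symbol_def by (rule order_trans[OF sum_abs]) (rule sum_mono, rule abs_cos_le_one)
  then show ?thesis by simp
qed

lemma compactly_supported_laplacian:
  "compactly_supported w \<Longrightarrow> compactly_supported (laplacian w)"
  unfolding laplacian_def
  by (intro compactly_supported_sum compactly_supported_scaleR compactly_supported_add
      compactly_supported_shift)

lemma trig_laplacian:
  assumes "compactly_supported w"
  shows "trig (laplacian w) \<theta> = of_real (laplacian_symbol \<theta>) * trig w \<theta>"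
proof -
  have "trig (laplacian w) \<theta> = (\<Sum>i\<in>UNIV. of_real (1/2) * ((cis (\<theta> i) + cis (- \<theta> i)) * trig w \<theta>))"
    unfolding laplacian_def
    by (subst trig_sum)
       (simp_all add: assms trig_scaleR trig_add trig_shift compactly_supported_shift
         compactly_supported_scaleR compactly_supported_add distrib_right)
  also have "\<dots> = (\<Sum>i\<in>UNIV. of_real (cos (\<theta> i)) * trig w \<theta>)"
    by (intro sum.cong refl) (simp add: cis_conv_exp cos_of_real[symmetric] cos_exp_eq mult_ac)
  finally show ?thesis by (simp add: laplacian_symbol_def sum_distrib_right)
qed

lemma norm_shift: "norm (shift i m u) = norm u"
proof -
  have "shift_seq i (- m) \<circ> shift_seq i m = id"
    using shift_seq_add[of i "- m" m] by (simp add: shift_seq_0)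
  then have "shift i (- m) (shift i m u) = u"
    by (intro ell2_eqI) (simp add: shift.rep_eq fun_eq_iff)
  then have "cinner (shift i m u) (shift i m u) = cinner u u"
    by (simp add: shift_adjoint)
  then have "(norm (shift i m u))\<^sup>2 = (norm u)\<^sup>2"
    unfolding cinner_self_norm by (simp only: of_real_eq_iff)
  then show ?thesis by (simp add: power2_eq_iff_nonneg)
qed

lemma bounded_op_sum:
  "(\<And>i. i \<in> I \<Longrightarrow> bounded_op (T i)) \<Longrightarrow> bounded_op (\<lambda>u. \<Sum>i\<in>I. T i u)"
  unfolding bounded_op_def
  by (auto intro!: bounded_linear_sum ell2_eqI simp: sum_distrib_left)

lemma bounded_op_add: "bounded_op S \<Longrightarrow> bounded_op T \<Longrightarrow> bounded_op (\<lambda>u. S u + T u)"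
  unfolding bounded_op_def by (auto intro!: bounded_linear_add ell2_eqI simp: distrib_left)

lemma bounded_op_scaleR: "bounded_op T \<Longrightarrow> bounded_op (\<lambda>u. r *\<^sub>R T u)"
  unfolding bounded_op_def
  by (auto intro!: bounded_linear_scaleR_right[THEN bounded_linear_compose] ell2_eqI simp: mult_ac)

lemma bounded_op_diff: "bounded_op S \<Longrightarrow> bounded_op T \<Longrightarrow> bounded_op (\<lambda>u. S u - T u)"
  unfolding bounded_op_def by (auto intro!: bounded_linear_sub ell2_eqI simp: right_diff_distrib)

lemma bounded_op_shift: "bounded_op (shift i m)"
  unfolding bounded_op_def
  by (auto intro!: bounded_linear_intro[where K=1] ell2_eqI
      simp: norm_shift shift.rep_eq shift_seq_def)

lemma bounded_op_laplacian: "bounded_op laplacian"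
  unfolding laplacian_def[abs_def]
  by (intro bounded_op_sum bounded_op_scaleR bounded_op_add bounded_op_shift)

lemma laplacian_symmetric: "cinner (laplacian u) v = cinner u (laplacian v)"
  unfolding laplacian_def
  by (simp add: cinner_sum_left cinner_sum_right cinner_scaleR_left cinner_scaleR_right
      cinner_add_left cinner_add_right shift_adjoint add.commute)

text \<open>
  Multiplication by a polynomial in the symbol is a polynomial in the Laplacian, so it preserves
  finite support.
\<close>
lemma trig_polynomial_symbol:
  fixes w :: "(int ^ 'd::finite) ell2"
  assumes "real_polynomial_function p" "compactly_supported w"
  shows "\<exists>w'. compactly_supported w' \<and> (\<forall>\<theta>. trig w' \<theta> = of_real (p (laplacian_symbol \<theta>)) * trig w \<theta>)"
  using assms
proof (induction p arbitrary: w)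
  case (linear f)
  have "f (laplacian_symbol \<theta>) = f 1 * laplacian_symbol \<theta>" for \<theta> :: "'d \<Rightarrow> real"
    using linear_cmul[OF bounded_linear.linear[OF linear(1)], of "laplacian_symbol \<theta>" 1] by simp
  then show ?case
    by (intro exI[of _ "f 1 *\<^sub>R laplacian w"])
       (simp add: linear compactly_supported_scaleR compactly_supported_laplacian trig_scaleR
         trig_laplacian)
next
  case (const c)
  then show ?case
    by (intro exI[of _ "c *\<^sub>R w"]) (simp add: compactly_supported_scaleR trig_scaleR)
next
  case (add f g)
  obtain u v where "compactly_supported u" "\<forall>\<theta>. trig u \<theta> = of_real (f (laplacian_symbol \<theta>)) * trig w \<theta>"
    "compactly_supported v" "\<forall>\<theta>. trig v \<theta> = of_real (g (laplacian_symbol \<theta>)) * trig w \<theta>"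
    using add.IH add.prems by metis
  then show ?case
    by (intro exI[of _ "u + v"]) (simp add: compactly_supported_add trig_add distrib_right)
next
  case (mult f g)
  obtain u where u: "compactly_supported u" "\<forall>\<theta>. trig u \<theta> = of_real (g (laplacian_symbol \<theta>)) * trig w \<theta>"
    using mult.IH(2) mult.prems by metis
  obtain v where "compactly_supported v" "\<forall>\<theta>. trig v \<theta> = of_real (f (laplacian_symbol \<theta>)) * trig u \<theta>"
    using mult.IH(1) u(1) by metis
  with u show ?case by (intro exI[of _ v]) (simp add: mult.assoc)
qed

definition mask :: "('d::finite \<Rightarrow> real) set \<Rightarrow> (('d \<Rightarrow> real) \<Rightarrow> complex) \<Rightarrow> ('d \<Rightarrow> real) \<Rightarrow> complex" where
  "mask Z f \<theta> = of_real (indicator Z \<theta>) * f \<theta>"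

lemma bounded_measurable_mask:
  "Z \<in> sets torus \<Longrightarrow> bounded_measurable f \<Longrightarrow> bounded_measurable (mask Z f)"
  unfolding mask_def[abs_def] by (intro bounded_measurable_intros)

lemma norm_mask_le: "cmod (mask Z f \<theta>) \<le> cmod (f \<theta>)"
  by (simp add: mask_def norm_mult split: split_indicator)

lemma integral_norm_sq_mask_le:
  assumes "Z \<in> sets torus" "bounded_measurable f"
  shows "(\<integral>\<theta>. (cmod (mask Z f \<theta>))\<^sup>2 \<partial>torus) \<le> (\<integral>\<theta>. (cmod (f \<theta>))\<^sup>2 \<partial>torus)"
  by (intro integral_mono integrable_norm_sq bounded_measurable_mask assms power_mono norm_mask_le) simp

lemma integral_mask_tail:
  fixes f :: "('d::finite \<Rightarrow> real) \<Rightarrow> complex"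
  assumes Z: "\<And>k. Z k \<in> sets torus" and f: "bounded_measurable f"
    and tail: "\<And>\<theta>. eventually (\<lambda>k. \<theta> \<notin> Z k) sequentially"
  shows "(\<lambda>k. \<integral>\<theta>. (cmod (mask (Z k) f \<theta>))\<^sup>2 \<partial>torus) \<longlonglongrightarrow> 0"
proof -
  have "(\<lambda>k. \<integral>\<theta>. (cmod (mask (Z k) f \<theta>))\<^sup>2 \<partial>torus) \<longlonglongrightarrow> integral\<^sup>L torus (\<lambda>\<theta>::'d \<Rightarrow> real. 0)"
  proof (rule integral_dominated_convergence)
    show "integrable torus (\<lambda>\<theta>. (cmod (f \<theta>))\<^sup>2)" by (rule integrable_norm_sq[OF f])
    show "(\<lambda>\<theta>. (cmod (mask (Z k) f \<theta>))\<^sup>2) \<in> borel_measurable torus" for k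
      by (rule borel_measurable_integrable[OF integrable_norm_sq[OF bounded_measurable_mask[OF Z f]]])
    show "AE \<theta> in torus. (\<lambda>k. (cmod (mask (Z k) f \<theta>))\<^sup>2) \<longlonglongrightarrow> 0"
    proof (rule AE_I2)
      fix \<theta>
      show "(\<lambda>k. (cmod (mask (Z k) f \<theta>))\<^sup>2) \<longlonglongrightarrow> 0"
        by (rule tendsto_eventually) (use tail[of \<theta>] in \<open>eventually_elim, simp add: mask_def\<close>)
    qed
    show "AE \<theta> in torus. norm ((cmod (mask (Z k) f \<theta>))\<^sup>2) \<le> (cmod (f \<theta>))\<^sup>2" for k
      by (auto intro!: AE_I2 power_mono norm_mask_le)
  qed simp
  then show ?thesis by simp
qed

definition symbol_set :: "real set \<Rightarrow> ('d::finite \<Rightarrow> real) set" where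
  "symbol_set B = laplacian_symbol -` B"

lemma symbol_set_measurable [measurable]: "B \<in> sets borel \<Longrightarrow> symbol_set B \<in> sets torus"
  unfolding symbol_set_def using measurable_sets[OF measurable_laplacian_symbol, of B] by simp

text \<open>
  A half-line indicator is a bounded limit of continuous functions, and those are uniform limits
  of polynomials on the compact range of the laplacian_symbol.
\<close>
lemma approximable_half_line:
  assumes w: "compactly_supported (w :: (int ^ 'd::finite) ell2)"
  shows "approximable (mask (symbol_set {..t}) (trig w))"
proof (rule approximable_limit)
  show bm: "bounded_measurable (mask (symbol_set {..t}) (trig w))"
    by (intro bounded_measurable_mask bounded_measurable_trig symbol_set_measurable) simp
  define g where "g k x = max 0 (min 1 (1 - real k * (x - t)))" for k x
  have cont: "continuous_on A (g k)" for A k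
    unfolding g_def by (intro continuous_intros)
  have [measurable]: "g k \<in> borel_measurable borel" for k
    by (intro borel_measurable_continuous_onI cont)
  have g01: "0 \<le> g k x" "g k x \<le> 1" for k x by (auto simp: g_def)
  define G where "G k \<theta> = of_real (g k (laplacian_symbol \<theta>)) * trig w \<theta>" for k \<theta>
  have bmG: "bounded_measurable (G k)" for k
    unfolding G_def
  proof (rule bounded_measurable_mult[OF _ bounded_measurable_trig])
    show "bounded_measurable (\<lambda>\<theta>. of_real (g k (laplacian_symbol \<theta>)))"
      by (rule bounded_measurableI[of _ 1]) (use g01 in auto)
  qed
  have appr: "approximable (G k)" for k
    unfolding approximable_def
  proof (intro allI impI)
    fix e :: real assume e: "0 < e"
    define N where "N = (norm w)\<^sup>2 + 1"
    define d where "d = sqrt (e / (2 * N))"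
    have N: "0 < N" by (simp add: N_def add_nonneg_pos)
    have d: "0 < d" "d\<^sup>2 = e / (2 * N)"
      using e N by (simp_all add: d_def)
    obtain p where p: "real_polynomial_function p"
      "\<And>x. x \<in> {- real CARD('d)..real CARD('d)} \<Longrightarrow> \<bar>g k x - p x\<bar> < d"
      using Stone_Weierstrass_real_polynomial_function[OF compact_Icc cont d(1)] by metis
    obtain w' where w': "compactly_supported w'" "\<And>\<theta>. trig w' \<theta> = of_real (p (laplacian_symbol \<theta>)) * trig w \<theta>"
      using trig_polynomial_symbol[OF p(1) w] by metis
    have "(\<integral>\<theta>. (cmod (G k \<theta> - trig w' \<theta>))\<^sup>2 \<partial>torus) \<le> (\<integral>\<theta>. d\<^sup>2 * (cmod (trig w \<theta>))\<^sup>2 \<partial>torus)"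
    proof (rule integral_mono)
      show "integrable torus (\<lambda>\<theta>. (cmod (G k \<theta> - trig w' \<theta>))\<^sup>2)"
        by (intro integrable_norm_sq bounded_measurable_intros bmG)
      show "integrable torus (\<lambda>\<theta>. d\<^sup>2 * (cmod (trig w \<theta>))\<^sup>2)"
        by (intro integrable_mult_right integrable_norm_sq bounded_measurable_trig)
      fix \<theta> :: "'d \<Rightarrow> real"
      have "\<bar>g k (laplacian_symbol \<theta>) - p (laplacian_symbol \<theta>)\<bar> < d"
        by (rule p(2)) (use laplacian_symbol_bound[of \<theta>] in \<open>auto simp: abs_le_iff\<close>)
      then have "\<bar>g k (laplacian_symbol \<theta>) - p (laplacian_symbol \<theta>)\<bar> * cmod (trig w \<theta>) \<le> d * cmod (trig w \<theta>)"
        by (intro mult_right_mono) auto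
      moreover have "G k \<theta> - trig w' \<theta> = of_real (g k (laplacian_symbol \<theta>) - p (laplacian_symbol \<theta>)) * trig w \<theta>"
        by (simp add: G_def w' left_diff_distrib)
      ultimately have "cmod (G k \<theta> - trig w' \<theta>) \<le> d * cmod (trig w \<theta>)"
        by (simp only: norm_mult norm_of_real)
      then show "(cmod (G k \<theta> - trig w' \<theta>))\<^sup>2 \<le> d\<^sup>2 * (cmod (trig w \<theta>))\<^sup>2"
        unfolding power_mult_distrib[symmetric] by (intro power_mono) auto
    qed
    also have "\<dots> = d\<^sup>2 * (norm w)\<^sup>2" by (simp add: integral_norm_sq_trig[OF w])
    also have "\<dots> \<le> d\<^sup>2 * N" by (intro mult_left_mono) (auto simp: N_def)
    also have "\<dots> < e" using e N by (simp add: d(2))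
    finally show "\<exists>w'. compactly_supported w' \<and> (\<integral>\<theta>. (cmod (G k \<theta> - trig w' \<theta>))\<^sup>2 \<partial>torus) < e"
      using w'(1) by blast
  qed
  have lim: "(\<lambda>k. \<integral>\<theta>. (cmod (mask (symbol_set {..t}) (trig w) \<theta> - G k \<theta>))\<^sup>2 \<partial>torus) \<longlonglongrightarrow> integral\<^sup>L torus (\<lambda>\<theta>::'d \<Rightarrow> real. 0)"
  proof (rule integral_dominated_convergence)
    show "integrable torus (\<lambda>\<theta>. (cmod (trig w \<theta>))\<^sup>2)"
      by (rule integrable_norm_sq[OF bounded_measurable_trig])
    have diff: "mask (symbol_set {..t}) (trig w) \<theta> - G k \<theta> = of_real (indicator {..t} (laplacian_symbol \<theta>) - g k (laplacian_symbol \<theta>)) * trig w \<theta>" for k \<theta>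
      by (simp add: G_def mask_def symbol_set_def indicator_def left_diff_distrib)
    show "(\<lambda>\<theta>. (cmod (mask (symbol_set {..t}) (trig w) \<theta> - G k \<theta>))\<^sup>2) \<in> borel_measurable torus" for k
      by (intro borel_measurable_integrable integrable_norm_sq bounded_measurable_intros bmG bm)
    show "AE \<theta> in torus. norm ((cmod (mask (symbol_set {..t}) (trig w) \<theta> - G k \<theta>))\<^sup>2) \<le> (cmod (trig w \<theta>))\<^sup>2" for k
    proof (rule AE_I2)
      fix \<theta> :: "'d \<Rightarrow> real"
      have "\<bar>indicator {..t} (laplacian_symbol \<theta>) - g k (laplacian_symbol \<theta>)\<bar> \<le> 1"
        using g01[of k "laplacian_symbol \<theta>"] by (auto simp: abs_le_iff split: split_indicator)
      then have "cmod (mask (symbol_set {..t}) (trig w) \<theta> - G k \<theta>) \<le> cmod (trig w \<theta>)"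
        unfolding diff norm_mult norm_of_real by (intro mult_left_le_one_le) auto
      then show "norm ((cmod (mask (symbol_set {..t}) (trig w) \<theta> - G k \<theta>))\<^sup>2) \<le> (cmod (trig w \<theta>))\<^sup>2"
        by (simp add: power_mono)
    qed
    show "AE \<theta> in torus. (\<lambda>k. (cmod (mask (symbol_set {..t}) (trig w) \<theta> - G k \<theta>))\<^sup>2) \<longlonglongrightarrow> 0"
    proof (rule AE_I2)
      fix \<theta> :: "'d \<Rightarrow> real"
      have ev: "eventually (\<lambda>k. g k (laplacian_symbol \<theta>) = indicator {..t} (laplacian_symbol \<theta>)) sequentially"
      proof (cases "laplacian_symbol \<theta> \<le> t")
        case True
        then have "g k (laplacian_symbol \<theta>) = 1" for k
          by (simp add: g_def mult_nonneg_nonpos)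
        then show ?thesis using True by simp
      next
        case False
        obtain k0 :: nat where k0: "1 / (laplacian_symbol \<theta> - t) < real k0" using reals_Archimedean2 by blast
        have "g k (laplacian_symbol \<theta>) = 0" if "k \<ge> k0" for k
        proof -
          have "1 < real k0 * (laplacian_symbol \<theta> - t)" using k0 False by (simp add: field_simps)
          also have "\<dots> \<le> real k * (laplacian_symbol \<theta> - t)" using that False by (intro mult_right_mono) auto
          finally show ?thesis by (simp add: g_def)
        qed
        then show ?thesis using False by (auto simp: eventually_sequentially)
      qed
      show "(\<lambda>k. (cmod (mask (symbol_set {..t}) (trig w) \<theta> - G k \<theta>))\<^sup>2) \<longlonglongrightarrow> 0"
        by (rule tendsto_eventually, rule eventually_mono[OF ev]) (simp add: diff)
    qed
  qed simp
  show "\<exists>g. bounded_measurable g \<and> approximable g \<and>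
      (\<integral>\<theta>. (cmod (mask (symbol_set {..t}) (trig w) \<theta> - g \<theta>))\<^sup>2 \<partial>torus) < e" if "0 < e" for e
  proof -
    have "eventually (\<lambda>k. (\<integral>\<theta>. (cmod (mask (symbol_set {..t}) (trig w) \<theta> - G k \<theta>))\<^sup>2 \<partial>torus) < e) sequentially"
      using that by (intro order_tendstoD(2)[OF lim]) simp
    then obtain k where "(\<integral>\<theta>. (cmod (mask (symbol_set {..t}) (trig w) \<theta> - G k \<theta>))\<^sup>2 \<partial>torus) < e"
      by (auto simp: eventually_sequentially)
    then show ?thesis using bmG appr by blast
  qed
qed

text \<open>
  The half-lines are closed under intersection and generate the Borel sets. The class of sets with
  the approximation property is closed under complements and, since the tails of a disjoint union
  have vanishing integral, under countable disjoint unions.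
\<close>
lemma approximable_symbol_set:
  assumes B: "B \<in> sets borel" and w: "compactly_supported (w :: (int ^ 'd::finite) ell2)"
  shows "approximable (mask (symbol_set B) (trig w))"
proof -
  have gen: "sets borel = sigma_sets UNIV (range (\<lambda>t::real. {..t}))"
    by (subst borel_eq_atMost) (simp add: sets_measure_of)
  have "Int_stable (range (\<lambda>t::real. {..t}))"
    by (auto simp: Int_stable_def)
  moreover have "range (\<lambda>t::real. {..t}) \<subseteq> Pow UNIV" by simp
  moreover have "B \<in> sigma_sets UNIV (range (\<lambda>t::real. {..t}))" using B gen by simp
  ultimately show ?thesis
  proof (induction rule: sigma_sets_induct_disjoint)
    case (basic A)
    then show ?case using approximable_half_line[OF w] by auto
  next
    case empty
    then show ?case
      using approximable_trig[OF compactly_supported_zero] by (simp add: mask_def[abs_def] symbol_set_def)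
  next
    case (compl A)
    then have A: "A \<in> sets borel" using gen by simp
    have "approximable (\<lambda>\<theta>. trig w \<theta> + (- 1) * mask (symbol_set A) (trig w) \<theta>)"
      by (intro approximable_linear bounded_measurable_mask bounded_measurable_trig
          approximable_trig w compl symbol_set_measurable A) simp
    moreover have "(\<lambda>\<theta>. trig w \<theta> + (- 1) * mask (symbol_set A) (trig w) \<theta>) = mask (symbol_set (UNIV - A)) (trig w)"
      by (auto simp: mask_def symbol_set_def split: split_indicator)
    ultimately show ?case by simp
  next
    case (union A)
    then have A: "\<And>k. A k \<in> sets borel" using gen by auto
    define U where "U n = (\<Union>k<n. A k)" for n :: nat
    have U: "U n \<in> sets borel" for n unfolding U_def using A by auto
    have appr: "approximable (mask (symbol_set (U n)) (trig w))" for n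
    proof (induction n)
      case 0
      then show ?case
        using approximable_trig[OF compactly_supported_zero]
        by (simp add: U_def mask_def[abs_def] symbol_set_def)
    next
      case (Suc n)
      have "A n \<inter> A k = {}" if "k < n" for k
        using union(1) that by (auto simp: disjoint_family_on_def)
      then have "U n \<inter> A n = {}" unfolding U_def by blast
      then have "mask (symbol_set (U (Suc n))) (trig w) =
          (\<lambda>\<theta>. mask (symbol_set (U n)) (trig w) \<theta> + 1 * mask (symbol_set (A n)) (trig w) \<theta>)"
        by (intro ext) (auto simp: mask_def symbol_set_def U_def lessThan_Suc split: split_indicator)
      moreover have "approximable (\<lambda>\<theta>. mask (symbol_set (U n)) (trig w) \<theta> + 1 * mask (symbol_set (A n)) (trig w) \<theta>)"
        by (intro approximable_linear bounded_measurable_mask bounded_measurable_trig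
            symbol_set_measurable A U Suc union) simp
      ultimately show ?case by simp
    qed
    let ?V = "\<Union>k. A k"
    have V: "?V \<in> sets borel" using A by auto
    have diff: "mask (symbol_set ?V) (trig w) \<theta> - mask (symbol_set (U n)) (trig w) \<theta>
        = mask (symbol_set (?V - U n)) (trig w) \<theta>" for n \<theta>
      by (auto simp: mask_def symbol_set_def U_def split: split_indicator)
    have tail: "(\<lambda>n. \<integral>\<theta>. (cmod (mask (symbol_set (?V - U n)) (trig w) \<theta>))\<^sup>2 \<partial>torus) \<longlonglongrightarrow> 0"
    proof (rule integral_mask_tail)
      show "symbol_set (?V - U n) \<in> sets torus" for n using V U by (intro symbol_set_measurable) auto
      show "bounded_measurable (trig w)" by (rule bounded_measurable_trig)
      show "eventually (\<lambda>n. \<theta> \<notin> symbol_set (?V - U n)) sequentially" for \<theta>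
      proof (cases "\<exists>k. laplacian_symbol \<theta> \<in> A k")
        case True
        then obtain k where "laplacian_symbol \<theta> \<in> A k" by blast
        then show ?thesis
          unfolding eventually_sequentially symbol_set_def U_def
          by (intro exI[of _ "Suc k"]) (auto simp: Suc_le_eq)
      qed (simp add: symbol_set_def)
    qed
    show ?case
    proof (rule approximable_limit)
      show "bounded_measurable (mask (symbol_set ?V) (trig w))"
        by (intro bounded_measurable_mask bounded_measurable_trig symbol_set_measurable V)
      fix e :: real assume "0 < e"
      then obtain n where "(\<integral>\<theta>. (cmod (mask (symbol_set (?V - U n)) (trig w) \<theta>))\<^sup>2 \<partial>torus) < e"
        using order_tendstoD(2)[OF tail] by (auto simp: eventually_sequentially)
      then show "\<exists>g. bounded_measurable g \<and> approximable g \<and>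
          (\<integral>\<theta>. (cmod (mask (symbol_set ?V) (trig w) \<theta> - g \<theta>))\<^sup>2 \<partial>torus) < e"
        by (intro exI[of _ "mask (symbol_set (U n)) (trig w)"])
           (auto simp: diff appr intro!: bounded_measurable_mask bounded_measurable_trig symbol_set_measurable U)
    qed
  qed
qed

text \<open>
  The Fourier multiplier by the indicator of \<open>Z\<close>, written in coordinates as the pairing with the
  Fourier coefficients of the truncated characters. In this form it makes sense for every
  square-summable sequence.
\<close>
definition torus_proj :: "('d::finite \<Rightarrow> real) set \<Rightarrow> (int ^ 'd) ell2 \<Rightarrow> (int ^ 'd) ell2" where
  "torus_proj Z u = Abs_ell2 (\<lambda>n. cinner (fourier_coeffs (mask Z (character n))) u)"

lemma fourier_coeffs_mask:
  assumes Z: "Z \<in> sets torus" and w: "compactly_supported w"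
  shows "(\<Sum>n | coord w n \<noteq> 0. coord w n *\<^sub>C fourier_coeffs (mask Z (character n))) = fourier_coeffs (mask Z (trig w))"
proof (rule ell2_eqI)
  fix m
  have bm: "bounded_measurable (mask Z (character n))" for n
    by (intro bounded_measurable_mask Z bounded_measurable_character)
  have "mask Z (trig w) = (\<lambda>\<theta>. \<Sum>n | coord w n \<noteq> 0. coord w n * mask Z (character n) \<theta>)"
    by (auto simp: mask_def trig_def sum_distrib_left mult_ac)
  then have "fourier (mask Z (trig w)) m = (\<Sum>n | coord w n \<noteq> 0. coord w n * fourier (mask Z (character n)) m)"
    by (simp add: fourier_sum fourier_cmult bm bounded_measurable_mult bounded_measurable_const)
  then show "coord (\<Sum>n | coord w n \<noteq> 0. coord w n *\<^sub>C fourier_coeffs (mask Z (character n))) m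
      = coord (fourier_coeffs (mask Z (trig w))) m"
    by (simp add: coord_fourier_coeffs bm bounded_measurable_mask Z bounded_measurable_trig)
qed

lemma norm_fourier_coeffs_mask_le:
  assumes Z: "Z \<in> sets torus" and w: "compactly_supported w"
  shows "norm (fourier_coeffs (mask Z (trig w))) \<le> norm w"
proof -
  have "(norm (fourier_coeffs (mask Z (trig w))))\<^sup>2 \<le> (\<integral>\<theta>. (cmod (mask Z (trig w) \<theta>))\<^sup>2 \<partial>torus)"
    by (intro bessel bounded_measurable_mask bounded_measurable_trig Z)
  also have "\<dots> \<le> (norm w)\<^sup>2"
    using integral_norm_sq_mask_le[OF Z bounded_measurable_trig[of w]]
    by (simp add: integral_norm_sq_trig[OF w])
  finally show ?thesis by (rule power2_le_imp_le) simp
qed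

text \<open>The bound is dual to \<open>norm_fourier_coeffs_mask_le\<close>: test with the truncations of the image.\<close>
lemma torus_proj:
  assumes Z: "Z \<in> sets torus"
  shows coord_torus_proj: "coord (torus_proj Z u) n = cinner (fourier_coeffs (mask Z (character n))) u"
    and norm_torus_proj_le: "norm (torus_proj Z u) \<le> norm u"
proof -
  define y where "y n = cinner (fourier_coeffs (mask Z (character n))) u" for n
  have "(\<Sum>n\<in>F. (cmod (y n))\<^sup>2) \<le> (norm u)\<^sup>2" if F: "finite F" for F
  proof -
    define w where "w = (\<Sum>n\<in>F. y n *\<^sub>C delta n)"
    have w: "coord w n = (if n \<in> F then y n else 0)" for n
      unfolding w_def using F by (simp add: if_distrib[of "\<lambda>x. _ * x"] cong: if_cong)
    have cs: "compactly_supported w"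
      by (rule compactly_supported_intro[OF F]) (simp add: w)
    have nz: "{n. coord w n \<noteq> 0} \<subseteq> F" by (auto simp: w)
    have nw: "(norm w)\<^sup>2 = (\<Sum>n\<in>F. (cmod (y n))\<^sup>2)"
      unfolding norm_sq_compactly_supported[OF cs]
      using F nz by (subst sum.mono_neutral_left[of F]) (auto simp: w)
    have "complex_of_real ((norm w)\<^sup>2) = (\<Sum>n\<in>F. cnj (y n) * y n)"
      unfolding nw of_real_sum norm_sq_eq_cnj_mult ..
    also have "\<dots> = (\<Sum>n | coord w n \<noteq> 0. cnj (coord w n) * y n)"
      using F nz by (subst sum.mono_neutral_left[of F]) (auto simp: w)
    also have "\<dots> = cinner (fourier_coeffs (mask Z (trig w))) u"
      by (simp add: fourier_coeffs_mask[OF Z cs, symmetric] cinner_sum_left cinner_cscale_left y_def)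
    finally have "(norm w)\<^sup>2 = cmod (cinner (fourier_coeffs (mask Z (trig w))) u)"
      by (metis abs_power2 norm_of_real)
    also have "\<dots> \<le> norm w * norm u"
      using cmod_cinner_le norm_fourier_coeffs_mask_le[OF Z cs] mult_right_mono norm_ge_zero order_trans
      by metis
    finally have "norm w * norm w \<le> norm w * norm u" by (simp add: power2_eq_square)
    then have "norm w \<le> norm u"
      by (cases "norm w = 0") (auto simp: mult_le_cancel_left)
    then show ?thesis unfolding nw[symmetric] by (intro power_mono) auto
  qed
  then have *: "0 \<le> norm u" "\<And>F. finite F \<Longrightarrow> (\<Sum>n\<in>F. (cmod (y n))\<^sup>2) \<le> (norm u)\<^sup>2" by auto
  show "coord (torus_proj Z u) n = cinner (fourier_coeffs (mask Z (character n))) u"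
    unfolding torus_proj_def using coord_Abs_ell2[OF norm_le_of_finite(1)[OF *]] by (simp add: y_def)
  show "norm (torus_proj Z u) \<le> norm u"
    unfolding torus_proj_def using norm_le_of_finite(2)[OF *] by (simp add: y_def)
qed

lemma bounded_op_torus_proj:
  assumes Z: "Z \<in> sets torus"
  shows "bounded_op (torus_proj Z)"
  unfolding bounded_op_def
proof (intro conjI allI)
  show "bounded_linear (torus_proj Z)"
    by (rule bounded_linear_intro[where K=1])
       (auto intro!: ell2_eqI simp: coord_torus_proj[OF Z] norm_torus_proj_le[OF Z]
         cinner_add_right cinner_scaleR_right scaleR_conv_of_real)
  show "torus_proj Z (c *\<^sub>C u) = c *\<^sub>C torus_proj Z u" for c u
    by (rule ell2_eqI) (simp add: coord_torus_proj[OF Z] cinner_cscale_right)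
qed

lemma torus_proj_compactly_supported:
  assumes Z: "Z \<in> sets torus" and w: "compactly_supported w"
  shows "torus_proj Z w = fourier_coeffs (mask Z (trig w))"
proof (rule ell2_eqI)
  fix n
  have bm: "bounded_measurable (mask Z (character n))"
    by (intro bounded_measurable_mask Z bounded_measurable_character)
  have "coord (torus_proj Z w) n = cnj (cinner w (fourier_coeffs (mask Z (character n))))"
    unfolding coord_torus_proj[OF Z] by (rule cinner_commute)
  also have "\<dots> = (\<integral>\<theta>. cnj (cnj (trig w \<theta>) * mask Z (character n) \<theta>) \<partial>torus)"
    unfolding Bochner_Integration.integral_cnj integral_trig_fourier_coeffs[OF bm w] ..
  also have "\<dots> = fourier (mask Z (trig w)) n"
    unfolding fourier_def by (simp add: mask_def mult_ac)
  finally show "coord (torus_proj Z w) n = coord (fourier_coeffs (mask Z (trig w))) n"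
    by (simp add: coord_fourier_coeffs bounded_measurable_mask Z bounded_measurable_trig)
qed

lemma torus_proj_adjoint:
  assumes Z: "Z \<in> sets torus"
  shows "cinner (torus_proj Z u) v = cinner u (torus_proj Z v)"
proof (rule ell2_density_induct[where Q="\<lambda>u. cinner (torus_proj Z u) v = cinner u (torus_proj Z v)"])
  show "closed {u. cinner (torus_proj Z u) v = cinner u (torus_proj Z v)}"
    by (intro closed_Collect_eq continuous_intros bounded_op_continuous_on bounded_op_torus_proj[OF Z])
  fix w :: "(int ^ 'a) ell2" assume w: "compactly_supported w"
  have "cinner w (torus_proj Z v) = (\<Sum>n | coord w n \<noteq> 0. cnj (coord w n) * cinner (fourier_coeffs (mask Z (character n))) v)"
    by (simp add: cinner_compactly_supported[OF w] coord_torus_proj[OF Z])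
  also have "\<dots> = cinner (fourier_coeffs (mask Z (trig w))) v"
    by (simp add: fourier_coeffs_mask[OF Z w, symmetric] cinner_sum_left cinner_cscale_left)
  finally show "cinner (torus_proj Z w) v = cinner w (torus_proj Z v)"
    by (simp add: torus_proj_compactly_supported[OF Z w])
qed

lemma torus_proj_Un:
  assumes "Z \<in> sets torus" "Z' \<in> sets torus" "Z \<inter> Z' = {}"
  shows "torus_proj (Z \<union> Z') u = torus_proj Z u + torus_proj Z' u"
proof (rule ell2_eqI)
  fix n
  have "mask (Z \<union> Z') (character n) = (\<lambda>\<theta>. mask Z (character n) \<theta> + mask Z' (character n) \<theta>)"
    using assms(3) by (intro ext) (auto simp: mask_def split: split_indicator)
  then have "fourier_coeffs (mask (Z \<union> Z') (character n)) = fourier_coeffs (mask Z (character n)) + fourier_coeffs (mask Z' (character n))"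
    using assms by (simp add: fourier_coeffs_add bounded_measurable_mask bounded_measurable_character)
  then show "coord (torus_proj (Z \<union> Z') u) n = coord (torus_proj Z u + torus_proj Z' u) n"
    using assms by (simp add: coord_torus_proj cinner_add_left)
qed

lemma torus_proj_empty: "torus_proj {} u = 0"
  using torus_proj_Un[of "{}" "{}" u] by simp

lemma torus_proj_UNIV: "torus_proj UNIV u = u"
proof (rule ell2_density_induct[where Q="\<lambda>u. torus_proj UNIV u = u"])
  have Z: "(UNIV :: ('a \<Rightarrow> real) set) \<in> sets torus" using sets.top[of torus] by simp
  show "closed {u :: (int ^ 'a) ell2. torus_proj UNIV u = u}"
    by (intro closed_Collect_eq continuous_intros bounded_op_continuous_on bounded_op_torus_proj[OF Z])
  show "torus_proj UNIV w = w" if "compactly_supported w" for w :: "(int ^ 'a) ell2"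
    using torus_proj_compactly_supported[OF Z that] fourier_coeffs_trig[OF that]
    by (simp add: mask_def[abs_def])
qed

text \<open>
  Dominated convergence settles trigonometric polynomials; the multipliers are contractions, so the
  conclusion passes to the closure.
\<close>
lemma torus_proj_tail:
  fixes Z :: "nat \<Rightarrow> ('d::finite \<Rightarrow> real) set"
  assumes Z: "\<And>k. Z k \<in> sets torus" and tail: "\<And>\<theta>. eventually (\<lambda>k. \<theta> \<notin> Z k) sequentially"
  shows "(\<lambda>k. torus_proj (Z k) u) \<longlonglongrightarrow> 0"
proof (rule tendstoI)
  fix e :: real assume e: "0 < e"
  have "u \<in> closure {u. compactly_supported u}" by (simp add: compactly_supported_dense)
  then obtain w where w: "compactly_supported w" "dist w u < e / 2"
    unfolding closure_approachable using e by (metis half_gt_zero mem_Collect_eq)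
  have "(norm (torus_proj (Z k) w))\<^sup>2 \<le> (\<integral>\<theta>. (cmod (mask (Z k) (trig w) \<theta>))\<^sup>2 \<partial>torus)" for k
    unfolding torus_proj_compactly_supported[OF Z w(1)]
    by (intro bessel bounded_measurable_mask bounded_measurable_trig Z)
  moreover have "eventually (\<lambda>k. (\<integral>\<theta>. (cmod (mask (Z k) (trig w) \<theta>))\<^sup>2 \<partial>torus) < (e / 2)\<^sup>2) sequentially"
    using e by (intro order_tendstoD(2)[OF integral_mask_tail[OF Z bounded_measurable_trig tail]]) simp
  ultimately have "eventually (\<lambda>k. (norm (torus_proj (Z k) w))\<^sup>2 < (e / 2)\<^sup>2) sequentially"
    by (auto elim!: eventually_mono intro: order_le_less_trans)
  then show "eventually (\<lambda>k. dist (torus_proj (Z k) u) 0 < e) sequentially"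
  proof eventually_elim
    case (elim k)
    then have "norm (torus_proj (Z k) w) < e / 2"
      using e by (intro power2_less_imp_less[OF elim]) simp
    moreover have "norm (torus_proj (Z k) (u - w)) < e / 2"
      using norm_torus_proj_le[OF Z, of k "u - w"] w(2) by (simp add: dist_norm norm_minus_commute)
    moreover have "torus_proj (Z k) u = torus_proj (Z k) w + torus_proj (Z k) (u - w)"
      using bounded_opD(2)[OF bounded_op_torus_proj[OF Z]] by (simp add: linear_diff)
    ultimately show ?case using norm_triangle_ineq[of "torus_proj (Z k) w" "torus_proj (Z k) (u - w)"] by simp
  qed
qed

lemma torus_proj_sums:
  fixes Z :: "nat \<Rightarrow> ('d::finite \<Rightarrow> real) set"
  assumes Z: "\<And>k. Z k \<in> sets torus" and disj: "disjoint_family Z"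
  shows "(\<lambda>k. torus_proj (Z k) u) sums torus_proj (\<Union>k. Z k) u"
proof -
  define U where "U n = (\<Union>k<n. Z k)" for n
  have U: "U n \<in> sets torus" for n unfolding U_def using Z by auto
  have V: "(\<Union>k. Z k) \<in> sets torus" using Z by auto
  have partial: "(\<Sum>k<n. torus_proj (Z k) u) = torus_proj (U n) u" for n
  proof (induction n)
    case (Suc n)
    have "Z n \<inter> Z k = {}" if "k < n" for k
      using disj that by (auto simp: disjoint_family_on_def)
    then have "U n \<inter> Z n = {}" unfolding U_def by blast
    moreover have "U (Suc n) = U n \<union> Z n" by (auto simp: U_def lessThan_Suc)
    ultimately show ?case using torus_proj_Un[OF U Z] Suc by simp
  qed (simp add: U_def torus_proj_empty)
  have "(\<lambda>n. torus_proj ((\<Union>k. Z k) - U n) u) \<longlonglongrightarrow> 0"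
  proof (rule torus_proj_tail)
    show "(\<Union>k. Z k) - U n \<in> sets torus" for n using U V by auto
    show "eventually (\<lambda>n. \<theta> \<notin> (\<Union>k. Z k) - U n) sequentially" for \<theta>
    proof (cases "\<exists>k. \<theta> \<in> Z k")
      case True
      then obtain k where "\<theta> \<in> Z k" by blast
      then show ?thesis
        unfolding eventually_sequentially U_def by (intro exI[of _ "Suc k"]) (auto simp: Suc_le_eq)
    qed simp
  qed
  then have "(\<lambda>n. torus_proj (\<Union>k. Z k) u - torus_proj ((\<Union>k. Z k) - U n) u) \<longlonglongrightarrow> torus_proj (\<Union>k. Z k) u - 0"
    by (intro tendsto_diff tendsto_const)
  moreover have "torus_proj (\<Union>k. Z k) u - torus_proj ((\<Union>k. Z k) - U n) u = torus_proj (U n) u" for n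
  proof -
    have "U n \<union> ((\<Union>k. Z k) - U n) = (\<Union>k. Z k)" by (auto simp: U_def)
    then show ?thesis using torus_proj_Un[OF U, of "(\<Union>k. Z k) - U n" n u] U V
      by (simp add: sets.Diff)
  qed
  ultimately show ?thesis by (simp add: sums_def partial)
qed

lemma inner_torus_proj:
  assumes Z: "Z \<in> sets torus" and w: "compactly_supported w"
  shows "inner w (torus_proj Z w) = (\<integral>\<theta>. (cmod (mask Z (trig w) \<theta>))\<^sup>2 \<partial>torus)"
proof -
  have bm: "bounded_measurable (mask Z (trig w))"
    by (intro bounded_measurable_mask bounded_measurable_trig Z)
  have "cinner w (torus_proj Z w) = (\<integral>\<theta>. cnj (trig w \<theta>) * mask Z (trig w) \<theta> \<partial>torus)"
    by (simp add: torus_proj_compactly_supported[OF Z w] integral_trig_fourier_coeffs[OF bm w])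
  also have "\<dots> = (\<integral>\<theta>. complex_of_real ((cmod (mask Z (trig w) \<theta>))\<^sup>2) \<partial>torus)"
    unfolding norm_sq_eq_cnj_mult by (intro Bochner_Integration.integral_cong) (auto simp: mask_def split: split_indicator)
  finally show ?thesis by (simp add: Re_cinner[symmetric] del: of_real_power)
qed

text \<open>
  Equality in Bessel's inequality is what makes the multiplier idempotent: it says that
  \<open>\<langle>u, P u\<rangle> = \<langle>u, P (P u)\<rangle>\<close>, and a symmetric operator is determined by its quadratic form.
\<close>
lemma torus_proj_idem:
  fixes Z :: "('d::finite \<Rightarrow> real) set"
  assumes Z: "Z \<in> sets torus"
    and appr: "\<And>w. compactly_supported w \<Longrightarrow> approximable (mask Z (trig w))"
  shows "torus_proj Z (torus_proj Z u) = torus_proj Z u"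
proof -
  let ?P = "torus_proj Z"
  have lin: "linear ?P" using bounded_opD(2)[OF bounded_op_torus_proj[OF Z]] .
  have sym: "inner (?P u) v = inner u (?P v)" for u v
    by (simp add: Re_cinner[symmetric] torus_proj_adjoint[OF Z])
  have form: "inner u (?P u) = inner (?P u) (?P u)" for u
  proof (rule ell2_density_induct[where Q="\<lambda>u. inner u (?P u) = inner (?P u) (?P u)"])
    show "closed {u. inner u (?P u) = inner (?P u) (?P u)}"
      by (intro closed_Collect_eq continuous_intros bounded_op_continuous_on bounded_op_torus_proj[OF Z])
    show "inner w (?P w) = inner (?P w) (?P w)" if w: "compactly_supported w" for w
      unfolding inner_torus_proj[OF Z w] power2_norm_eq_inner[symmetric]
      unfolding torus_proj_compactly_supported[OF Z w]
      by (intro parseval[symmetric] bounded_measurable_mask bounded_measurable_trig Z appr w)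
  qed
  define S where "S u = ?P u - ?P (?P u)" for u
  have S: "inner u (S u) = 0" for u using form[of u] sym[of u "?P u"] by (simp add: S_def inner_diff_right)
  have S_sym: "inner (S u) v = inner u (S v)" for u v by (simp add: S_def inner_diff_left inner_diff_right sym)
  have "inner (u + S u) (S (u + S u)) = 0" by (rule S)
  moreover have "S (u + S u) = S u + S (S u)"
    by (simp add: S_def linear_add[OF lin] linear_diff[OF lin])
  ultimately have "2 * inner (S u) (S u) = 0"
    using S[of u] S[of "S u"] S_sym[of u "S u"] by (simp add: inner_add_left inner_add_right)
  then show ?thesis by (simp add: S_def)
qed

definition laplacian_pvm :: "real set \<Rightarrow> (int ^ 'd::finite) ell2 \<Rightarrow> (int ^ 'd) ell2" where
  "laplacian_pvm B = torus_proj (symbol_set B)"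

lemma pvm_laplacian: "pvm (laplacian_pvm :: real set \<Rightarrow> (int ^ 'd::finite) ell2 \<Rightarrow> (int ^ 'd) ell2)"
proof
  show "orthogonal_projection (laplacian_pvm B :: (int ^ 'd) ell2 \<Rightarrow> (int ^ 'd) ell2)"
    if "B \<in> sets borel" for B
    unfolding orthogonal_projection_def laplacian_pvm_def
    by (auto intro!: bounded_op_torus_proj torus_proj_idem torus_proj_adjoint
        symbol_set_measurable approximable_symbol_set that)
  show "laplacian_pvm UNIV = (id :: (int ^ 'd) ell2 \<Rightarrow> (int ^ 'd) ell2)"
    by (rule ext) (simp add: laplacian_pvm_def symbol_set_def torus_proj_UNIV)
  show "(\<lambda>k. laplacian_pvm (F k) u) sums laplacian_pvm (\<Union>k. F k) u"
    if "range F \<subseteq> sets borel" "disjoint_family F" for F :: "nat \<Rightarrow> real set" and u :: "(int ^ 'd) ell2"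
  proof -
    have "symbol_set (\<Union>k. F k) = (\<Union>k. symbol_set (F k) :: ('d \<Rightarrow> real) set)"
      by (auto simp: symbol_set_def)
    moreover have "disjoint_family (\<lambda>k. symbol_set (F k) :: ('d \<Rightarrow> real) set)"
      using that(2) by (auto simp: symbol_set_def disjoint_family_on_def)
    ultimately show ?thesis
      unfolding laplacian_pvm_def using that(1)
      by (simp only:) (rule torus_proj_sums, auto intro!: symbol_set_measurable)
  qed
qed


definition cell :: "real \<Rightarrow> int \<Rightarrow> real set" where
  "cell e j = {e * of_int j..<e * of_int (j + 1)}"

definition round_down :: "real \<Rightarrow> nat \<Rightarrow> real \<Rightarrow> real" where
  "round_down e J x = (\<Sum>j\<in>{- int J..int J}. e * of_int j * indicator (cell e j) x)"

lemma cell_borel [measurable, simp]: "cell e j \<in> sets borel"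
  by (simp add: cell_def)

lemma round_down_close:
  assumes e: "0 < e" and x: "\<bar>x\<bar> \<le> r" and J: "r \<le> e * real J"
  shows "\<bar>x - round_down e J x\<bar> \<le> e"
proof -
  define k where "k = \<lfloor>x / e\<rfloor>"
  have mem: "x \<in> cell e j \<longleftrightarrow> j = k" for j
  proof -
    have "x \<in> cell e j \<longleftrightarrow> of_int j \<le> x / e \<and> x / e < of_int j + 1"
      using e by (auto simp: cell_def field_simps)
    also have "\<dots> \<longleftrightarrow> j = k" unfolding k_def by linarith
    finally show ?thesis .
  qed
  have "x / e \<le> real J" "- real J \<le> x / e"
    using x J e by (auto simp: field_simps abs_le_iff)
  then have "k \<in> {- int J..int J}" unfolding k_def by (simp add: floor_le_iff le_floor_iff)
  then have "round_down e J x = e * of_int k"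
    unfolding round_down_def
    by (simp add: indicator_def mem if_distrib[of "\<lambda>y. _ * y"] cong: if_cong)
  moreover have "x \<in> cell e k" by (simp add: mem)
  ultimately show ?thesis by (auto simp: cell_def algebra_simps abs_le_iff)
qed

text \<open>
  On trigonometric polynomials both terms are integrals over the torus, of the symbol and of the
  symbol rounded down to a multiple of \<open>e\<close>.
\<close>
lemma laplacian_step_approximation:
  fixes u :: "(int ^ 'd::finite) ell2"
  assumes e: "0 < e" and J: "real CARD('d) \<le> e * real J"
  shows "\<bar>inner u (laplacian u) - (\<Sum>j\<in>{- int J..int J}. e * of_int j * inner u (laplacian_pvm (cell e j) u))\<bar>
    \<le> e * (norm u)\<^sup>2"
proof (rule ell2_density_induct[where Q="\<lambda>u. \<bar>inner u (laplacian u) -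
    (\<Sum>j\<in>{- int J..int J}. e * of_int j * inner u (laplacian_pvm (cell e j) u))\<bar> \<le> e * (norm u)\<^sup>2"])
  show "closed {u :: (int ^ 'd) ell2. \<bar>inner u (laplacian u) -
    (\<Sum>j\<in>{- int J..int J}. e * of_int j * inner u (laplacian_pvm (cell e j) u))\<bar> \<le> e * (norm u)\<^sup>2}"
    unfolding laplacian_pvm_def
    by (intro closed_Collect_le continuous_intros bounded_op_continuous_on bounded_op_laplacian
        bounded_op_torus_proj symbol_set_measurable cell_borel)
  fix w :: "(int ^ 'd) ell2" assume w: "compactly_supported w"
  have int: "integrable torus (\<lambda>\<theta>. (cmod (trig w \<theta>))\<^sup>2)"
    by (rule integrable_norm_sq[OF bounded_measurable_trig])
  have 1: "inner w (laplacian w) = (\<integral>\<theta>. laplacian_symbol \<theta> * (cmod (trig w \<theta>))\<^sup>2 \<partial>torus)"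
  proof -
    have "cinner w (laplacian w) = (\<integral>\<theta>. cnj (trig w \<theta>) * trig (laplacian w) \<theta> \<partial>torus)"
      by (rule integral_trig_trig[symmetric]) (simp_all add: w compactly_supported_laplacian)
    also have "\<dots> = (\<integral>\<theta>. complex_of_real (laplacian_symbol \<theta> * (cmod (trig w \<theta>))\<^sup>2) \<partial>torus)"
      unfolding of_real_mult norm_sq_eq_cnj_mult by (simp add: trig_laplacian[OF w] mult_ac)
    finally show ?thesis by (simp add: Re_cinner[symmetric] del: of_real_power of_real_mult)
  qed
  have ind: "(cmod (mask (symbol_set (cell e j)) (trig w) \<theta>))\<^sup>2 = indicator (cell e j) (laplacian_symbol \<theta>) * (cmod (trig w \<theta>))\<^sup>2" for j \<theta>
    by (simp add: mask_def symbol_set_def indicator_def)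
  have int_ind: "integrable torus (\<lambda>\<theta>. indicator (cell e j) (laplacian_symbol \<theta>) * (cmod (trig w \<theta>))\<^sup>2)" for j
    unfolding ind[symmetric]
    by (intro integrable_norm_sq bounded_measurable_mask bounded_measurable_trig symbol_set_measurable cell_borel)
  have 2: "(\<Sum>j\<in>{- int J..int J}. e * of_int j * inner w (laplacian_pvm (cell e j) w)) =
      (\<integral>\<theta>. round_down e J (laplacian_symbol \<theta>) * (cmod (trig w \<theta>))\<^sup>2 \<partial>torus)"
    unfolding laplacian_pvm_def inner_torus_proj[OF symbol_set_measurable[OF cell_borel] w] ind round_down_def
      sum_distrib_right mult.assoc
    using int_ind by simp
  have int_s: "integrable torus (\<lambda>\<theta>. round_down e J (laplacian_symbol \<theta>) * (cmod (trig w \<theta>))\<^sup>2)"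
    unfolding round_down_def sum_distrib_right mult.assoc using int_ind by simp
  have int_h: "integrable torus (\<lambda>\<theta>. laplacian_symbol \<theta> * (cmod (trig w \<theta>))\<^sup>2)"
  proof (rule Bochner_Integration.integrable_bound[OF integrable_mult_right[OF int, of "real CARD('d)"]])
    show "AE \<theta> in torus. norm (laplacian_symbol \<theta> * (cmod (trig w \<theta>))\<^sup>2) \<le> norm (real CARD('d) * (cmod (trig w \<theta>))\<^sup>2)"
      by (intro AE_I2) (auto simp: abs_mult intro!: mult_right_mono laplacian_symbol_bound)
  qed (use borel_measurable_integrable[OF int] in measurable)
  have "\<bar>inner w (laplacian w) - (\<Sum>j\<in>{- int J..int J}. e * of_int j * inner w (laplacian_pvm (cell e j) w))\<bar>
      = \<bar>\<integral>\<theta>. laplacian_symbol \<theta> * (cmod (trig w \<theta>))\<^sup>2 - round_down e J (laplacian_symbol \<theta>) * (cmod (trig w \<theta>))\<^sup>2 \<partial>torus\<bar>"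
    unfolding 1 2 using int_h int_s by simp
  also have "\<dots> \<le> (\<integral>\<theta>. \<bar>laplacian_symbol \<theta> * (cmod (trig w \<theta>))\<^sup>2 - round_down e J (laplacian_symbol \<theta>) * (cmod (trig w \<theta>))\<^sup>2\<bar> \<partial>torus)"
    using integral_norm_bound[of torus "\<lambda>\<theta>. laplacian_symbol \<theta> * (cmod (trig w \<theta>))\<^sup>2 - round_down e J (laplacian_symbol \<theta>) * (cmod (trig w \<theta>))\<^sup>2"]
    by simp
  also have "\<dots> \<le> (\<integral>\<theta>. e * (cmod (trig w \<theta>))\<^sup>2 \<partial>torus)"
  proof (rule integral_mono)
    fix \<theta> :: "'d \<Rightarrow> real"
    have "\<bar>laplacian_symbol \<theta> * (cmod (trig w \<theta>))\<^sup>2 - round_down e J (laplacian_symbol \<theta>) * (cmod (trig w \<theta>))\<^sup>2\<bar>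
        = \<bar>laplacian_symbol \<theta> - round_down e J (laplacian_symbol \<theta>)\<bar> * (cmod (trig w \<theta>))\<^sup>2"
      by (simp add: left_diff_distrib[symmetric] abs_mult)
    also have "\<dots> \<le> e * (cmod (trig w \<theta>))\<^sup>2"
      by (intro mult_right_mono round_down_close[OF e laplacian_symbol_bound J]) simp
    finally show "\<bar>laplacian_symbol \<theta> * (cmod (trig w \<theta>))\<^sup>2 - round_down e J (laplacian_symbol \<theta>) * (cmod (trig w \<theta>))\<^sup>2\<bar>
        \<le> e * (cmod (trig w \<theta>))\<^sup>2" .
  qed (use int int_h int_s in auto)
  also have "\<dots> = e * (norm w)\<^sup>2" by (simp add: integral_norm_sq_trig[OF w])
  finally show "\<bar>inner w (laplacian w) - (\<Sum>j\<in>{- int J..int J}. e * of_int j * inner w (laplacian_pvm (cell e j) w))\<bar>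
      \<le> e * (norm w)\<^sup>2" .
qed

lemma AE_laplacian_pvm_measure:
  fixes u :: "(int ^ 'd::finite) ell2"
  shows "AE x in pvm_measure laplacian_pvm u. \<bar>x\<bar> \<le> real CARD('d)"
proof -
  interpret pvm "laplacian_pvm :: real set \<Rightarrow> (int ^ 'd) ell2 \<Rightarrow> (int ^ 'd) ell2" by (rule pvm_laplacian)
  let ?N = "- {- real CARD('d)..real CARD('d)}"
  have "symbol_set ?N = ({} :: ('d \<Rightarrow> real) set)"
  proof (rule equals0I)
    fix \<theta> :: "'d \<Rightarrow> real" assume "\<theta> \<in> symbol_set ?N"
    then show False using laplacian_symbol_bound[of \<theta>] by (auto simp: symbol_set_def abs_le_iff)
  qed
  then have "laplacian_pvm ?N u = 0" by (simp add: laplacian_pvm_def torus_proj_empty)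
  then have "emeasure (pvm_measure laplacian_pvm u) ?N = 0"
    by (subst emeasure_pvm_measure) auto
  then show ?thesis
    by (intro AE_I[of _ _ ?N]) (auto simp: abs_le_iff)
qed

text \<open>
  Additivity is inherited from the multipliers. For the first moment, both \<open>\<langle>u, \<Delta> u\<rangle>\<close> and the integral
  are within \<open>e \<parallel>u\<parallel>\<^sup>2\<close> of the same finite sum over cells of length \<open>e\<close>.
\<close>
theorem is_spectral_measure_laplacian:
  "is_spectral_measure laplacian (laplacian_pvm :: real set \<Rightarrow> (int ^ 'd::finite) ell2 \<Rightarrow> (int ^ 'd) ell2)"
  unfolding is_spectral_measure_iff
proof (intro conjI allI)
  show pvm: "pvm (laplacian_pvm :: real set \<Rightarrow> (int ^ 'd) ell2 \<Rightarrow> (int ^ 'd) ell2)" by (rule pvm_laplacian)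
  fix u :: "(int ^ 'd) ell2"
  interpret pvm "laplacian_pvm :: real set \<Rightarrow> (int ^ 'd) ell2 \<Rightarrow> (int ^ 'd) ell2" by (rule pvm)
  let ?\<mu> = "pvm_measure laplacian_pvm u"
  interpret finite_measure ?\<mu> by (rule finite_measure_pvm)
  show int: "integrable ?\<mu> (\<lambda>x. x)"
    using AE_laplacian_pvm_measure[of u] by (intro integrable_const_bound[where B="real CARD('d)"]) auto
  have mass: "measure ?\<mu> UNIV = (norm u)\<^sup>2"
    by (simp add: measure_pvm_measure P_UNIV)
  have "\<bar>inner u (laplacian u) - (\<integral>x. x \<partial>?\<mu>)\<bar> \<le> 0 + d" if d: "0 < d" for d
  proof -
    define N where "N = (norm u)\<^sup>2 + 1"
    define e where "e = d / (2 * N)"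
    have N: "0 < N" by (simp add: N_def add_nonneg_pos)
    have e: "0 < e" using d N by (simp add: e_def)
    obtain J :: nat where "real CARD('d) / e \<le> real J" using real_arch_simple by blast
    then have J: "real CARD('d) \<le> e * real J" using e by (simp add: field_simps)
    let ?s = "round_down e J"
    have int_s: "integrable ?\<mu> ?s"
      unfolding round_down_def[abs_def]
      by (intro Bochner_Integration.integrable_sum integrable_mult_right integrable_real_indicator)
         (auto simp: emeasure_pvm_measure)
    have "(\<integral>x. ?s x \<partial>?\<mu>) = (\<Sum>j\<in>{- int J..int J}. e * of_int j * measure ?\<mu> (cell e j))"
      unfolding round_down_def
      by (subst Bochner_Integration.integral_sum)
         (auto intro!: integrable_mult_right integrable_real_indicator simp: emeasure_pvm_measure)
    also have "\<dots> = (\<Sum>j\<in>{- int J..int J}. e * of_int j * inner u (laplacian_pvm (cell e j) u))"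
      by (simp add: measure_pvm_measure norm_sq_P)
    finally have 1: "\<bar>inner u (laplacian u) - (\<integral>x. ?s x \<partial>?\<mu>)\<bar> \<le> e * (norm u)\<^sup>2"
      using laplacian_step_approximation[OF e J, of u] by simp
    have "\<bar>(\<integral>x. ?s x \<partial>?\<mu>) - (\<integral>x. x \<partial>?\<mu>)\<bar> = \<bar>\<integral>x. ?s x - x \<partial>?\<mu>\<bar>"
      using int int_s by simp
    also have "\<dots> \<le> (\<integral>x. \<bar>?s x - x\<bar> \<partial>?\<mu>)"
      using integral_norm_bound[of ?\<mu> "\<lambda>x. ?s x - x"] by simp
    also have "\<dots> \<le> (\<integral>x. e \<partial>?\<mu>)"
    proof (rule integral_mono_AE)
      show "AE x in ?\<mu>. \<bar>?s x - x\<bar> \<le> e"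
        using AE_laplacian_pvm_measure[of u]
        by eventually_elim (subst abs_minus_commute, rule round_down_close[OF e _ J])
    qed (use int int_s in auto)
    also have "\<dots> = e * (norm u)\<^sup>2" by (simp add: mass mult.commute)
    finally have "\<bar>inner u (laplacian u) - (\<integral>x. x \<partial>?\<mu>)\<bar> \<le> 2 * (e * (norm u)\<^sup>2)"
      using 1 by linarith
    also have "\<dots> \<le> 2 * (e * N)" using e by (simp add: N_def)
    also have "\<dots> = 0 + d" using N by (simp add: e_def)
    finally show ?thesis .
  qed
  then have "\<bar>inner u (laplacian u) - (\<integral>x. x \<partial>?\<mu>)\<bar> \<le> 0" by (rule field_le_epsilon)
  then have "inner u (laplacian u) = (\<integral>x. x \<partial>?\<mu>)" by simp
  moreover have "cnj (cinner u (laplacian u)) = cinner u (laplacian u)"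
    using laplacian_symmetric[of u u] cinner_commute[of u "laplacian u"] by simp
  then have "Im (cinner u (laplacian u)) = 0" by (simp add: complex_eq_iff)
  ultimately show "cinner u (laplacian u) = complex_of_real (\<integral>x. x \<partial>?\<mu>)"
    by (simp add: complex_eq_iff Re_cinner)
qed

section \<open>The commutator\<close>

text \<open>
  In Fourier variables the terms for \<open>m\<close> and \<open>-m\<close> add up to \<open>r m sin (m \<theta>\<^sub>i) sin \<theta>\<^sub>i\<close>.
\<close>
definition dil_commutator ::
    "int set \<Rightarrow> (int \<Rightarrow> real) \<Rightarrow> (int ^ 'd::finite) ell2 \<Rightarrow> (int ^ 'd) ell2" where
  "dil_commutator M r u =
     (\<Sum>i\<in>UNIV. \<Sum>m\<in>M. (r m / 4) *\<^sub>R (shift i (m - 1) u - shift i (m + 1) u))"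

lemma bounded_op_dil_commutator: "bounded_op (dil_commutator M r)"
  unfolding dil_commutator_def[abs_def]
  by (intro bounded_op_sum bounded_op_scaleR bounded_op_diff bounded_op_shift)

lemma coord_laplacian:
  "coord (laplacian u) n = (\<Sum>k\<in>UNIV. (coord u (n - axis k 1) + coord u (n + axis k 1)) / 2)"
proof -
  have "axis k (- 1) = (- axis k 1 :: int ^ 'a)" for k
    by (simp add: vec_eq_iff axis_def)
  then show ?thesis
    by (simp add: laplacian_def shift.rep_eq shift_seq_def scaleR_conv_of_real)
qed

text \<open>
  Only the position dependence of the coefficients contributes: moving by one step in direction
  \<open>k\<close> changes the coefficient of a step in direction \<open>i\<close> only if \<open>k = i\<close>.
\<close>
lemma dil_commutator_coord:
  fixes f :: "int ^ 'd::finite \<Rightarrow> complex"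
  shows "(\<Sum>k\<in>UNIV. (dil_seq UNIV M r f (n - axis k 1) + dil_seq UNIV M r f (n + axis k 1)) / 2)
    - dil_seq UNIV M r (\<lambda>n. \<Sum>k\<in>UNIV. (f (n - axis k 1) + f (n + axis k 1)) / 2) n
    = - \<i> * (\<Sum>i\<in>UNIV. \<Sum>m\<in>M. of_real (r m / 4) * (f (n - axis i (m - 1)) - f (n - axis i (m + 1))))"
proof -
  let ?t = "\<lambda>i m k. dil_coeff r (i, m) (n - axis k 1) * f (n - axis k 1 - axis i m) / 2
      + dil_coeff r (i, m) (n + axis k 1) * f (n + axis k 1 - axis i m) / 2
      - dil_coeff r (i, m) n * ((f (n - axis i m - axis k 1) + f (n - axis i m + axis k 1)) / 2)"
  have t: "?t i m k = (if k = i then - \<i> * (of_real (r m / 4) * (f (n - axis i (m - 1)) - f (n - axis i (m + 1)))) else 0)"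
    for i k :: 'd and m
  proof -
    have c: "n - axis k 1 - axis i m = n - axis i m - axis k 1" "n + axis k 1 - axis i m = n - axis i m + axis k 1"
      by (simp_all add: algebra_simps)
    show ?thesis
    proof (cases "k = i")
      case True
      let ?d = "\<lambda>x. - \<i> * of_real (r m * (2 * x - of_int m) / 4)"
      have s: "n - axis i m - axis i 1 = n - axis i (m + 1)" "n - axis i m + axis i 1 = n - axis i (m - 1)"
        by (simp_all add: vec_eq_iff axis_def)
      have d: "dil_coeff r (i, m) (n - axis i 1) = ?d (of_int (n $ i) - 1)"
        "dil_coeff r (i, m) (n + axis i 1) = ?d (of_int (n $ i) + 1)"
        "dil_coeff r (i, m) n = ?d (of_int (n $ i))"
        by (simp_all add: dil_coeff_def)
      have "?d (x - 1) * p / 2 + ?d (x + 1) * q / 2 - ?d x * ((p + q) / 2)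
          = - \<i> * (of_real (r m / 4) * (q - p))" for x p q
        by (simp add: field_simps)
      then show ?thesis
        unfolding c by (simp only: True refl if_True s d)
    next
      case False
      have "axis k 1 $ i = (0::int)" using False by (simp add: axis_def)
      then have "dil_coeff r (i, m) (n - axis k 1) = dil_coeff r (i, m) n"
        "dil_coeff r (i, m) (n + axis k 1) = dil_coeff r (i, m) n"
        by (simp_all add: dil_coeff_def)
      then show ?thesis unfolding c using False by (simp add: algebra_simps)
    qed
  qed
  have "(\<Sum>k\<in>UNIV. (dil_seq UNIV M r f (n - axis k 1) + dil_seq UNIV M r f (n + axis k 1)) / 2)
      = (\<Sum>k\<in>UNIV. \<Sum>i\<in>UNIV. \<Sum>m\<in>M. dil_coeff r (i, m) (n - axis k 1) * f (n - axis k 1 - axis i m) / 2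
      + dil_coeff r (i, m) (n + axis k 1) * f (n + axis k 1 - axis i m) / 2)"
    by (simp add: dil_seq_def sum.distrib sum_divide_distrib add_divide_distrib)
  also have "\<dots> = (\<Sum>i\<in>UNIV. \<Sum>m\<in>M. \<Sum>k\<in>UNIV. dil_coeff r (i, m) (n - axis k 1) * f (n - axis k 1 - axis i m) / 2
      + dil_coeff r (i, m) (n + axis k 1) * f (n + axis k 1 - axis i m) / 2)"
    by (subst sum.swap) (intro sum.cong refl sum.swap)
  finally have "(\<Sum>k\<in>UNIV. (dil_seq UNIV M r f (n - axis k 1) + dil_seq UNIV M r f (n + axis k 1)) / 2)
      - dil_seq UNIV M r (\<lambda>n. \<Sum>k\<in>UNIV. (f (n - axis k 1) + f (n + axis k 1)) / 2) n
      = (\<Sum>i\<in>UNIV. \<Sum>m\<in>M. \<Sum>k\<in>UNIV. ?t i m k)"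
    unfolding dil_seq_def[of UNIV M r "\<lambda>n. \<Sum>k\<in>UNIV. (f (n - axis k 1) + f (n + axis k 1)) / 2"]
    by (simp only: sum_distrib_left sum_subtractf)
  also have "\<dots> = - \<i> * (\<Sum>i\<in>UNIV. \<Sum>m\<in>M. of_real (r m / 4) * (f (n - axis i (m - 1)) - f (n - axis i (m + 1))))"
    unfolding t by (simp add: sum_distrib_left sum_negf)
  finally show ?thesis .
qed

theorem is_commutator_ext_9_14:
  "is_commutator_ext laplacian (conj_op 2 rho_9_14) (dil_commutator M_9_14 r_9_14)"
  unfolding is_commutator_ext_def
proof (intro conjI allI impI)
  show "bounded_op (dil_commutator M_9_14 r_9_14)" by (rule bounded_op_dil_commutator)
  fix u :: "(int ^ 'a) ell2" assume cs: "compactly_supported u"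
  have cs': "compactly_supported (laplacian u)" by (rule compactly_supported_laplacian[OF cs])
  obtain v where v: "\<forall>n. coord v n = dil_seq UNIV M_9_14 r_9_14 (coord u) n"
    using dil_graphs(2)[OF r_9_14_odd cs] by blast
  obtain w where w: "\<forall>n. coord w n = dil_seq UNIV M_9_14 r_9_14 (coord (laplacian u)) n"
    using dil_graphs(2)[OF r_9_14_odd cs'] by blast
  have "dil_commutator M_9_14 r_9_14 u = \<i> *\<^sub>C (laplacian v - w)"
  proof (rule ell2_eqI)
    fix n
    have "coord (laplacian v - w) n = - \<i> * coord (dil_commutator M_9_14 r_9_14 u) n"
      using dil_commutator_coord[of M_9_14 r_9_14 "coord u" n]
      by (simp only: minus_ell2.rep_eq coord_laplacian[abs_def] v w dil_commutator_def coord_sum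
          scaleR_ell2.rep_eq shift.rep_eq shift_seq_def scaleR_conv_of_real)
    then show "coord (dil_commutator M_9_14 r_9_14 u) n = coord (\<i> *\<^sub>C (laplacian v - w)) n"
      by simp
  qed
  moreover have "laplacian (\<i> *\<^sub>C v) - \<i> *\<^sub>C w = \<i> *\<^sub>C (laplacian v - w)"
    unfolding bounded_opD(3)[OF bounded_op_laplacian] by (rule ell2_eqI) (simp add: right_diff_distrib)
  ultimately show "\<exists>v w. (u, v) \<in> conj_op 2 rho_9_14 \<and> (laplacian u, w) \<in> conj_op 2 rho_9_14 \<and>
      dil_commutator M_9_14 r_9_14 u = laplacian (\<i> *\<^sub>C v) - \<i> *\<^sub>C w"
    using conj_op_9_14_mem[OF cs v] conj_op_9_14_mem[OF cs' w] by metis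
qed

text \<open>
  This is \<open>(1 - x\<^sup>2) (U\<^sub>1 x + (9/14) U\<^sub>3 x)\<close> with the Chebyshev polynomials of the second kind, and it
  factors as \<open>(4/7) x (1 - x\<^sup>2) (9 x\<^sup>2 - 1)\<close>.
\<close>
definition commutator_symbol :: "real \<Rightarrow> real" where
  "commutator_symbol x = 4 / 7 * (10 * x ^ 3 - 9 * x ^ 5 - x)"

lemma commutator_symbol_cos: "(cos t - cos (3 * t)) / 2 + 9 / 14 * ((cos (3 * t) - cos (5 * t)) / 2) = commutator_symbol (cos t)"
proof -
  have 3: "cos (3 * t) = 4 * cos t ^ 3 - 3 * cos t" by (rule cos_treble_cos)
  have "cos (3 * t) * cos (2 * t) = (cos t + cos (5 * t)) / 2"
    using cos_times_cos[of "3 * t" "2 * t"] by simp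
  then have "cos (5 * t) = 2 * ((4 * cos t ^ 3 - 3 * cos t) * (2 * (cos t)\<^sup>2 - 1)) - cos t"
    unfolding 3 cos_double_cos by simp
  also have "\<dots> = 16 * cos t ^ 5 - 20 * cos t ^ 3 + 5 * cos t"
    by (simp add: power2_eq_square power3_eq_cube eval_nat_numeral algebra_simps)
  finally have "cos (5 * t) = 16 * cos t ^ 5 - 20 * cos t ^ 3 + 5 * cos t" .
  then show ?thesis unfolding 3 commutator_symbol_def by (simp add: field_simps)
qed

lemma trig_dil_commutator:
  assumes w: "compactly_supported (w :: (int ^ 'd::finite) ell2)"
  shows "trig (dil_commutator M_9_14 r_9_14 w) \<theta> = of_real (\<Sum>i\<in>UNIV. commutator_symbol (cos (\<theta> i))) * trig w \<theta>"
proof -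
  have sym: "(\<Sum>m\<in>M_9_14. of_real (r_9_14 m / 4) * (cis (of_int (m - 1) * t) - cis (of_int (m + 1) * t)))
      = of_real (commutator_symbol (cos t))" for t
    unfolding commutator_symbol_cos[symmetric]
    by (simp add: complex_eq_iff r_9_14_def rho_9_14_def field_simps)
  have "trig (dil_commutator M_9_14 r_9_14 w) \<theta> = (\<Sum>i\<in>UNIV. \<Sum>m\<in>M_9_14.
      of_real (r_9_14 m / 4) * ((cis (of_int (m - 1) * \<theta> i) - cis (of_int (m + 1) * \<theta> i)) * trig w \<theta>))"
    unfolding dil_commutator_def
    by (simp only: trig_sum trig_scaleR trig_diff trig_shift w compactly_supported_shift
        compactly_supported_scaleR compactly_supported_diff compactly_supported_sum left_diff_distrib)
  also have "\<dots> = (\<Sum>i\<in>UNIV. (\<Sum>m\<in>M_9_14.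
      of_real (r_9_14 m / 4) * (cis (of_int (m - 1) * \<theta> i) - cis (of_int (m + 1) * \<theta> i))) * trig w \<theta>)"
    by (simp only: sum_distrib_right mult.assoc)
  also have "\<dots> = (\<Sum>i\<in>UNIV. of_real (commutator_symbol (cos (\<theta> i))) * trig w \<theta>)"
    by (simp only: sym)
  finally show ?thesis by (simp add: sum_distrib_right)
qed

lemma cinner_eq_integral_of_symbol:
  assumes w: "compactly_supported w" "compactly_supported v"
    and v: "\<And>\<theta>. trig v \<theta> = of_real (\<phi> \<theta>) * trig w \<theta>"
  shows "cinner w v = of_real (\<integral>\<theta>. \<phi> \<theta> * (cmod (trig w \<theta>))\<^sup>2 \<partial>torus)"
proof -
  have "cinner w v = (\<integral>\<theta>. cnj (trig w \<theta>) * trig v \<theta> \<partial>torus)"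
    by (rule integral_trig_trig[symmetric]) (rule w)+
  also have "\<dots> = (\<integral>\<theta>. complex_of_real (\<phi> \<theta> * (cmod (trig w \<theta>))\<^sup>2) \<partial>torus)"
    unfolding of_real_mult norm_sq_eq_cnj_mult by (simp add: v mult_ac)
  finally show ?thesis by (simp del: of_real_power of_real_mult)
qed

lemma compactly_supported_dil_commutator:
  "compactly_supported w \<Longrightarrow> compactly_supported (dil_commutator M r w)"
  unfolding dil_commutator_def
  by (intro compactly_supported_sum compactly_supported_scaleR compactly_supported_diff
      compactly_supported_shift)

lemma dil_commutator_form_real:
  fixes u :: "(int ^ 'd::finite) ell2"
  shows "Im (cinner u (dil_commutator M_9_14 r_9_14 u)) = 0"
proof (rule ell2_density_induct[where Q="\<lambda>u. Im (cinner u (dil_commutator M_9_14 r_9_14 u)) = 0"])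
  show "closed {u :: (int ^ 'd) ell2. Im (cinner u (dil_commutator M_9_14 r_9_14 u)) = 0}"
    by (intro closed_Collect_eq continuous_intros bounded_op_continuous_on bounded_op_dil_commutator)
  show "Im (cinner w (dil_commutator M_9_14 r_9_14 w)) = 0" if "compactly_supported w" for w :: "(int ^ 'd) ell2"
    using cinner_eq_integral_of_symbol[OF that compactly_supported_dil_commutator[OF that] trig_dil_commutator[OF that]]
    by simp
qed

text \<open>A pointwise inequality between symbols is an inequality between quadratic forms.\<close>
lemma dil_commutator_lower_bound:
  fixes u :: "(int ^ 'd::finite) ell2"
  assumes bound: "\<And>\<theta> :: 'd \<Rightarrow> real. c - K * (laplacian_symbol \<theta> - E)\<^sup>2 \<le> (\<Sum>i\<in>UNIV. commutator_symbol (cos (\<theta> i)))"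
  shows "c * (norm u)\<^sup>2 - K * (norm (laplacian u - E *\<^sub>R u))\<^sup>2 \<le> inner u (dil_commutator M_9_14 r_9_14 u)"
proof (rule ell2_density_induct[where Q="\<lambda>u. c * (norm u)\<^sup>2 - K * (norm (laplacian u - E *\<^sub>R u))\<^sup>2
    \<le> inner u (dil_commutator M_9_14 r_9_14 u)"])
  show "closed {u :: (int ^ 'd) ell2. c * (norm u)\<^sup>2 - K * (norm (laplacian u - E *\<^sub>R u))\<^sup>2
      \<le> inner u (dil_commutator M_9_14 r_9_14 u)}"
    by (intro closed_Collect_le continuous_intros bounded_op_continuous_on bounded_op_dil_commutator
        bounded_op_laplacian)
  fix w :: "(int ^ 'd) ell2" assume w: "compactly_supported w"
  let ?L = "laplacian w - E *\<^sub>R w" and ?C = "dil_commutator M_9_14 r_9_14 w"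
  have L: "compactly_supported ?L"
    by (intro compactly_supported_diff compactly_supported_laplacian compactly_supported_scaleR w)
  have tL: "trig ?L \<theta> = of_real (laplacian_symbol \<theta> - E) * trig w \<theta>" for \<theta>
    by (simp add: trig_diff trig_scaleR trig_laplacian w compactly_supported_laplacian
        compactly_supported_scaleR left_diff_distrib)
  have "(norm ?L)\<^sup>2 = (\<integral>\<theta>. (cmod (trig ?L \<theta>))\<^sup>2 \<partial>torus)"
    by (rule integral_norm_sq_trig[OF L, symmetric])
  have 1: "(cmod (trig ?L \<theta>))\<^sup>2 = (laplacian_symbol \<theta> - E)\<^sup>2 * (cmod (trig w \<theta>))\<^sup>2" for \<theta>
    unfolding tL norm_mult norm_of_real power_mult_distrib by simp
  have int: "integrable torus (\<lambda>\<theta>. (cmod (trig v \<theta>))\<^sup>2)" for v :: "(int ^ 'd) ell2"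
    by (rule integrable_norm_sq[OF bounded_measurable_trig])
  have int_C: "integrable torus (\<lambda>\<theta>. (\<Sum>i\<in>UNIV. commutator_symbol (cos (\<theta> i))) * (cmod (trig w \<theta>))\<^sup>2)"
  proof -
    have "integrable torus (\<lambda>\<theta>. Re (cnj (trig w \<theta>) * trig ?C \<theta>))"
      by (intro integrable_Re bounded_measurable_integrable bounded_measurable_intros)
    moreover have "cnj (trig w \<theta>) * trig ?C \<theta> = of_real ((\<Sum>i\<in>UNIV. commutator_symbol (cos (\<theta> i))) * (cmod (trig w \<theta>))\<^sup>2)" for \<theta>
      unfolding of_real_mult norm_sq_eq_cnj_mult trig_dil_commutator[OF w] by (simp add: mult_ac)
    ultimately show ?thesis by (simp only: Re_complex_of_real)
  qed
  have "c * (norm w)\<^sup>2 - K * (norm ?L)\<^sup>2 = (\<integral>\<theta>. c * (cmod (trig w \<theta>))\<^sup>2 - K * (cmod (trig ?L \<theta>))\<^sup>2 \<partial>torus)"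
    using int by (simp add: integral_norm_sq_trig w L)
  also have "\<dots> \<le> (\<integral>\<theta>. (\<Sum>i\<in>UNIV. commutator_symbol (cos (\<theta> i))) * (cmod (trig w \<theta>))\<^sup>2 \<partial>torus)"
  proof (rule integral_mono)
    fix \<theta> :: "'d \<Rightarrow> real"
    show "c * (cmod (trig w \<theta>))\<^sup>2 - K * (cmod (trig ?L \<theta>))\<^sup>2 \<le> (\<Sum>i\<in>UNIV. commutator_symbol (cos (\<theta> i))) * (cmod (trig w \<theta>))\<^sup>2"
      using mult_right_mono[OF bound[of \<theta>], of "(cmod (trig w \<theta>))\<^sup>2"]
      unfolding 1 by (simp add: left_diff_distrib mult.assoc)
  qed (use int int_C in auto)
  also have "\<dots> = inner w ?C"
    using cinner_eq_integral_of_symbol[OF w compactly_supported_dil_commutator[OF w] trig_dil_commutator[OF w]]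
    by (simp add: Re_cinner[symmetric])
  finally show "c * (norm w)\<^sup>2 - K * (norm ?L)\<^sup>2 \<le> inner w ?C" .
qed

section \<open>Positivity of the laplacian_symbol on the energy line\<close>

text \<open>
  Newton's identities express the sum through \<open>x + y = E\<close> and \<open>p = x y\<close> as \<open>(4/7) E q\<close>, where \<open>q\<close> is
  a concave quadratic polynomial in \<open>p\<close>. The product ranges over \<open>[E - 1, E\<^sup>2/4]\<close>, where the ends
  belong to \<open>x = 1\<close> or \<open>y = 1\<close> and to \<open>x = y\<close>, and \<open>q\<close> is positive at both.
\<close>
lemma commutator_symbol_sum_pos:
  assumes E: "2 / 3 < E" "E < 1" and xy: "\<bar>x\<bar> \<le> 1" "\<bar>y\<bar> \<le> 1" "x + y = E"
  shows "0 < commutator_symbol x + commutator_symbol y"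
proof -
  define p where "p = x * y"
  define a where "a = p - (E - 1)"
  define b where "b = E\<^sup>2 / 4 - p"
  define q where "q = - 45 * p\<^sup>2 + (45 * E\<^sup>2 - 30) * p - 9 * E ^ 4 + 10 * E\<^sup>2 - 1"
  define l where "l = (1 - E) * (2 - E) * ((3 * E - 2) * (4 - 3 * E))"
  define h where "h = (1 - E\<^sup>2 / 4) * (9 * E\<^sup>2 / 4 - 1)"
  have y: "y = E - x" using xy(3) by simp
  have sum: "commutator_symbol x + commutator_symbol y = 4 / 7 * (E * q)"
    unfolding commutator_symbol_def q_def p_def y
    by (simp add: field_simps power2_eq_square power3_eq_cube eval_nat_numeral)
  have "0 \<le> (1 - x) * (1 - y)" using xy by (intro mult_nonneg_nonneg) auto
  then have a: "0 \<le> a" unfolding a_def p_def using xy(3) by (simp add: algebra_simps)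
  have "0 \<le> (x - y)\<^sup>2" by simp
  then have b: "0 \<le> b" unfolding b_def p_def xy(3)[symmetric] by (simp add: power2_eq_square field_simps)
  have "a + b = (1 - E / 2)\<^sup>2" by (simp add: a_def b_def power2_eq_square field_simps)
  then have ab: "0 < a + b" using E by simp
  have l: "0 < l" unfolding l_def using E by (intro mult_pos_pos) auto
  have "E\<^sup>2 < 1" "4 / 9 < E\<^sup>2"
    using E power_strict_mono[of E 1 2] power_strict_mono[of "2 / 3" E 2] by (auto simp: power2_eq_square)
  then have h: "0 < h" unfolding h_def by (intro mult_pos_pos) auto
  \<comment> \<open>Interpolation between the values \<open>l\<close> and \<open>h\<close> of \<open>q\<close> at the two ends; the last term is the
    contribution of the leading coefficient \<open>- 45\<close>.\<close>
  have "q * (a + b) = l * b + h * a + 45 * (a * b) * (a + b)"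
    unfolding q_def l_def h_def a_def b_def by (simp add: field_simps power2_eq_square eval_nat_numeral)
  moreover have "0 < l * b + h * a"
  proof (cases "b = 0")
    case True
    then show ?thesis using ab h by simp
  next
    case False
    then have "0 < l * b" using b l by simp
    moreover have "0 \<le> h * a" using h a by simp
    ultimately show ?thesis by linarith
  qed
  moreover have "0 \<le> 45 * (a * b) * (a + b)" using a b by simp
  ultimately have "0 < q * (a + b)" by linarith
  then have "0 < q" using ab by (simp add: zero_less_mult_iff)
  then show ?thesis unfolding sum using E by simp
qed

text \<open>
  Positivity on the compact segment \<open>x + y = E\<close> of the square extends to the whole square at the
  price of a multiple of the squared distance to the line.
\<close>
lemma penalised_lower_bound:
  assumes E: "2 / 3 < E" "E < 1"
  obtains c K where "0 < c" "0 \<le> K"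
    "\<And>x y. \<bar>x\<bar> \<le> 1 \<Longrightarrow> \<bar>y\<bar> \<le> 1 \<Longrightarrow> c - K * (x + y - E)\<^sup>2 \<le> commutator_symbol x + commutator_symbol y"
proof -
  define S where "S = {-1..1::real} \<times> {-1..1::real}"
  define F where "F p = commutator_symbol (fst p) + commutator_symbol (snd p)" for p
  define L where "L p = (fst p + snd p - E)\<^sup>2" for p
  have cont: "continuous_on A F" "continuous_on A L" for A
    unfolding F_def L_def commutator_symbol_def by (intro continuous_intros)+
  have S: "compact S" unfolding S_def by (intro compact_Times compact_Icc)
  have zero: "compact (S \<inter> {p. L p = 0})"
    by (intro compact_Int_closed S closed_Collect_eq cont continuous_on_const)
  \<comment> \<open>The end of the segment at \<open>x = 1\<close> shows that it is nonempty.\<close>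
  have "(1, E - 1) \<in> S \<inter> {p. L p = 0}" using E by (simp add: S_def L_def)
  then obtain p0 where p0: "p0 \<in> S \<inter> {p. L p = 0}" "\<And>p. p \<in> S \<inter> {p. L p = 0} \<Longrightarrow> F p0 \<le> F p"
    using continuous_attains_inf[OF zero _ cont(1)] by blast
  have pos: "0 < F p0"
    using p0(1) commutator_symbol_sum_pos[OF E, of "fst p0" "snd p0"] by (auto simp: S_def F_def L_def abs_le_iff)
  define c where "c = F p0 / 2"
  have c: "0 < c" using pos by (simp add: c_def)
  have bad: "compact (S \<inter> {p. F p \<le> c})"
    by (intro compact_Int_closed S closed_Collect_le cont continuous_on_const)
  have "\<exists>K\<ge>0. \<forall>p\<in>S. c - K * L p \<le> F p"
  proof (cases "S \<inter> {p. F p \<le> c} = {}")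
    case True
    then show ?thesis by (intro exI[of _ 0]) force
  next
    case False
    obtain p1 where p1: "p1 \<in> S \<inter> {p. F p \<le> c}" "\<And>p. p \<in> S \<inter> {p. F p \<le> c} \<Longrightarrow> L p1 \<le> L p"
      using continuous_attains_inf[OF bad False cont(2)] by blast
    obtain p2 where p2: "\<And>p. p \<in> S \<inter> {p. F p \<le> c} \<Longrightarrow> F p2 \<le> F p" "p2 \<in> S \<inter> {p. F p \<le> c}"
      using continuous_attains_inf[OF bad False cont(1)] by blast
    have "L p1 \<noteq> 0" using p0(2)[of p1] p1(1) c by (auto simp: c_def)
    then have L1: "0 < L p1" using zero_le_power2 by (simp add: L_def)
    define K where "K = (c - F p2) / L p1"
    have K: "0 \<le> K" using p2(2) L1 by (simp add: K_def)
    have "c - K * L p \<le> F p" if "p \<in> S" for p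
    proof (cases "F p \<le> c")
      case True
      then have p: "p \<in> S \<inter> {p. F p \<le> c}" using that by simp
      have "c - F p2 = K * L p1" using L1 by (simp add: K_def)
      also have "\<dots> \<le> K * L p" using p1(2)[OF p] K by (rule mult_left_mono)
      finally show ?thesis using p2(1)[OF p] by linarith
    next
      case False
      moreover have "0 \<le> K * L p" using K by (simp add: L_def)
      ultimately show ?thesis by linarith
    qed
    then show ?thesis using K by blast
  qed
  then obtain K where "0 \<le> K" "\<forall>p\<in>S. c - K * L p \<le> F p" by blast
  then show thesis using c
    by (intro that[of c K]) (auto simp: S_def L_def F_def abs_le_iff)
qed

section \<open>The spectrum of the Laplacian\<close>

lemma abs_cos_diff_le: "\<bar>cos x - cos y\<bar> \<le> \<bar>x - y\<bar>" for x y :: real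
proof -
  have "\<bar>cos x - cos y\<bar> = 2 * (\<bar>sin ((x + y) / 2)\<bar> * \<bar>sin ((y - x) / 2)\<bar>)"
    unfolding cos_diff_cos by (simp add: abs_mult)
  also have "\<dots> \<le> 2 * (1 * \<bar>(y - x) / 2\<bar>)"
    by (intro mult_left_mono mult_mono abs_sin_le_one abs_sin_x_le_abs_x) auto
  finally show ?thesis by simp
qed

lemma measure_symbol_interval_pos:
  fixes E :: real
  assumes E: "\<bar>E\<bar> \<le> real CARD('d::finite)" and e: "0 < e"
  shows "0 < measure torus (symbol_set {E - e<..<E + e} :: ('d \<Rightarrow> real) set)"
proof -
  define N where "N = real CARD('d)"
  have N: "0 < N" by (simp add: N_def)
  define t where "t = arccos (E / N)"
  have "- 1 \<le> E / N" "E / N \<le> 1"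
    using E N unfolding N_def[symmetric] by (auto simp: abs_le_iff field_simps)
  then have t: "0 \<le> t" "t \<le> pi" "cos t = E / N"
    unfolding t_def by (auto intro!: arccos_lbound arccos_ubound cos_arccos)
  \<comment> \<open>At \<open>(t, \<dots>, t)\<close> the symbol equals \<open>E\<close>; the bound \<open>pi\<close> keeps the box inside the period.\<close>
  define d where "d = min pi (e / (2 * N))"
  have d: "0 < d" "d \<le> pi" "d \<le> e / (2 * N)" using e N by (auto simp: d_def)
  define X where "X = (\<Pi>\<^sub>E i\<in>(UNIV :: 'd set). {t..t + d})"
  have "X \<subseteq> symbol_set {E - e<..<E + e}"
  proof
    fix \<theta> assume "\<theta> \<in> X"
    then have \<theta>: "\<bar>\<theta> i - t\<bar> \<le> d" for i by (auto simp: X_def abs_le_iff PiE_iff algebra_simps)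
    have "laplacian_symbol \<theta> - E = (\<Sum>i\<in>(UNIV :: 'd set). cos (\<theta> i) - cos t)"
      using N by (simp add: laplacian_symbol_def sum_subtractf t N_def)
    also have "\<bar>\<dots>\<bar> \<le> (\<Sum>i\<in>(UNIV :: 'd set). d)"
      by (intro order_trans[OF sum_abs] sum_mono order_trans[OF abs_cos_diff_le \<theta>])
    also have "\<dots> \<le> e / 2" using d(3) N by (simp add: N_def field_simps)
    finally have "\<bar>laplacian_symbol \<theta> - E\<bar> < e" using e by simp
    then show "\<theta> \<in> symbol_set {E - e<..<E + e}" by (auto simp: symbol_set_def abs_less_iff)
  qed
  moreover have "0 < emeasure torus X"
  proof -
    interpret circle: prob_space circle_measure by (rule prob_space_circle)
    interpret product_sigma_finite "\<lambda>_. circle_measure" ..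
    have "emeasure torus X = (\<Prod>i\<in>(UNIV :: 'd set). emeasure circle_measure {t..t + d})"
      unfolding torus_def X_def by (rule emeasure_PiM) auto
    moreover have "emeasure circle_measure {t..t + d} = ennreal (d / (2 * pi))"
    proof -
      have "{0..2 * pi} \<inter> {t..t + d} = {t..t + d}" using t d by auto
      then show ?thesis
        unfolding circle_measure_def using d(1)
        by (subst emeasure_uniform_measure) (auto simp: divide_ennreal)
    qed
    ultimately show ?thesis using d(1) by (simp add: ennreal_zero_less_divide prod_pos zero_less_iff_neq_zero)
  qed
  ultimately have "0 < emeasure torus (symbol_set {E - e<..<E + e} :: ('d \<Rightarrow> real) set)"
    using emeasure_mono[of X "symbol_set {E - e<..<E + e}" torus] symbol_set_measurable
    by (meson borel_open open_greaterThanLessThan order_less_le_trans)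
  then show ?thesis by (simp add: torus.emeasure_eq_measure)
qed

text \<open>
  The spectral projection of a small interval around \<open>E\<close> maps the delta sequence at the origin to
  an approximate eigenvector; it is nonzero because the laplacian_symbol takes values in the interval on a
  set of positive measure.
\<close>
lemma spectrum_laplacian:
  assumes E: "\<bar>E\<bar> \<le> real CARD('d::finite)"
  shows "complex_of_real E \<in> spectrum (laplacian :: (int ^ 'd) ell2 \<Rightarrow> (int ^ 'd) ell2)"
proof (rule ccontr)
  let ?z = "complex_of_real E"
  assume "\<not> ?thesis"
  then obtain R where R: "bounded_op R" "\<And>u :: (int ^ 'd) ell2. R (laplacian u - ?z *\<^sub>C u) = u"
    by (auto simp: spectrum_def)
  obtain b where b: "0 < b" "\<And>u. norm (R u) \<le> norm u * b"
    using bounded_linear.pos_bounded[OF bounded_opD(1)[OF R(1)]] by blast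
  define e where "e = 1 / (2 * b)"
  have e: "0 < e" using b(1) by (simp add: e_def)
  define I where "I = {E - e<..<E + e}"
  have I: "I \<in> sets borel" "I \<subseteq> {E - e..E + e}" by (auto simp: I_def)
  interpret pvm "laplacian_pvm :: real set \<Rightarrow> (int ^ 'd) ell2 \<Rightarrow> (int ^ 'd) ell2" by (rule pvm_laplacian)
  define v where "v = laplacian_pvm I (delta (0 :: int ^ 'd))"
  have "(norm v)\<^sup>2 = inner (delta 0) (laplacian_pvm I (delta (0 :: int ^ 'd)))"
    unfolding v_def by (rule norm_sq_P[OF I(1)])
  also have "\<dots> = (\<integral>\<theta>. (cmod (mask (symbol_set I) (trig (delta (0 :: int ^ 'd))) \<theta>))\<^sup>2 \<partial>torus)"
    unfolding laplacian_pvm_def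
    by (rule inner_torus_proj[OF symbol_set_measurable[OF I(1)] compactly_supported_delta])
  also have "\<dots> = (\<integral>\<theta>. indicator (symbol_set I :: ('d \<Rightarrow> real) set) \<theta> \<partial>torus)"
    by (intro Bochner_Integration.integral_cong) (auto simp: mask_def norm_mult split: split_indicator)
  also have "\<dots> = measure torus (symbol_set I :: ('d \<Rightarrow> real) set)"
    using symbol_set_measurable[OF I(1)] by simp
  also have "0 < \<dots>" unfolding I_def by (rule measure_symbol_interval_pos[OF E e])
  finally have v0: "0 < norm v" by simp
  have "laplacian_pvm I v = v" unfolding v_def by (rule P_idem[OF I(1)])
  then have small: "norm (laplacian v - E *\<^sub>R v) \<le> e * norm v"
    by (intro spectral_localisation[OF is_spectral_measure_laplacian _ _ I])
       (auto simp: bounded_opD(2)[OF bounded_op_laplacian] Re_cinner[symmetric] laplacian_symmetric)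
  have "norm v = norm (R (laplacian v - E *\<^sub>R v))"
    using R(2)[of v] by (simp add: scaleR_eq_cscale)
  also have "\<dots> \<le> e * norm v * b"
    using b(2)[of "laplacian v - E *\<^sub>R v"] mult_right_mono[OF small, of b] b(1) by linarith
  also have "\<dots> = norm v / 2" using b(1) by (simp add: e_def)
  finally show False using v0 by simp
qed

section \<open>The Mourre estimate\<close>

text \<open>
  The radius \<open>e\<close> of the interval is chosen with \<open>K e\<^sup>2 \<le> c / 2\<close>, so that the penalty term costs at
  most half of the constant \<open>c\<close>.
\<close>
lemma mourre_estimate_laplacian:
  assumes E: "2 / 3 < E" "E < 1"
  shows "\<exists>a b \<gamma>. E \<in> {a<..<b} \<and> 0 < \<gamma> \<and>
    mourre_estimate laplacian (dil_commutator M_9_14 r_9_14 :: (int ^ 2) ell2 \<Rightarrow> (int ^ 2) ell2) {a<..<b} \<gamma>"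
proof -
  obtain c K where c: "0 < c" and K: "0 \<le> K"
    and bound: "\<And>x y. \<bar>x\<bar> \<le> 1 \<Longrightarrow> \<bar>y\<bar> \<le> 1 \<Longrightarrow> c - K * (x + y - E)\<^sup>2 \<le> commutator_symbol x + commutator_symbol y"
    using penalised_lower_bound[OF E] by blast
  define e where "e = sqrt (c / (2 * (K + 1)))"
  have e: "0 < e" using c K by (simp add: e_def)
  have "K * e\<^sup>2 \<le> (K + 1) * e\<^sup>2" by (simp add: mult_right_mono)
  also have "\<dots> = c / 2" using c K by (simp add: e_def field_simps)
  finally have Ke: "K * e\<^sup>2 \<le> c / 2" .
  define I where "I = {E - e<..<E + e}"
  have I: "I \<in> sets borel" "I \<subseteq> {E - e..E + e}" by (auto simp: I_def)
  let ?C = "dil_commutator M_9_14 r_9_14 :: (int ^ 2) ell2 \<Rightarrow> (int ^ 2) ell2"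
  define P where "P = spectral_projection (laplacian :: (int ^ 2) ell2 \<Rightarrow> (int ^ 2) ell2)"
  have P: "is_spectral_measure laplacian P"
    unfolding P_def spectral_projection_def 
    by (rule someI[where P="is_spectral_measure laplacian"]) (rule is_spectral_measure_laplacian)
  interpret pvm P using P by (simp add: is_spectral_measure_iff)
  have adj: "cinner u (P I v) = cinner (P I u) v" for u v
    using proj[OF I(1)] by (simp add: orthogonal_projection_def)
  have form: "cinner u (P I (?C (P I u)) - (c / 2) *\<^sub>R P I u) =
      cinner (P I u) (?C (P I u)) - of_real (c / 2 * (norm (P I u))\<^sup>2)" for u
  proof -
    have "cinner u (P I u) = cinner (P I u) (P I u)"
      using adj[of u "P I u"] by (simp add: P_idem[OF I(1)])
    then show ?thesis
      by (simp only: cinner_diff_right cinner_scaleR_right adj cinner_self_norm of_real_mult)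
  qed
  have est: "c / 2 * (norm v)\<^sup>2 \<le> inner v (?C v)" if v: "P I v = v" for v
  proof -
    have "norm (laplacian v - E *\<^sub>R v) \<le> e * norm v"
      by (intro spectral_localisation[OF P _ _ I v])
         (auto simp: bounded_opD(2)[OF bounded_op_laplacian] Re_cinner[symmetric] laplacian_symmetric)
    then have "(norm (laplacian v - E *\<^sub>R v))\<^sup>2 \<le> (e * norm v)\<^sup>2" by (intro power_mono) auto
    then have "K * (norm (laplacian v - E *\<^sub>R v))\<^sup>2 \<le> K * e\<^sup>2 * (norm v)\<^sup>2"
      using K by (simp add: power_mult_distrib mult_left_mono mult.assoc)
    also have "\<dots> \<le> c / 2 * (norm v)\<^sup>2" using Ke by (rule mult_right_mono) simp
    finally have "c / 2 * (norm v)\<^sup>2 \<le> c * (norm v)\<^sup>2 - K * (norm (laplacian v - E *\<^sub>R v))\<^sup>2"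
      by (simp add: field_simps)
    also have "\<dots> \<le> inner v (?C v)"
      by (rule dil_commutator_lower_bound) (simp add: laplacian_symbol_def sum_2 bound)
    finally show ?thesis .
  qed
  have "mourre_estimate laplacian ?C I (c / 2)"
    unfolding mourre_estimate_def op_le_def P_def[symmetric] form
  proof (intro allI conjI)
    fix u :: "(int ^ 2) ell2"
    show "cinner (P I u) (?C (P I u)) - of_real (c / 2 * (norm (P I u))\<^sup>2) \<in> \<real>"
      by (simp add: complex_is_Real_iff dil_commutator_form_real)
    show "0 \<le> Re (cinner (P I u) (?C (P I u)) - of_real (c / 2 * (norm (P I u))\<^sup>2))"
      using est[of "P I u"] by (simp add: Re_cinner P_idem[OF I(1)])
  qed
  then show ?thesis
    unfolding I_def using c e by (intro exI[of _ "E - e"] exI[of _ "E + e"] exI[of _ "c / 2"]) auto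
qed

text \<open>
  The equation for \<open>T2\<close> says \<open>E - 1 = \<plusminus> E/2\<close>, and the sign conditions select the minus sign.
\<close>
lemma is_E1_iff: "is_E1 E \<longleftrightarrow> E = 2 / 3"
proof
  assume "is_E1 E"
  then have E: "0 < E" "E < 1" "T2 (E - 1) = T2 (E / 2)"
    by (auto simp: is_E1_def)
  then have "(E - 1)\<^sup>2 = (E / 2)\<^sup>2" by (simp add: T2_def)
  then have "E - 1 = E / 2 \<or> E - 1 = - (E / 2)" by (rule power2_eq_iff[THEN iffD1])
  then show "E = 2 / 3" using E by auto
next
  assume E: "E = 2 / 3"
  show "is_E1 E"
    unfolding is_E1_def E
    by (intro conjI exI[of _ "- 1 / 3"] exI[of _ "1 / 3"] exI[of _ 1])
       (simp_all add: T2_def power2_eq_square)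
qed

theorem theorem1p10:
  shows "E0 = 1 \<and> (\<exists>!E. is_E1 E) \<and> {2 / 3<..<1} = {E1<..<E0} \<and>
    {E1<..<E0} \<subseteq> mu_set 2 (laplacian :: (int ^ 2) ell2 \<Rightarrow> (int ^ 2) ell2) \<and>
    self_adjoint (conj_op 2 rho_9_14 :: (int ^ 2) graph) \<and>
    (\<exists>C. is_commutator_ext laplacian (conj_op 2 rho_9_14 :: (int ^ 2) graph) C \<and>
      (\<forall>E\<in>{E1<..<E0}. \<exists>a b \<gamma>. E \<in> {a<..<b} \<and> 0 < \<gamma> \<and>
        mourre_estimate laplacian C {a<..<b} \<gamma>))"
proof -
  have E0: "E0 = 1" by (simp add: E0_def)
  have E1: "E1 = 2 / 3" unfolding E1_def by (rule the_equality) (simp_all add: is_E1_iff)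
  have "E \<in> mu_set 2 (laplacian :: (int ^ 2) ell2 \<Rightarrow> (int ^ 2) ell2)" if "E \<in> {2 / 3<..<1}" for E
  proof -
    have "complex_of_real E \<in> spectrum (laplacian :: (int ^ 2) ell2 \<Rightarrow> (int ^ 2) ell2)"
      using that by (intro spectrum_laplacian) (simp add: abs_le_iff)
    then show ?thesis
      unfolding mu_set_def
      using mourre_estimate_laplacian[of E] that self_adjoint_conj_op_9_14 is_commutator_ext_9_14
      by simp blast
  qed
  moreover have "\<exists>!E. is_E1 E" by (rule ex1I[of _ "2 / 3"]) (simp_all add: is_E1_iff)
  ultimately show ?thesis
    unfolding E0 E1
    using self_adjoint_conj_op_9_14 is_commutator_ext_9_14 mourre_estimate_laplacian by auto
qed

end
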